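(* Let $L(\lambda)$ be a regular $n\times n$ (complex) symmetric matrix pencil and let $\lambda_1,\dots,\lambda_\kappa$ denote the pairwise distinct eigenvalues (finite or infinite) of $L(\lambda)$, having the partial multiplicities $n_{i,1}\geq\dots\geq n_{i,g_i}>0$ for $i=1,\dots,\kappa$, respectively. Let $r$ be a positive integer, let $0\leq s\leq\lfloor r/2\rfloor$, $\ell=r-2s$, and let $\Phi_s$ be the map on $\mathbb C^{2\ell+(r+s)n}$ defined in the context. Then there exists a generic set $\mathcal G_s$ in $\mathbb C^{2\ell+(r+s)n}$ such that, for all $E(\lambda)\in\Phi_s(\mathcal G_s)$, the perturbed pencil $L+E$ is regular and, for $i=1,\dots,\kappa$, the partial multiplicities of $L+E$ at $\lambda_i$ are given by $n_{i,r+1}\geq\cdots\geq n_{i,g_i}$. (In particular, if $r\geq g_i$ then $\lambda_i$ is not an eigenvalue of $L+E$.) Furthermore, all eigenvalues of $L+E$ that are different from those of $L$ are simple.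
   Context: A matrix pencil $L(\lambda)=A+\lambda B$ with $A,B\in\mathbb C^{n\times n}$ is symmetric if $A=A^\top$ and $B=B^\top$; it is regular if $\det L(\lambda)\not\equiv 0$. For a regular pencil, a finite eigenvalue is a root of $\det L(\lambda)$; $\infty$ is an eigenvalue if $0$ is an eigenvalue of the reversal $\operatorname{rev}L(\lambda)=B+\lambda A$. The partial multiplicities of a regular pencil at an eigenvalue are the sizes of the corresponding Jordan blocks in its Weierstrass canonical form (at $\infty$: the partial multiplicities of $\operatorname{rev}L$ at $0$); the algebraic multiplicity is their sum, and an eigenvalue is simple if its algebraic multiplicity is $1$. The map $\Phi_s$ is defined on $\mathbb C^{2\ell+(r+s)n}$, $\ell=r-2s$: a point consists of complex numbers $a_1,b_1,\dots,a_\ell,b_\ell$ and of vectors $u_1,\dots,u_\ell,v_1,\dots,v_s,\gamma_1,\dots,\gamma_s,\delta_1,\dots,\delta_s\in\mathbb C^n$ (note $(\ell+3s)n=(r+s)n$), and is mapped to the symmetric pencil $$\sum_{i=1}^{\ell}(a_i+\lambda b_i)u_iu_i^\top+\sum_{j=1}^{s}\big(v_jw_j^\top+w_jv_j^\top\big),\qquad w_j(\lambda)=\gamma_j+\lambda\delta_j .$$ Genericity: a subset of $\mathbb C^m$ is generic if its complement is contained in a proper algebraic set, i.e., in a set of common zeros of finitely many complex polynomials in $m$ variables that is not all of $\mathbb C^m$. *)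

theory Defs
  imports
    "Jordan_Normal_Form.Jordan_Normal_Form"
    "HOL-Library.Poly_Mapping"
    "HOL-Library.Product_Plus"
    "HOL.Complex"
begin

(* The pair (A, B) stands for the pencil A + x B; sums of pencils are those of Product_Plus. *)
type_synonym pencil = "complex mat \<times> complex mat"

definition symmetric_pencils :: "nat \<Rightarrow> pencil set" where
  "symmetric_pencils n = {(A, B). A \<in> carrier_mat n n \<and> B \<in> carrier_mat n n \<and>
     transpose_mat A = A \<and> transpose_mat B = B}"

definition pencil_det :: "pencil \<Rightarrow> complex poly" where
  "pencil_det L = (case L of (A, B) \<Rightarrow>
     det (mat (dim_row A) (dim_col A) (\<lambda>(i, j). [: A $$ (i, j), B $$ (i, j) :])))"

definition regular_pencil :: "pencil \<Rightarrow> bool" where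
  "regular_pencil L \<longleftrightarrow> pencil_det L \<noteq> 0"

definition rev_pencil :: "pencil \<Rightarrow> pencil" where
  "rev_pencil L = (case L of (A, B) \<Rightarrow> (B, A))"

datatype eigval = Finite complex | Infinity

fun is_eigenvalue :: "pencil \<Rightarrow> eigval \<Rightarrow> bool" where
  "is_eigenvalue L (Finite z) \<longleftrightarrow> poly (pencil_det L) z = 0"
| "is_eigenvalue L Infinity \<longleftrightarrow> poly (pencil_det (rev_pencil L)) 0 = 0"

definition eigenvalues_of :: "pencil \<Rightarrow> eigval set" where
  "eigenvalues_of L = {z. is_eigenvalue L z}"

(* The canonical form has the blocks J_k(a) - x I_k, one for each (k, a) in bs (finite eigenvalues),
   and I_k - x J_k(0), one for each k in ks (infinite eigenvalue). *)
definition weierstrass_form :: "pencil \<Rightarrow> (nat \<times> complex) list \<Rightarrow> nat list \<Rightarrow> bool" where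
  "weierstrass_form L bs ks \<longleftrightarrow> 0 \<notin> fst ` set bs \<and> 0 \<notin> set ks \<and>
     (\<exists>n A B P Q. L = (A, B) \<and>
        A \<in> carrier_mat n n \<and> B \<in> carrier_mat n n \<and>
        P \<in> carrier_mat n n \<and> Q \<in> carrier_mat n n \<and>
        invertible_mat P \<and> invertible_mat Q \<and>
        P * A * Q = diag_block_mat [jordan_matrix bs, 1\<^sub>m (sum_list ks)] \<and>
        P * B * Q = - diag_block_mat [1\<^sub>m (sum_list (map fst bs)),
                                      jordan_matrix (map (\<lambda>k. (k, 0)) ks)])"

(* The list is in non-increasing order. Every regular pencil has a Weierstrass form, and the form is
   unique up to the order of the blocks, so for regular pencils the choice made here is immaterial.
   The list is empty at points that are not eigenvalues. *)
definition finite_partial_mults :: "pencil \<Rightarrow> complex \<Rightarrow> nat list" where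
  "finite_partial_mults L z =
     (let bs = (SOME bs. \<exists>ks. weierstrass_form L bs ks)
      in rev (sort (map fst (filter (\<lambda>(k, a). a = z) bs))))"

fun partial_mults :: "pencil \<Rightarrow> eigval \<Rightarrow> nat list" where
  "partial_mults L (Finite z) = finite_partial_mults L z"
| "partial_mults L Infinity = finite_partial_mults (rev_pencil L) 0"

definition alg_mult :: "pencil \<Rightarrow> eigval \<Rightarrow> nat" where
  "alg_mult L z = sum_list (partial_mults L z)"

definition simple_eigenvalue :: "pencil \<Rightarrow> eigval \<Rightarrow> bool" where
  "simple_eigenvalue L z \<longleftrightarrow> is_eigenvalue L z \<and> alg_mult L z = 1"

(* Polynomials map monomials to coefficients; a monomial maps variables to exponents. *)
type_synonym mpoly = "(nat \<Rightarrow>\<^sub>0 nat) \<Rightarrow>\<^sub>0 complex"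

definition mpolys :: "nat \<Rightarrow> mpoly set" where
  "mpolys m = {p. \<forall>e \<in> Poly_Mapping.keys p. Poly_Mapping.keys e \<subseteq> {..<m}}"

definition mpoly_eval :: "mpoly \<Rightarrow> complex vec \<Rightarrow> complex" where
  "mpoly_eval p x = (\<Sum>e \<in> Poly_Mapping.keys p. Poly_Mapping.lookup p e *
     (\<Prod>i \<in> Poly_Mapping.keys e. x $ i ^ Poly_Mapping.lookup e i))"

definition algebraic_set :: "nat \<Rightarrow> complex vec set \<Rightarrow> bool" where
  "algebraic_set m Z \<longleftrightarrow>
     (\<exists>F. finite F \<and> F \<subseteq> mpolys m \<and> Z = {x \<in> carrier_vec m. \<forall>p \<in> F. mpoly_eval p x = 0})"

definition generic :: "nat \<Rightarrow> complex vec set \<Rightarrow> bool" where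
  "generic m G \<longleftrightarrow> G \<subseteq> carrier_vec m \<and>
     (\<exists>Z. algebraic_set m Z \<and> Z \<noteq> carrier_vec m \<and> carrier_vec m - G \<subseteq> Z)"

(* Coordinates of a point x, with l = r - 2 s, all indices counted from 0:
   a_0, b_0, ..., a_(l-1), b_(l-1) come first; they are followed by l + 3 s = r + s vectors of
   length n, in the order u_0, ..., v_0, ..., gamma_0, ..., delta_0, .... *)
definition nth_block :: "nat \<Rightarrow> nat \<Rightarrow> complex vec \<Rightarrow> nat \<Rightarrow> complex vec" where
  "nth_block n l x k = vec n (\<lambda>p. x $ (2 * l + k * n + p))"

definition Phi :: "nat \<Rightarrow> nat \<Rightarrow> nat \<Rightarrow> complex vec \<Rightarrow> pencil" where
  "Phi n r s x =
    (let l = r - 2 * s;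
         a = (\<lambda>i. x $ (2 * i));
         b = (\<lambda>i. x $ (2 * i + 1));
         u = (\<lambda>i. nth_block n l x i);
         v = (\<lambda>j. nth_block n l x (l + j));
         \<gamma> = (\<lambda>j. nth_block n l x (l + s + j));
         \<delta> = (\<lambda>j. nth_block n l x (l + 2 * s + j));
         S = (\<lambda>c w. mat n n (\<lambda>(p, q). (\<Sum>i<l. c i * (u i $ p * u i $ q)) +
                (\<Sum>j<s. v j $ p * w j $ q + w j $ p * v j $ q)))
     in (S a \<gamma>, S b \<delta>))"

end

theory Submission
  imports Defs "Jordan_Normal_Form.Jordan_Normal_Form_Existence" "HOL-Computational_Algebra.Field_as_Ring"
begin

text \<open>
Infinity is treated as the point \<open>0\<close> of the reversed pencil. Fix a point \<open>z\<close>, put \<open>t = x - z\<close>, and call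
a polynomial vector \<open>f\<close> a chain of length \<open>k\<close> if \<open>t\<^sup>k\<close> divides \<open>L f\<close>. The values \<open>f(z)\<close> of these chains form
the root space of order \<open>k\<close>. Its dimension is the number of partial multiplicities \<open>\<ge> k\<close> at \<open>z\<close>, and the
sum of the partial multiplicities is the order of \<open>det L\<close> at \<open>z\<close> (\<open>weierstrass_form_root_data\<close>).

Every value \<open>E\<close> of \<open>Phi\<close> is a sum of \<open>r\<close> terms \<open>u w\<^sup>T\<close> with polynomial vectors \<open>u\<close> and \<open>w\<close>. One such term
lowers the dimension of a root space by at most one, because \<open>w\<^sup>T f = 0\<close> is a single condition on the
chains. It follows that the \<open>j\<close>-th partial multiplicity of \<open>L + E\<close> is at least the \<open>(j + r)\<close>-th one of
\<open>L\<close>. If \<open>N\<^sub>z\<close> is the sum of all but the \<open>r\<close> largest partial multiplicities of \<open>L\<close> at \<open>z\<close>, then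
\<open>det (L + E)\<close> has order at least \<open>N\<^sub>z\<close> at \<open>z\<close>, and if the order is \<open>N\<^sub>z\<close>, then all partial multiplicities of
\<open>L + E\<close> at \<open>z\<close> are as claimed (\<open>partial_mults_interlacing\<close>).

So only the determinant matters. It is \<open>G h\<close>, where \<open>G\<close> is the product of the powers \<open>t\<close> to the \<open>N\<^sub>z\<close>
over the finite eigenvalues \<open>z\<close> of \<open>L\<close> and the degree of \<open>h\<close> has a bound \<open>d\<close> that comes from infinity. The
theorem holds for \<open>E\<close> as soon as \<open>h\<close> does not vanish at the finite eigenvalues of \<open>L\<close>, has degree \<open>d\<close>, and
has only simple roots. As the coefficients of \<open>h\<close> are polynomials in the parameters, this is
the nonvanishing of a polynomial in the parameters; the condition on the roots is expressed by the
determinant of a Sylvester matrix. What is left is to find a single parameter at which the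
polynomial does not vanish.

Such a parameter is found among the perturbations \<open>(x - c) S\<close> with \<open>S\<close> a sum of \<open>r\<close> squares \<open>p p\<^sup>T\<close>, where
\<open>c\<close> is not an eigenvalue of \<open>L\<close>; they lie in the range of \<open>Phi\<close> for every \<open>s\<close> (\<open>Phi_attains_gram\<close>).
By induction on \<open>r\<close> it is enough to add one square (\<open>rank_one_step\<close>). Here
\<open>det (L + (x - c) p p\<^sup>T) = det L + (x - c) p\<^sup>T adj(L) p\<close>. The order of the second summand at \<open>z\<close> is as small
as interlacing permits for almost all \<open>p\<close>. This is the place where the symmetry of \<open>L\<close> enters: a
nonzero symmetric matrix has a nonzero quadratic form (\<open>rank_one_coeff_at_nonzero\<close>). If \<open>p\<close> is
multiplied by a scalar, then after division by \<open>G\<close> the determinant runs through a family \<open>m + \<epsilon> \<phi>\<close>.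
The new multiple roots occur at zeros of the Wronskian of \<open>m\<close> and \<open>\<phi>\<close>, and hence for finitely many
\<open>\<epsilon>\<close> only.
\<close>

section \<open>Polynomial functions and generic sets\<close>

text \<open>
Genericity is stated with formal polynomials. Sums, products and determinants are easier to
handle through the functions that these polynomials define.
\<close>

definition polyfun :: "nat \<Rightarrow> (complex vec \<Rightarrow> complex) \<Rightarrow> bool" where
  "polyfun m f \<longleftrightarrow> (\<exists>p \<in> mpolys m. \<forall>x. f x = mpoly_eval p x)"

definition monom_fun :: "(nat \<Rightarrow>\<^sub>0 nat) \<Rightarrow> complex vec \<Rightarrow> complex" where
  "monom_fun e x = (\<Prod>i \<in> Poly_Mapping.keys e. x $ i ^ Poly_Mapping.lookup e i)"

lemma monom_fun_superset:
  assumes "finite K" "Poly_Mapping.keys e \<subseteq> K"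
  shows "monom_fun e x = (\<Prod>i \<in> K. x $ i ^ Poly_Mapping.lookup e i)"
  unfolding monom_fun_def using assms
  by (intro prod.mono_neutral_left) (auto simp: in_keys_iff)

lemma monom_fun_add: "monom_fun (e + e') x = monom_fun e x * monom_fun e' x"
proof -
  let ?K = "Poly_Mapping.keys e \<union> Poly_Mapping.keys e'"
  have "Poly_Mapping.keys (e + e') \<subseteq> ?K" by (rule keys_add)
  then show ?thesis
    by (simp add: monom_fun_superset[of ?K] lookup_add power_add prod.distrib)
qed

lemma mpoly_eval_superset:
  assumes "finite S" "Poly_Mapping.keys p \<subseteq> S"
  shows "mpoly_eval p x = (\<Sum>e \<in> S. Poly_Mapping.lookup p e * monom_fun e x)"
  unfolding mpoly_eval_def monom_fun_def[symmetric] using assms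
  by (intro sum.mono_neutral_left) (auto simp: in_keys_iff)

lemma polyfun_monom:
  assumes "Poly_Mapping.keys e \<subseteq> {..<m}"
  shows "polyfun m (\<lambda>x. c * monom_fun e x)"
  unfolding polyfun_def
proof (intro bexI allI)
  show "Poly_Mapping.single e c \<in> mpolys m" using assms by (auto simp: mpolys_def)
  show "c * monom_fun e x = mpoly_eval (Poly_Mapping.single e c) x" for x
    by (subst mpoly_eval_superset[of "{e}"]) auto
qed

lemma polyfun_const: "polyfun m (\<lambda>x. c)"
  using polyfun_monom[of 0 m c] by (simp add: monom_fun_def)

lemma polyfun_coord: "i < m \<Longrightarrow> polyfun m (\<lambda>x. x $ i)"
  using polyfun_monom[of "Poly_Mapping.single i 1" m 1] by (simp add: monom_fun_def)

lemma polyfun_add: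
  assumes "polyfun m f" "polyfun m g"
  shows "polyfun m (\<lambda>x. f x + g x)"
proof -
  obtain p q where p: "p \<in> mpolys m" "\<And>x. f x = mpoly_eval p x"
    and q: "q \<in> mpolys m" "\<And>x. g x = mpoly_eval q x"
    using assms unfolding polyfun_def by auto
  let ?S = "Poly_Mapping.keys p \<union> Poly_Mapping.keys q"
  have sub: "Poly_Mapping.keys (p + q) \<subseteq> ?S" by (rule keys_add)
  have "p + q \<in> mpolys m" using p q sub unfolding mpolys_def by blast
  moreover have "f x + g x = mpoly_eval (p + q) x" for x
    using sub by (simp add: p q mpoly_eval_superset[of ?S] lookup_add algebra_simps sum.distrib)
  ultimately show ?thesis unfolding polyfun_def by auto
qed

lemma polyfun_sum: "(\<And>i. i \<in> A \<Longrightarrow> polyfun m (f i)) \<Longrightarrow> polyfun m (\<lambda>x. \<Sum>i\<in>A. f i x)"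
proof (induction A rule: infinite_finite_induct)
  case (insert a A)
  then show ?case by (simp add: polyfun_add)
qed (auto simp: polyfun_const)

lemma polyfun_mult:
  assumes "polyfun m f" "polyfun m g"
  shows "polyfun m (\<lambda>x. f x * g x)"
proof -
  obtain p q where p: "p \<in> mpolys m" "\<And>x. f x = mpoly_eval p x"
    and q: "q \<in> mpolys m" "\<And>x. g x = mpoly_eval q x"
    using assms unfolding polyfun_def by auto
  have "f x * g x = (\<Sum>e\<in>Poly_Mapping.keys p. \<Sum>e'\<in>Poly_Mapping.keys q.
     (Poly_Mapping.lookup p e * Poly_Mapping.lookup q e') * monom_fun (e + e') x)" for x
    unfolding p q mpoly_eval_def monom_fun_def[symmetric] sum_product monom_fun_add
    by (simp add: mult_ac)
  moreover have "polyfun m (\<lambda>x. \<Sum>e\<in>Poly_Mapping.keys p. \<Sum>e'\<in>Poly_Mapping.keys q.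
     (Poly_Mapping.lookup p e * Poly_Mapping.lookup q e') * monom_fun (e + e') x)"
  proof (intro polyfun_sum polyfun_monom)
    fix e e' assume "e \<in> Poly_Mapping.keys p" "e' \<in> Poly_Mapping.keys q"
    then have "Poly_Mapping.keys e \<subseteq> {..<m}" "Poly_Mapping.keys e' \<subseteq> {..<m}"
      using p(1) q(1) unfolding mpolys_def by auto
    then show "Poly_Mapping.keys (e + e') \<subseteq> {..<m}" using keys_add[of e e'] by (meson Un_least subset_trans)
  qed
  ultimately show ?thesis by simp
qed

lemma polyfun_prod: "(\<And>i. i \<in> A \<Longrightarrow> polyfun m (f i)) \<Longrightarrow> polyfun m (\<lambda>x. \<Prod>i\<in>A. f i x)"
proof (induction A rule: infinite_finite_induct)
  case (insert a A)
  then show ?case by (simp add: polyfun_mult)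
qed (auto simp: polyfun_const)

lemma polyfun_det:
  assumes "\<And>x. M x \<in> carrier_mat k k"
    and "\<And>i j. i < k \<Longrightarrow> j < k \<Longrightarrow> polyfun m (\<lambda>x. M x $$ (i, j))"
  shows "polyfun m (\<lambda>x. det (M x))"
proof -
  have "det (M x) = (\<Sum>p \<in> {p. p permutes {0..<k}}. signof p * (\<Prod>i = 0..<k. M x $$ (i, p i)))" for x
    by (rule det_def'[OF assms(1)])
  moreover have "polyfun m (\<lambda>x. \<Sum>p \<in> {p. p permutes {0..<k}}. signof p * (\<Prod>i = 0..<k. M x $$ (i, p i)))"
    by (intro polyfun_sum polyfun_mult polyfun_const polyfun_prod assms(2))
      (auto dest: permutes_in_image)
  ultimately show ?thesis by simp
qed

text \<open>
One point outside the zero set suffices. No intersection of generic sets is needed later: all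
conditions on the parameters are multiplied into one polynomial function, and one good point
serves all of them.
\<close>

lemma generic_nonvanishing:
  assumes f: "polyfun m f" and x0: "x0 \<in> carrier_vec m" "f x0 \<noteq> 0"
  shows "generic m {x \<in> carrier_vec m. f x \<noteq> 0}"
proof -
  obtain p where p: "p \<in> mpolys m" "\<And>x. f x = mpoly_eval p x"
    using f unfolding polyfun_def by auto
  let ?Z = "{x \<in> carrier_vec m. \<forall>q \<in> {p}. mpoly_eval q x = 0}"
  have "algebraic_set m ?Z" unfolding algebraic_set_def
    by (rule exI[of _ "{p}"]) (use p in auto)
  moreover have "x0 \<notin> ?Z" using x0 p by auto
  then have "?Z \<noteq> carrier_vec m" using x0 by blast
  ultimately show ?thesis unfolding generic_def using p by (intro conjI exI[of _ ?Z]) auto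
qed

lemma poly_eq_sum_atMost:
  fixes p :: "'a :: comm_semiring_1 poly"
  assumes "degree p \<le> d"
  shows "poly p z = (\<Sum>i\<le>d. coeff p i * z ^ i)"
  unfolding poly_altdef using assms
  by (intro sum.mono_neutral_left) (auto intro: le_degree)

definition ppolyfun :: "nat \<Rightarrow> (complex vec \<Rightarrow> complex poly) \<Rightarrow> bool" where
  "ppolyfun m F \<longleftrightarrow> (\<forall>i. polyfun m (\<lambda>x. coeff (F x) i))"

lemma ppolyfun_const: "ppolyfun m (\<lambda>x. c)"
  unfolding ppolyfun_def by (simp add: polyfun_const)

lemma ppolyfun_mult: "ppolyfun m F \<Longrightarrow> ppolyfun m G \<Longrightarrow> ppolyfun m (\<lambda>x. F x * G x)"
  unfolding ppolyfun_def coeff_mult by (auto intro!: polyfun_sum polyfun_mult)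

lemma ppolyfun_sum: "(\<And>i. i \<in> A \<Longrightarrow> ppolyfun m (F i)) \<Longrightarrow> ppolyfun m (\<lambda>x. \<Sum>i\<in>A. F i x)"
  unfolding ppolyfun_def coeff_sum by (auto intro!: polyfun_sum)

lemma ppolyfun_prod: "(\<And>i. i \<in> A \<Longrightarrow> ppolyfun m (F i)) \<Longrightarrow> ppolyfun m (\<lambda>x. \<Prod>i\<in>A. F i x)"
proof (induction A rule: infinite_finite_induct)
  case (insert a A)
  then show ?case by (simp add: ppolyfun_mult)
qed (auto simp: ppolyfun_const)

lemma ppolyfun_linear:
  assumes "polyfun m f" "polyfun m g"
  shows "ppolyfun m (\<lambda>x. [:f x, g x:])"
  unfolding ppolyfun_def
proof
  fix i
  consider "i = 0" | "i = 1" | j where "i = Suc (Suc j)" by (metis One_nat_def not0_implies_Suc)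
  then show "polyfun m (\<lambda>x. coeff [:f x, g x:] i)"
    by cases (use assms polyfun_const in \<open>auto\<close>)
qed

lemma ppolyfun_det:
  assumes "\<And>x. M x \<in> carrier_mat k k"
    and "\<And>i j. i < k \<Longrightarrow> j < k \<Longrightarrow> ppolyfun m (\<lambda>x. M x $$ (i, j))"
  shows "ppolyfun m (\<lambda>x. det (M x))"
proof -
  have "det (M x) = (\<Sum>p \<in> {p. p permutes {0..<k}}. signof p * (\<Prod>i = 0..<k. M x $$ (i, p i)))" for x
    by (rule det_def'[OF assms(1)])
  moreover have "ppolyfun m (\<lambda>x. \<Sum>p \<in> {p. p permutes {0..<k}}. signof p * (\<Prod>i = 0..<k. M x $$ (i, p i)))"
    by (intro ppolyfun_sum ppolyfun_mult ppolyfun_const ppolyfun_prod assms(2))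
      (auto dest: permutes_in_image)
  ultimately show ?thesis by simp
qed

text \<open>
Division by a fixed polynomial is linear, so the coefficients of the quotient are fixed linear
combinations of those of the dividend. The uniform degree bound keeps these combinations finite.
\<close>

lemma ppolyfun_div:
  assumes F: "ppolyfun m F" and deg: "\<And>x. degree (F x) \<le> d"
  shows "ppolyfun m (\<lambda>x. F x div G)"
proof -
  have div_sum: "(\<Sum>i\<in>A. h i) div G = (\<Sum>i\<in>A. h i div G)" if "finite A" for h :: "nat \<Rightarrow> complex poly" and A
    using that by (induction A rule: finite_induct) (auto simp: poly_div_add_left)
  have "F x div G = (\<Sum>i\<le>d. Polynomial.smult (coeff (F x) i) (monom 1 i div G))" for x
  proof -
    have "F x = (\<Sum>i\<le>d. Polynomial.smult (coeff (F x) i) (monom 1 i))"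
      using poly_as_sum_of_monoms'[OF deg[of x]] by (simp add: smult_monom)
    then have "F x div G = (\<Sum>i\<le>d. Polynomial.smult (coeff (F x) i) (monom 1 i)) div G"
      by (rule arg_cong)
    also have "\<dots> = (\<Sum>i\<le>d. Polynomial.smult (coeff (F x) i) (monom 1 i) div G)"
      by (rule div_sum) simp
    also have "\<dots> = (\<Sum>i\<le>d. Polynomial.smult (coeff (F x) i) (monom 1 i div G))"
      by (simp add: div_smult_left)
    finally show ?thesis .
  qed
  moreover have "ppolyfun m (\<lambda>x. \<Sum>i\<le>d. Polynomial.smult (coeff (F x) i) (monom 1 i div G))"
    using F unfolding ppolyfun_def coeff_sum coeff_smult
    by (auto intro!: polyfun_sum polyfun_mult polyfun_const)
  ultimately show ?thesis by simp
qed

lemma polyfun_poly: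
  assumes F: "ppolyfun m F" and deg: "\<And>x. degree (F x) \<le> d"
  shows "polyfun m (\<lambda>x. poly (F x) z)"
proof -
  have "poly (F x) z = (\<Sum>i\<le>d. coeff (F x) i * z ^ i)" for x
    by (rule poly_eq_sum_atMost) (rule deg)
  then show ?thesis using F unfolding ppolyfun_def
    by (auto intro!: polyfun_sum polyfun_mult polyfun_const)
qed

section \<open>Squarefree polynomials of a fixed degree\<close>

text \<open>
The Sylvester matrix of \<open>h\<close> and its derivative: its rows are the coefficients of \<open>x\<^sup>i h\<close> for
\<open>i < d - 1\<close> and of \<open>x\<^sup>i h'\<close> for \<open>i < d\<close>. The number \<open>d\<close> takes the place of the degree of \<open>h\<close>, so that
the size of the matrix is the same for all members of a family of polynomials of degree at most
\<open>d\<close> and its determinant depends polynomially on the parameters of the family.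
\<close>

definition sylvester_deriv :: "nat \<Rightarrow> complex poly \<Rightarrow> complex mat" where
  "sylvester_deriv d h = mat (2 * d - 1) (2 * d - 1) (\<lambda>(i, j).
     coeff (if i < d - 1 then monom 1 i * h else monom 1 (i - (d - 1)) * pderiv h) j)"

text \<open>
A common root \<open>w\<close> of \<open>h\<close> and its derivative puts the vector \<open>(1, w, w\<^sup>2, \<dots>)\<close> into the kernel.
\<close>

lemma sylvester_deriv_simple_roots:
  assumes deg: "degree h \<le> d" and d: "d > 0" and det: "det (sylvester_deriv d h) \<noteq> 0"
    and w: "poly h w = 0"
  shows "poly (pderiv h) w \<noteq> 0"
proof
  assume w': "poly (pderiv h) w = 0"
  let ?N = "2 * d - 1"
  let ?v = "vec ?N (\<lambda>j. w ^ j)"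
  have degd: "degree (pderiv h) \<le> d - 1" using deg by (auto simp: degree_pderiv)
  have ev: "(\<Sum>j = 0..<?N. coeff q j * w ^ j) = poly q w" if "degree q < ?N" for q :: "complex poly"
  proof -
    have "poly q w = (\<Sum>j\<le>2 * d - 2. coeff q j * w ^ j)" by (rule poly_eq_sum_atMost) (use that in auto)
    also have "{..2 * d - 2} = {0..<?N}" using d by auto
    finally show ?thesis by simp
  qed
  have "sylvester_deriv d h *\<^sub>v ?v = 0\<^sub>v ?N"
  proof (rule eq_vecI)
    fix i assume i: "i < dim_vec (0\<^sub>v ?N :: complex vec)"
    let ?q = "if i < d - 1 then monom 1 i * h else monom 1 (i - (d - 1)) * pderiv h"
    have "degree ?q < ?N"
    proof (cases "i < d - 1")
      case True
      have "degree (monom 1 i * h) \<le> degree (monom (1::complex) i) + degree h" by (rule degree_mult_le)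
      then show ?thesis using True deg by (simp add: degree_monom_eq)
    next
      case False
      have "degree (monom 1 (i - (d - 1)) * pderiv h) \<le> degree (monom (1::complex) (i - (d - 1))) + degree (pderiv h)"
        by (rule degree_mult_le)
      then show ?thesis using False degd i d by (simp add: degree_monom_eq)
    qed
    moreover have "poly ?q w = 0" using w w' by auto
    ultimately have "(\<Sum>j = 0..<?N. coeff ?q j * w ^ j) = 0" using ev by metis
    then show "(sylvester_deriv d h *\<^sub>v ?v) $ i = 0\<^sub>v ?N $ i"
      using i by (simp add: sylvester_deriv_def scalar_prod_def)
  qed (simp add: sylvester_deriv_def)
  moreover have "?v \<noteq> 0\<^sub>v ?N"
  proof
    assume "?v = 0\<^sub>v ?N"
    then have "?v $ 0 = 0\<^sub>v ?N $ 0" by simp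
    then show False using d by simp
  qed
  moreover have "sylvester_deriv d h \<in> carrier_mat ?N ?N" by (simp add: sylvester_deriv_def)
  moreover have "?v \<in> carrier_vec ?N" by (rule vec_carrier)
  ultimately show False using det det_0_iff_vec_prod_zero[of "sylvester_deriv d h" ?N] by blast
qed

text \<open>
A vector in the kernel of the transposed matrix amounts to polynomials \<open>a\<close> and \<open>b\<close> with
\<open>a h + b h' = 0\<close> and \<open>degree b < d\<close>. As \<open>h\<close> is coprime to \<open>h'\<close>, it divides \<open>b\<close>, so \<open>b = 0\<close> by its degree.
\<close>

lemma sylvester_deriv_nonzero:
  assumes deg: "degree h = d" and d: "d > 0" and simple: "\<And>w. poly h w = 0 \<Longrightarrow> poly (pderiv h) w \<noteq> 0"
  shows "det (sylvester_deriv d h) \<noteq> 0"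
proof
  assume "det (sylvester_deriv d h) = 0"
  let ?N = "2 * d - 1" let ?S = "transpose_mat (sylvester_deriv d h)"
  have C: "sylvester_deriv d h \<in> carrier_mat ?N ?N" by (simp add: sylvester_deriv_def)
  have CS: "?S \<in> carrier_mat ?N ?N" using C by simp
  have "det ?S = 0" using \<open>det (sylvester_deriv d h) = 0\<close> det_transpose[OF C] by simp
  then obtain v where v: "v \<in> carrier_vec ?N" "v \<noteq> 0\<^sub>v ?N" "?S *\<^sub>v v = 0\<^sub>v ?N"
    using det_0_iff_vec_prod_zero[OF CS] by auto
  define a where "a = (\<Sum>i<d - 1. monom (v $ i) i)"
  define b where "b = (\<Sum>i<d. monom (v $ (i + (d - 1))) i)"
  have h0: "h \<noteq> 0" using deg d by auto
  have split: "(\<Sum>i = 0..<?N. f i) = (\<Sum>i<d - 1. f i) + (\<Sum>i<d. f (i + (d - 1)))" for f :: "nat \<Rightarrow> complex"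
  proof -
    have "?N = (d - 1) + d" using d by simp
    then have "(\<Sum>i = 0..<?N. f i) = (\<Sum>i = 0..<(d - 1) + d. f i)" by metis
    also have "\<dots> = (\<Sum>i = 0..<d - 1. f i) + (\<Sum>i = d - 1..<(d - 1) + d. f i)"
      by (rule sum.atLeastLessThan_concat[symmetric]) auto
    also have "(\<Sum>i = d - 1..<(d - 1) + d. f i) = (\<Sum>i = 0..<d. f (i + (d - 1)))"
      using sum.shift_bounds_nat_ivl[of f 0 "d - 1" d] by (simp add: add.commute)
    finally show ?thesis by (simp add: atLeast0LessThan)
  qed
  have dega: "degree (monom 1 i * h) < ?N" if "i < d - 1" for i
    using degree_mult_le[of "monom 1 i" h] that deg by (simp add: degree_monom_eq)
  have degb: "degree (monom 1 i * pderiv h) < ?N" if "i < d" for i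
    using degree_mult_le[of "monom 1 i" "pderiv h"] that deg by (simp add: degree_monom_eq degree_pderiv)
  have ab: "a * h + b * pderiv h = 0"
  proof (rule poly_eqI)
    fix j
    have e: "coeff (a * h + b * pderiv h) j =
       (\<Sum>i<d - 1. v $ i * coeff (monom 1 i * h) j) + (\<Sum>i<d. v $ (i + (d - 1)) * coeff (monom 1 i * pderiv h) j)"
    proof -
      have m: "monom c i * q = Polynomial.smult c (monom 1 i * q)" for c :: complex and i q
        by (metis mult_smult_left smult_monom mult.right_neutral)
      show ?thesis unfolding a_def b_def sum_distrib_right coeff_add coeff_sum
        by (simp add: m[of "v $ _"] m[of "v $ (_ + _)"])
    qed
    show "coeff (a * h + b * pderiv h) j = coeff 0 j"
    proof (cases "j < ?N")
      case False
      then have "coeff (monom 1 i * h) j = 0" if "i < d - 1" for i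
        using dega[OF that] by (intro coeff_eq_0) auto
      moreover have "coeff (monom 1 i * pderiv h) j = 0" if "i < d" for i
        using degb[OF that] False by (intro coeff_eq_0) auto
      ultimately show ?thesis unfolding e by simp
    next
      case True
      have "(?S *\<^sub>v v) $ j = 0" using v True by simp
      then have "(\<Sum>i = 0..<?N. v $ i * coeff (if i < d - 1 then monom 1 i * h else monom 1 (i - (d - 1)) * pderiv h) j) = 0"
        using True v(1) by (simp add: sylvester_deriv_def scalar_prod_def mult.commute)
      then have "(\<Sum>i<d - 1. v $ i * coeff (monom 1 i * h) j)
          + (\<Sum>i<d. v $ (i + (d - 1)) * coeff (monom 1 i * pderiv h) j) = 0"
        unfolding split by (simp del: One_nat_def Nat.add_diff_assoc add: not_add_less2)
      then show ?thesis unfolding e by simp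
    qed
  qed
  have cop: "coprime h (pderiv h)"
  proof (rule ccontr)
    assume n: "\<not> coprime h (pderiv h)"
    let ?g = "gcd h (pderiv h)"
    have "?g \<noteq> 0" using h0 by simp
    have "\<not> is_unit ?g" using n by (simp only: is_unit_gcd not_False_eq_True)
    then have "degree ?g \<noteq> 0" using \<open>?g \<noteq> 0\<close> by (auto simp: is_unit_iff_degree)
    then obtain w where "poly ?g w = 0"
      using fundamental_theorem_of_algebra[of ?g] by (auto simp: constant_degree)
    then have "poly h w = 0" "poly (pderiv h) w = 0"
      by (metis gcd_dvd1 gcd_dvd2 poly_eq_0_iff_dvd dvd_trans)+
    then show False using simple by auto
  qed
  have "h dvd b * pderiv h" using ab by (metis add_eq_0_iff dvd_minus_iff dvd_triv_right)
  then have hb: "h dvd b" using cop by (simp add: coprime_dvd_mult_left_iff)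
  have "degree b < d" unfolding b_def
    using d by (intro degree_sum_less) (auto intro: le_less_trans[OF degree_monom_le])
  have b0: "b = 0"
  proof (rule ccontr)
    assume "b \<noteq> 0"
    then have "degree h \<le> degree b" using hb by (auto simp: dvd_def degree_mult_eq)
    then show False using deg \<open>degree b < d\<close> by simp
  qed
  then have a0: "a = 0" using ab h0 by simp
  have "v $ i = 0" if "i < ?N" for i
  proof (cases "i < d - 1")
    case True
    have "coeff a i = v $ i" unfolding a_def coeff_sum using True by simp
    then show ?thesis using a0 by simp
  next
    case False
    have "coeff b (i - (d - 1)) = v $ i" unfolding b_def coeff_sum using False that by simp
    then show ?thesis using b0 by simp
  qed
  then have "v = 0\<^sub>v ?N" using v(1) by (intro eq_vecI) auto
  then show False using v(2) by simp
qed

lemma polyfun_det_sylvester_deriv: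
  assumes "ppolyfun m F"
  shows "polyfun m (\<lambda>x. det (sylvester_deriv d (F x)))"
proof (rule polyfun_det[of _ "2 * d - 1"])
  fix i j assume ij: "i < 2 * d - 1" "j < 2 * d - 1"
  have "ppolyfun m (\<lambda>x. pderiv (F x))"
    using assms unfolding ppolyfun_def coeff_pderiv by (auto intro!: polyfun_mult polyfun_const)
  then have "ppolyfun m (\<lambda>x. if i < d - 1 then monom 1 i * F x else monom 1 (i - (d - 1)) * pderiv (F x))"
    using assms by (cases "i < d - 1") (simp_all add: ppolyfun_mult ppolyfun_const del: One_nat_def)
  then show "polyfun m (\<lambda>x. sylvester_deriv d (F x) $$ (i, j))"
    using ij unfolding ppolyfun_def sylvester_deriv_def by simp
qed (simp add: sylvester_deriv_def)

section \<open>Pencils\<close>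

interpretation const_poly_hom: comm_ring_hom "\<lambda>c :: complex. [:c:]"
  by unfold_locales auto

abbreviation const_mat :: "complex mat \<Rightarrow> complex poly mat" where
  "const_mat \<equiv> map_mat (\<lambda>c. [:c:])"

abbreviation eval_mat :: "complex \<Rightarrow> complex poly mat \<Rightarrow> complex mat" where
  "eval_mat z \<equiv> map_mat (\<lambda>p. poly p z)"

abbreviation eval_vec :: "complex \<Rightarrow> complex poly vec \<Rightarrow> complex vec" where
  "eval_vec z \<equiv> map_vec (\<lambda>p. poly p z)"

lemma det_eval_mat: "det (eval_mat z M) = poly (det M) z"
  by (rule comm_ring_hom.hom_det[OF poly_hom.comm_ring_hom_axioms])

lemma eval_mult_mat_vec:
  "M \<in> carrier_mat nr n \<Longrightarrow> f \<in> carrier_vec n \<Longrightarrow> eval_vec z (M *\<^sub>v f) = eval_mat z M *\<^sub>v eval_vec z f"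
  by (rule semiring_hom.mult_mat_vec_hom[OF poly_hom.semiring_hom_axioms])

definition pencil_mat :: "pencil \<Rightarrow> complex poly mat" where
  "pencil_mat L = mat (dim_row (fst L)) (dim_col (fst L))
     (\<lambda>(i, j). [:fst L $$ (i, j), snd L $$ (i, j):])"

abbreviation pencils :: "nat \<Rightarrow> pencil set" where
  "pencils n \<equiv> carrier_mat n n \<times> carrier_mat n n"

lemma pencil_det_pencil_mat: "pencil_det L = det (pencil_mat L)"
  unfolding pencil_det_def pencil_mat_def by (simp split: prod.split)

lemma pencil_mat_carrier: "L \<in> pencils n \<Longrightarrow> pencil_mat L \<in> carrier_mat n n"
  unfolding pencil_mat_def by auto

lemma pencil_mat_index:
  "L \<in> pencils n \<Longrightarrow> i < n \<Longrightarrow> j < n \<Longrightarrow> pencil_mat L $$ (i, j) = [:fst L $$ (i, j), snd L $$ (i, j):]"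
  unfolding pencil_mat_def by auto

lemma pencil_mat_altdef:
  assumes "A \<in> carrier_mat n n" "B \<in> carrier_mat n n"
  shows "pencil_mat (A, B) = const_mat A + [:0, 1:] \<cdot>\<^sub>m const_mat B"
  using assms by (intro eq_matI) (auto simp: pencil_mat_def)

lemma eval_pencil_mat:
  assumes "A \<in> carrier_mat n n" "B \<in> carrier_mat n n"
  shows "eval_mat z (pencil_mat (A, B)) = A + z \<cdot>\<^sub>m B"
  using assms by (intro eq_matI) (auto simp: pencil_mat_def)

lemma poly_pencil_det:
  assumes "A \<in> carrier_mat n n" "B \<in> carrier_mat n n"
  shows "poly (pencil_det (A, B)) z = det (A + z \<cdot>\<^sub>m B)"
  unfolding pencil_det_pencil_mat
  by (simp only: det_eval_mat[symmetric] eval_pencil_mat[OF assms])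

lemma rev_pencil_carrier: "L \<in> pencils n \<Longrightarrow> rev_pencil L \<in> pencils n"
  by (auto simp: rev_pencil_def)

lemma degree_pencil_det:
  assumes L: "L \<in> pencils n"
  shows "degree (pencil_det L) \<le> n"
  using degree_det_le[of n "pencil_mat L" 1] L
  by (simp add: pencil_det_pencil_mat pencil_mat_index pencil_mat_carrier)

lemma poly_eq_off_zero:
  fixes p q :: "complex poly"
  assumes "\<And>w. w \<noteq> 0 \<Longrightarrow> poly p w = poly q w"
  shows "p = q"
proof -
  have "poly ([:0, 1:] * (p - q)) w = 0" for w using assms[of w] by (cases "w = 0") auto
  then have "[:0, 1:] * (p - q) = 0" using poly_all_0_iff_0 by blast
  then show ?thesis by simp
qed

text \<open>
This is \<open>det (B + x A) = x\<^sup>n det (A + (1/x) B)\<close>, compared coefficient by coefficient.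
\<close>

lemma coeff_pencil_det_rev:
  assumes L: "L \<in> pencils n" and i: "i \<le> n"
  shows "coeff (pencil_det (rev_pencil L)) i = coeff (pencil_det L) (n - i)"
proof -
  obtain A B where AB: "L = (A, B)" "A \<in> carrier_mat n n" "B \<in> carrier_mat n n" using L by auto
  define R where "R = (\<Sum>i\<le>n. monom (coeff (pencil_det L) (n - i)) i)"
  have "pencil_det (rev_pencil L) = R"
  proof (rule poly_eq_off_zero)
    fix w :: complex assume w: "w \<noteq> 0"
    have "B + w \<cdot>\<^sub>m A = w \<cdot>\<^sub>m (A + (1 / w) \<cdot>\<^sub>m B)"
      using AB(2,3) w by (intro eq_matI) (simp_all add: distrib_left)
    then have "poly (pencil_det (rev_pencil L)) w = w ^ n * poly (pencil_det L) (1 / w)"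
      using AB by (simp add: rev_pencil_def poly_pencil_det)
    also have "poly (pencil_det L) (1 / w) = (\<Sum>i\<le>n. coeff (pencil_det L) i * (1 / w) ^ i)"
      by (rule poly_eq_sum_atMost[OF degree_pencil_det[OF L]])
    also have "\<dots> = (\<Sum>i\<le>n. coeff (pencil_det L) (n - i) * (1 / w) ^ (n - i))"
      by (rule sum.reindex_bij_witness[of _ "\<lambda>i. n - i" "\<lambda>i. n - i"]) auto
    also have "w ^ n * \<dots> = (\<Sum>i\<le>n. coeff (pencil_det L) (n - i) * w ^ i)"
      unfolding sum_distrib_left
    proof (rule sum.cong[OF refl])
      fix i assume "i \<in> {..n}"
      then have "w ^ n = w ^ (n - i) * w ^ i" by (simp flip: power_add)
      then show "w ^ n * (coeff (pencil_det L) (n - i) * (1 / w) ^ (n - i)) = coeff (pencil_det L) (n - i) * w ^ i"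
        using w by (simp add: field_simps)
    qed
    also have "\<dots> = poly R w" by (simp add: R_def poly_sum poly_monom)
    finally show "poly (pencil_det (rev_pencil L)) w = poly R w" .
  qed
  then show ?thesis using i by (simp add: R_def coeff_sum)
qed

lemma pencil_det_rev_eq_0_iff:
  assumes "L \<in> pencils n"
  shows "pencil_det (rev_pencil L) = 0 \<longleftrightarrow> pencil_det L = 0"
proof -
  have *: "pencil_det L = 0" if "pencil_det (rev_pencil L) = 0" "L \<in> pencils n" for L
  proof (rule poly_eqI)
    fix i
    show "coeff (pencil_det L) i = coeff 0 i"
      using coeff_pencil_det_rev[OF that(2), of "n - i"] degree_pencil_det[OF that(2)] that(1)
      by (cases "i \<le> n") (auto intro: coeff_eq_0)
  qed
  have "rev_pencil (rev_pencil L) = L" by (simp add: rev_pencil_def split: prod.split)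
  then show ?thesis using *[of L] *[of "rev_pencil L"] assms rev_pencil_carrier[OF assms] by auto
qed

text \<open>
Infinity accounts for the missing degree of the determinant. Through this identity the
multiplicity at infinity of a perturbed pencil becomes a condition on a degree.
\<close>

lemma degree_pencil_det_rev:
  assumes L: "L \<in> pencils n" and D: "pencil_det L \<noteq> 0"
  shows "degree (pencil_det L) + order 0 (pencil_det (rev_pencil L)) = n"
proof (rule antisym)
  let ?D = "pencil_det L" and ?R = "pencil_det (rev_pencil L)"
  have R: "?R \<noteq> 0" using pencil_det_rev_eq_0_iff[OF L] D by simp
  have dvd: "monom 1 k dvd ?R \<longleftrightarrow> k \<le> order 0 ?R" for k using R by (rule monom_1_dvd_iff)
  have "monom 1 (n - degree ?D) dvd ?R"
    unfolding monom_1_dvd_iff' using coeff_pencil_det_rev[OF L]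
    by (auto intro: coeff_eq_0)
  then show "n \<le> degree ?D + order 0 ?R" unfolding dvd by simp
  have "\<not> order 0 ?R > n - degree ?D"
  proof
    assume "order 0 ?R > n - degree ?D"
    then have "monom 1 (order 0 ?R) dvd ?R" "n - degree ?D < order 0 ?R" using dvd by auto
    then have "coeff ?R (n - degree ?D) = 0" unfolding monom_1_dvd_iff' by auto
    then show False using coeff_pencil_det_rev[OF L, of "n - degree ?D"] degree_pencil_det[OF L] D by simp
  qed
  then show "degree ?D + order 0 ?R \<le> n" using degree_pencil_det[OF L] by simp
qed

section \<open>Root spaces\<close>

text \<open>
The leading vectors of the Jordan chains of length at least \<open>k\<close> at \<open>z\<close>, together with \<open>0\<close>: a chain is
a polynomial vector that \<open>M\<close> sends to multiples of \<open>(x - z)\<^sup>k\<close>. For \<open>k = 1\<close> this is the kernel of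
\<open>M(z)\<close>. The definition makes sense for singular pencils too, which is what allows a perturbation
of rank \<open>r\<close> to be added one rank-one term at a time.
\<close>

definition root_space :: "complex poly mat \<Rightarrow> complex \<Rightarrow> nat \<Rightarrow> complex vec set" where
  "root_space M z k = {v. \<exists>f \<in> carrier_vec (dim_col M). v = eval_vec z f \<and>
     (\<forall>i < dim_row M. [:-z, 1:] ^ k dvd (M *\<^sub>v f) $ i)}"

lemma root_spaceI:
  assumes "M \<in> carrier_mat n n" "f \<in> carrier_vec n" "\<And>i. i < n \<Longrightarrow> [:-z, 1:] ^ k dvd (M *\<^sub>v f) $ i"
  shows "eval_vec z f \<in> root_space M z k"
  using assms unfolding root_space_def by auto

lemma root_spaceE:
  assumes "M \<in> carrier_mat n n" "v \<in> root_space M z k"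
  obtains f where "f \<in> carrier_vec n" "v = eval_vec z f" "\<And>i. i < n \<Longrightarrow> [:-z, 1:] ^ k dvd (M *\<^sub>v f) $ i"
  using assms unfolding root_space_def by auto

lemma dvd_mult_mat_vec:
  fixes q :: "'a :: comm_ring_1"
  assumes "M \<in> carrier_mat n n" "w \<in> carrier_vec n" "\<And>i. i < n \<Longrightarrow> q dvd w $ i" "i < n"
  shows "q dvd (M *\<^sub>v w) $ i"
  using assms by (auto simp: scalar_prod_def intro!: dvd_sum dvd_mult)

lemma root_space_transform:
  assumes c: "M \<in> carrier_mat n n" "R \<in> carrier_mat n n" "R' \<in> carrier_mat n n" "S \<in> carrier_mat n n"
    and R: "R' * R = 1\<^sub>m n"
    and v: "v \<in> root_space (R * M * S) z k"
  shows "eval_mat z S *\<^sub>v v \<in> root_space M z k"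
proof -
  have c': "R * M * S \<in> carrier_mat n n" using c by simp
  obtain f where f: "f \<in> carrier_vec n" "v = eval_vec z f"
    "\<And>i. i < n \<Longrightarrow> [:-z, 1:] ^ k dvd ((R * M * S) *\<^sub>v f) $ i"
    using root_spaceE[OF c' v] by blast
  have e: "M *\<^sub>v (S *\<^sub>v f) = R' *\<^sub>v ((R * M * S) *\<^sub>v f)"
  proof -
    have "R' *\<^sub>v ((R * M * S) *\<^sub>v f) = (R' * (R * (M * S))) *\<^sub>v f"
      using c f by (simp add: assoc_mult_mat_vec[of _ n n _ n] assoc_mult_mat[of _ n n _ n _ n])
    also have "R' * (R * (M * S)) = (R' * R) * (M * S)"
      using c by (simp add: assoc_mult_mat[of _ n n _ n _ n])
    also have "\<dots> = M * S" unfolding R using c by simp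
    finally show ?thesis using c f by (simp add: assoc_mult_mat_vec[of _ n n _ n])
  qed
  have "eval_vec z (S *\<^sub>v f) \<in> root_space M z k"
  proof (rule root_spaceI[OF c(1)])
    show "S *\<^sub>v f \<in> carrier_vec n" using c f by simp
    show "[:- z, 1:] ^ k dvd (M *\<^sub>v (S *\<^sub>v f)) $ i" if "i < n" for i
      unfolding e using f(3) that
      by (intro dvd_mult_mat_vec[OF c(3) mult_mat_vec_carrier[OF c' f(1)]])
  qed
  also have "eval_vec z (S *\<^sub>v f) = eval_mat z S *\<^sub>v v"
    unfolding f(2) by (rule eval_mult_mat_vec[OF c(4) f(1)])
  finally show ?thesis .
qed

text \<open>
The root spaces of the blocks of a Weierstrass form are spanned by unit vectors. Their dimension
is counted through the set \<open>I\<close> of the indices of these vectors.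
\<close>

definition coord_root :: "nat \<Rightarrow> complex poly mat \<Rightarrow> complex \<Rightarrow> nat \<Rightarrow> nat set \<Rightarrow> bool" where
  "coord_root n M z k I \<longleftrightarrow> M \<in> carrier_mat n n \<and> I \<subseteq> {..<n} \<and>
     root_space M z k = {v \<in> carrier_vec n. \<forall>i<n. i \<notin> I \<longrightarrow> v $ i = 0}"

lemma coord_root_nonsingular:
  assumes M: "M \<in> carrier_mat n n" and det: "poly (det M) z \<noteq> 0" and k: "k > 0"
  shows "coord_root n M z k {}"
proof -
  have ev: "eval_mat z M \<in> carrier_mat n n" using M by simp
  have "det (eval_mat z M) \<noteq> 0" using det by (simp only: det_eval_mat not_False_eq_True)
  have "v = 0\<^sub>v n" if vM: "v \<in> root_space M z k" for v
  proof -
    obtain f where f: "f \<in> carrier_vec n" "v = eval_vec z f"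
      "\<And>i. i < n \<Longrightarrow> [:-z, 1:] ^ k dvd (M *\<^sub>v f) $ i"
      using root_spaceE[OF M vM] by blast
    have "eval_mat z M *\<^sub>v v = eval_vec z (M *\<^sub>v f)"
      unfolding f(2) by (rule eval_mult_mat_vec[OF M f(1), symmetric])
    also have "\<dots> = 0\<^sub>v n"
    proof (rule eq_vecI)
      fix i assume "i < dim_vec (0\<^sub>v n :: complex vec)"
      then have i: "i < n" by simp
      have "[:-z, 1:] dvd (M *\<^sub>v f) $ i"
        using f(3)[OF i] k by (meson dvd_power dvd_trans)
      then show "eval_vec z (M *\<^sub>v f) $ i = 0\<^sub>v n $ i" using i M by (simp add: poly_eq_0_iff_dvd)
    qed (use M in simp)
    finally have "eval_mat z M *\<^sub>v v = 0\<^sub>v n" .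
    moreover have "v \<in> carrier_vec n" using f by simp
    ultimately show "v = 0\<^sub>v n"
      using det_0_iff_vec_prod_zero[OF ev] \<open>det (eval_mat z M) \<noteq> 0\<close> by blast
  qed
  moreover have "0\<^sub>v n \<in> root_space M z k"
  proof -
    have "eval_vec z (0\<^sub>v n) \<in> root_space M z k"
      by (rule root_spaceI[OF M]) (use M in auto)
    also have "eval_vec z (0\<^sub>v n) = 0\<^sub>v n" by auto
    finally show ?thesis .
  qed
  ultimately have eq: "root_space M z k = {0\<^sub>v n}" by blast
  have "v = 0\<^sub>v n \<longleftrightarrow> v \<in> carrier_vec n \<and> (\<forall>i<n. v $ i = 0)" for v :: "complex vec"
    by (metis carrier_vecD eq_vecI index_zero_vec zero_carrier_vec)
  then have "root_space M z k = {v \<in> carrier_vec n. \<forall>i<n. v $ i = 0}" unfolding eq by blast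
  then show ?thesis using M by (simp add: coord_root_def)
qed

lemma root_space_four_block:
  assumes M: "M1 \<in> carrier_mat n1 n1" "M2 \<in> carrier_mat n2 n2"
  shows "root_space (four_block_mat M1 (0\<^sub>m n1 n2) (0\<^sub>m n2 n1) M2) z k =
    {v @\<^sub>v w | v w. v \<in> root_space M1 z k \<and> w \<in> root_space M2 z k}" (is "root_space ?M z k = ?R")
proof -
  have cM: "?M \<in> carrier_mat (n1 + n2) (n1 + n2)" using M by simp
  have mult: "?M *\<^sub>v (f @\<^sub>v g) = (M1 *\<^sub>v f) @\<^sub>v (M2 *\<^sub>v g)"
    if "f \<in> carrier_vec n1" "g \<in> carrier_vec n2" for f g
  proof -
    have "?M *\<^sub>v (f @\<^sub>v g) = (M1 *\<^sub>v f + 0\<^sub>m n1 n2 *\<^sub>v g) @\<^sub>v (0\<^sub>m n2 n1 *\<^sub>v f + M2 *\<^sub>v g)"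
      by (rule four_block_mat_mult_vec) (use M that in auto)
    also have "0\<^sub>m n1 n2 *\<^sub>v g = 0\<^sub>v n1" using that by auto
    also have "0\<^sub>m n2 n1 *\<^sub>v f = 0\<^sub>v n2" using that by auto
    finally show ?thesis using M that by simp
  qed
  have ev: "eval_vec z (f @\<^sub>v g) = eval_vec z f @\<^sub>v eval_vec z g" for f g by (intro eq_vecI) auto
  show ?thesis
  proof (rule antisym; rule subsetI)
    fix x assume "x \<in> root_space ?M z k"
    then obtain h where h: "h \<in> carrier_vec (n1 + n2)" "x = eval_vec z h"
      "\<And>i. i < n1 + n2 \<Longrightarrow> [:-z, 1:] ^ k dvd (?M *\<^sub>v h) $ i"
      using root_spaceE[OF cM] by blast
    define f g where "f = vec_first h n1" and "g = vec_last h n2"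
    have fg: "f \<in> carrier_vec n1" "g \<in> carrier_vec n2" "h = f @\<^sub>v g"
      using h(1) by (auto simp: f_def g_def)
    have "eval_vec z f \<in> root_space M1 z k"
    proof (rule root_spaceI[OF M(1) fg(1)])
      show "[:- z, 1:] ^ k dvd (M1 *\<^sub>v f) $ i" if "i < n1" for i
        using h(3)[of i] that M fg unfolding fg(3) mult[OF fg(1,2)] by simp
    qed
    moreover have "eval_vec z g \<in> root_space M2 z k"
    proof (rule root_spaceI[OF M(2) fg(2)])
      show "[:- z, 1:] ^ k dvd (M2 *\<^sub>v g) $ i" if "i < n2" for i
        using h(3)[of "n1 + i"] that M fg unfolding fg(3) mult[OF fg(1,2)] by simp
    qed
    ultimately show "x \<in> ?R" using h(2) fg(3) ev by auto
  next
    fix x assume "x \<in> ?R"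
    then obtain v w where vw: "x = v @\<^sub>v w" "v \<in> root_space M1 z k" "w \<in> root_space M2 z k" by auto
    obtain f where f: "f \<in> carrier_vec n1" "v = eval_vec z f" "\<And>i. i < n1 \<Longrightarrow> [:-z, 1:] ^ k dvd (M1 *\<^sub>v f) $ i"
      using root_spaceE[OF M(1) vw(2)] by blast
    obtain g where g: "g \<in> carrier_vec n2" "w = eval_vec z g" "\<And>i. i < n2 \<Longrightarrow> [:-z, 1:] ^ k dvd (M2 *\<^sub>v g) $ i"
      using root_spaceE[OF M(2) vw(3)] by blast
    have "eval_vec z (f @\<^sub>v g) \<in> root_space ?M z k"
    proof (rule root_spaceI[OF cM])
      show "f @\<^sub>v g \<in> carrier_vec (n1 + n2)" using f g by simp
      show "[:- z, 1:] ^ k dvd (?M *\<^sub>v (f @\<^sub>v g)) $ i" if "i < n1 + n2" for i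
        unfolding mult[OF f(1) g(1)] using that M f g by (cases "i < n1") auto
    qed
    then show "x \<in> root_space ?M z k" using vw(1) f g ev by simp
  qed
qed

lemma coord_root_four_block:
  assumes 1: "coord_root n1 M1 z k I1" and 2: "coord_root n2 M2 z k I2"
  shows "coord_root (n1 + n2) (four_block_mat M1 (0\<^sub>m n1 n2) (0\<^sub>m n2 n1) M2) z k (I1 \<union> (+) n1 ` I2)"
proof -
  have M: "M1 \<in> carrier_mat n1 n1" "M2 \<in> carrier_mat n2 n2" and I: "I1 \<subseteq> {..<n1}" "I2 \<subseteq> {..<n2}"
    and r1: "root_space M1 z k = {v \<in> carrier_vec n1. \<forall>i<n1. i \<notin> I1 \<longrightarrow> v $ i = 0}"
    and r2: "root_space M2 z k = {v \<in> carrier_vec n2. \<forall>i<n2. i \<notin> I2 \<longrightarrow> v $ i = 0}"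
    using 1 2 by (auto simp: coord_root_def)
  have "{v @\<^sub>v w | v w. v \<in> root_space M1 z k \<and> w \<in> root_space M2 z k} =
    {x \<in> carrier_vec (n1 + n2). \<forall>i<n1 + n2. i \<notin> I1 \<union> (+) n1 ` I2 \<longrightarrow> x $ i = 0}" (is "?L = ?R")
  proof (rule antisym; rule subsetI)
    fix x assume "x \<in> ?L"
    then obtain v w where x: "x = v @\<^sub>v w" "v \<in> carrier_vec n1" "w \<in> carrier_vec n2"
      and v: "\<And>i. i < n1 \<Longrightarrow> i \<notin> I1 \<Longrightarrow> v $ i = 0" and w: "\<And>i. i < n2 \<Longrightarrow> i \<notin> I2 \<Longrightarrow> w $ i = 0"
      unfolding r1 r2 by blast
    have "x $ i = 0" if i: "i < n1 + n2" "i \<notin> I1 \<union> (+) n1 ` I2" for i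
    proof (cases "i < n1")
      case True
      then show ?thesis using x v i by simp
    next
      case False
      then have "i = n1 + (i - n1)" by simp
      then have "i - n1 \<notin> I2" using i(2) by blast
      then show ?thesis using x w[of "i - n1"] i False by simp
    qed
    then show "x \<in> ?R" using x by simp
  next
    fix x assume x: "x \<in> ?R"
    define v w where "v = vec_first x n1" and "w = vec_last x n2"
    have vw: "v \<in> carrier_vec n1" "w \<in> carrier_vec n2" "x = v @\<^sub>v w"
      using x by (auto simp: v_def w_def)
    have "v \<in> root_space M1 z k" unfolding r1
    proof (safe)
      fix i assume "i < n1" "i \<notin> I1"
      moreover from this have "i \<notin> (+) n1 ` I2" by auto
      ultimately have "x $ i = 0" using x by simp
      then show "v $ i = 0" using vw \<open>i < n1\<close> by simp
    qed (rule vw)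
    moreover have "w \<in> root_space M2 z k" unfolding r2
    proof (safe)
      fix i assume i: "i < n2" "i \<notin> I2"
      then have "n1 + i \<notin> I1 \<union> (+) n1 ` I2" using I by auto
      then have "x $ (n1 + i) = 0" using x i by simp
      then show "w $ i = 0" using vw i by simp
    qed (rule vw)
    ultimately show "x \<in> ?L" using vw(3) by blast
  qed
  then show ?thesis
    unfolding coord_root_def root_space_four_block[OF M] using M I by auto
qed

section \<open>Bases of spaces of complex vectors\<close>

text \<open>
The basis is a family of functions, not of vectors, so that linear combinations are sums of
complex numbers.
\<close>

definition basis_of :: "nat \<Rightarrow> complex vec set \<Rightarrow> nat \<Rightarrow> (nat \<Rightarrow> nat \<Rightarrow> complex) \<Rightarrow> bool" where
  "basis_of n V g b \<longleftrightarrow>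
     (\<forall>c. (\<forall>p<n. (\<Sum>l<g. c l * b l p) = 0) \<longrightarrow> (\<forall>l<g. c l = 0)) \<and>
     V = {vec n (\<lambda>p. \<Sum>l<g. c l * b l p) | c. True}"

lemma basis_of_columns:
  assumes I: "I \<subseteq> {..<n}" and Q: "Q \<in> carrier_mat n n" "Q' \<in> carrier_mat n n" "Q' * Q = 1\<^sub>m n"
  shows "\<exists>b. basis_of n {Q *\<^sub>v v | v. v \<in> carrier_vec n \<and> (\<forall>i<n. i \<notin> I \<longrightarrow> v $ i = 0)} (card I) b"
proof -
  let ?g = "card I"
  have "finite I" using I finite_subset by blast
  then obtain e where e: "bij_betw e {0..<?g} I" using ex_bij_betw_nat_finite by blast
  then have inj: "inj_on e {..<?g}" and im: "e ` {..<?g} = I"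
    by (auto simp: bij_betw_def atLeast0LessThan)
  have eI: "e l \<in> I" if "l < ?g" for l using im that by blast
  have en: "e l < n" if "l < ?g" for l using eI[OF that] I by auto
  define v where "v c = vec n (\<lambda>j. \<Sum>l<?g. if e l = j then c l else 0)" for c :: "nat \<Rightarrow> complex"
  have v_carrier: "v c \<in> carrier_vec n" for c by (simp add: v_def)
  have v_e: "v c $ e l = c l" if "l < ?g" for c l
  proof -
    have "v c $ e l = (\<Sum>l'<?g. if l' = l then c l' else 0)"
      unfolding v_def using en[OF that] inj that
      by (auto intro!: sum.cong simp: inj_on_eq_iff)
    then show ?thesis using that by simp
  qed
  have v_out: "v c $ i = 0" if "i < n" "i \<notin> I" for c i
    using that eI by (auto simp: v_def intro!: sum.neutral)
  have Qv: "(Q *\<^sub>v v c) $ p = (\<Sum>l<?g. c l * Q $$ (p, e l))" if p: "p < n" for c p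
  proof -
    have "(Q *\<^sub>v v c) $ p = (\<Sum>j = 0..<n. Q $$ (p, j) * (\<Sum>l<?g. if e l = j then c l else 0))"
      using p Q by (simp add: scalar_prod_def v_def)
    also have "\<dots> = (\<Sum>l<?g. \<Sum>j = 0..<n. if j = e l then c l * Q $$ (p, j) else 0)"
      by (subst sum.swap) (auto simp: sum_distrib_left intro!: sum.cong)
    also have "\<dots> = (\<Sum>l<?g. c l * Q $$ (p, e l))"
      by (intro sum.cong refl) (use en in auto)
    finally show ?thesis .
  qed
  have Qv': "Q *\<^sub>v v c = vec n (\<lambda>p. \<Sum>l<?g. c l * Q $$ (p, e l))" for c
    using Qv Q by (intro eq_vecI) auto
  have v_all: "w = v (\<lambda>l. w $ e l)" if w: "w \<in> carrier_vec n" "\<And>i. i < n \<Longrightarrow> i \<notin> I \<Longrightarrow> w $ i = 0" for w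
  proof (rule eq_vecI)
    fix i assume "i < dim_vec (v (\<lambda>l. w $ e l))"
    then have i: "i < n" by (simp add: v_def)
    show "w $ i = v (\<lambda>l. w $ e l) $ i"
    proof (cases "i \<in> I")
      case True
      then obtain l where "l < ?g" "i = e l" using im by auto
      then show ?thesis using v_e[of l] by simp
    next
      case False
      then show ?thesis using w(2)[OF i] v_out[OF i] by simp
    qed
  qed (use w in \<open>simp add: v_def\<close>)
  have "basis_of n {Q *\<^sub>v v | v. v \<in> carrier_vec n \<and> (\<forall>i<n. i \<notin> I \<longrightarrow> v $ i = 0)} ?g (\<lambda>l p. Q $$ (p, e l))"
    unfolding basis_of_def
  proof (intro conjI allI impI)
    fix c l assume z: "\<forall>p<n. (\<Sum>l<?g. c l * Q $$ (p, e l)) = 0" and l: "l < ?g"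
    have "Q *\<^sub>v v c = 0\<^sub>v n" unfolding Qv' using z by (intro eq_vecI) auto
    then have "Q' *\<^sub>v (Q *\<^sub>v v c) = 0\<^sub>v n" using Q by auto
    then have "(Q' * Q) *\<^sub>v v c = 0\<^sub>v n" by (subst assoc_mult_mat_vec[OF Q(2,1) v_carrier])
    then have "v c = 0\<^sub>v n" unfolding Q(3) using v_carrier by simp
    then have "v c $ e l = 0" using en[OF l] by simp
    then show "c l = 0" using v_e[OF l] by simp
  next
    show "{Q *\<^sub>v v | v. v \<in> carrier_vec n \<and> (\<forall>i<n. i \<notin> I \<longrightarrow> v $ i = 0)} =
      {vec n (\<lambda>p. \<Sum>l<?g. c l * Q $$ (p, e l)) | c. True}" (is "?A = ?B")
    proof (rule antisym; rule subsetI)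
      fix x assume "x \<in> ?A"
      then obtain w where w: "x = Q *\<^sub>v w" "w \<in> carrier_vec n" "\<forall>i<n. i \<notin> I \<longrightarrow> w $ i = 0" by blast
      have "w = v (\<lambda>l. w $ e l)" by (rule v_all) (use w in auto)
      then have "x = Q *\<^sub>v v (\<lambda>l. w $ e l)" using w(1) by simp
      then show "x \<in> ?B" unfolding Qv' by (intro CollectI exI[of _ "\<lambda>l. w $ e l"]) simp
    next
      fix x assume "x \<in> ?B"
      then obtain c where "x = Q *\<^sub>v v c" unfolding Qv' by blast
      then show "x \<in> ?A" using v_carrier v_out by blast
    qed
  qed
  then show ?thesis by blast
qed

section \<open>Weierstrass forms\<close>

lemma pCons_minus_one: "[:- 1:] = (- 1 :: 'a :: comm_ring_1 poly)"
  by (metis minus_pCons minus_zero pCons_one)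

lemma pencil_mat_four_block:
  assumes "A \<in> carrier_mat n n" "B \<in> carrier_mat m m" "C \<in> carrier_mat n n" "D \<in> carrier_mat m m"
  shows "pencil_mat (four_block_mat A (0\<^sub>m n m) (0\<^sub>m m n) B, four_block_mat C (0\<^sub>m n m) (0\<^sub>m m n) D)
    = four_block_mat (pencil_mat (A, C)) (0\<^sub>m n m) (0\<^sub>m m n) (pencil_mat (B, D))"
  using assms by (intro eq_matI) (auto simp: pencil_mat_def)

abbreviation jordan_pencil :: "(nat \<times> complex) list \<Rightarrow> pencil" where
  "jordan_pencil bs \<equiv> (jordan_matrix bs, - 1\<^sub>m (sum_list (map fst bs)))"

abbreviation jordan_block_pencil :: "nat \<Rightarrow> complex \<Rightarrow> pencil" where
  "jordan_block_pencil j a \<equiv> (jordan_block j a, - 1\<^sub>m j)"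

lemma jordan_pencil_mat_Cons:
  "pencil_mat (jordan_pencil ((j, a) # bs)) =
    four_block_mat (pencil_mat (jordan_block_pencil j a)) (0\<^sub>m j (sum_list (map fst bs)))
      (0\<^sub>m (sum_list (map fst bs)) j) (pencil_mat (jordan_pencil bs))"
proof -
  let ?N = "sum_list (map fst bs)"
  have "- 1\<^sub>m (j + ?N) = four_block_mat (- 1\<^sub>m j) (0\<^sub>m j ?N) (0\<^sub>m ?N j) (- 1\<^sub>m ?N :: complex mat)"
    by (intro eq_matI) auto
  then show ?thesis unfolding jordan_matrix_Cons
    by (simp add: pencil_mat_four_block[symmetric])
qed

lemma det_jordan_block_pencil: "det (pencil_mat (jordan_block_pencil j a)) = [:a, -1:] ^ j"
proof -
  have "upper_triangular (pencil_mat (jordan_block_pencil j a))"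
    by (auto simp: upper_triangular_def pencil_mat_def)
  moreover have "diag_mat (pencil_mat (jordan_block_pencil j a)) = replicate j [:a, -1:]"
    by (intro nth_equalityI) (auto simp: diag_mat_def pencil_mat_def)
  moreover have "pencil_mat (jordan_block_pencil j a) \<in> carrier_mat j j"
    by (simp add: pencil_mat_carrier)
  ultimately show ?thesis
    by (metis det_upper_triangular prod_list_replicate)
qed

lemma det_jordan_pencil:
  "det (pencil_mat (jordan_pencil bs)) = (\<Prod>(j, a)\<leftarrow>bs. [:a, -1:] ^ j)"
proof (induction bs)
  case Nil
  have "pencil_mat (jordan_pencil []) \<in> carrier_mat 0 0" by (simp add: pencil_mat_def)
  then show ?case by (simp add: det_def)
next
  case (Cons ja bs)
  obtain j a where ja: "ja = (j, a)" by force
  let ?N = "sum_list (map fst bs)"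
  have "det (pencil_mat (jordan_pencil ((j, a) # bs))) =
    det (pencil_mat (jordan_block_pencil j a)) * det (pencil_mat (jordan_pencil bs))"
    unfolding jordan_pencil_mat_Cons
    by (rule det_four_block_mat_upper_right_zero[of _ j _ ?N]) (auto simp: pencil_mat_carrier)
  then show ?case using Cons by (simp add: ja det_jordan_block_pencil)
qed

lemma order_det_jordan_pencil:
  "order z (\<Prod>(j, a)\<leftarrow>bs. [:a, -1:] ^ j) = sum_list (map fst (filter (\<lambda>(j, a). a = z) bs))"
  "(\<Prod>(j, a)\<leftarrow>bs. [:a, -1::complex:] ^ j) \<noteq> 0"
proof -
  show nz: "(\<Prod>(j, a)\<leftarrow>bs. [:a, -1::complex:] ^ j) \<noteq> 0" for bs
    by (auto simp: prod_list_zero_iff)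
  have o: "order z ([:a, -1:] ^ j) = (if a = z then j else 0)" for a and j :: nat
  proof (cases "a = z")
    case True
    have "[:a, -1:] ^ j = ((-1) ^ j) * [:-a, 1:] ^ j"
      unfolding power_mult_distrib[symmetric] by (simp add: pCons_minus_one)
    moreover have "((-1) ^ j :: complex poly) = 1 \<or> ((-1) ^ j :: complex poly) = -1" by (cases "even j") auto
    ultimately show ?thesis using True order_power_n_n[of a j] by (auto simp: order_uminus)
  next
    case False
    then show ?thesis by (intro trans[OF order_0I]) auto
  qed
  show "order z (\<Prod>(j, a)\<leftarrow>bs. [:a, -1:] ^ j) = sum_list (map fst (filter (\<lambda>(j, a). a = z) bs))"
  proof (induction bs)
    case (Cons ja bs)
    obtain j a where ja: "ja = (j, a)" by force
    have "[:a, -1:] ^ j * (\<Prod>(j, a)\<leftarrow>bs. [:a, -1:] ^ j) \<noteq> 0" using nz[of bs] by simp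
    then show ?case using Cons by (simp add: ja order_mult o)
  qed simp
qed

text \<open>
Put \<open>t = x - z\<close>. Modulo \<open>t\<^sup>k\<close>, the equations for a chain \<open>f\<close> read \<open>f(i + 1) = t f(i)\<close>, and \<open>t f(i) = 0\<close> for the last
index \<open>i = j - 1\<close>. So \<open>f\<close> is determined by \<open>f(0)\<close>, the other entries vanish at \<open>z\<close>, and \<open>f(0)\<close> only has to
satisfy \<open>t\<^sup>j f(0) = 0\<close>. This leaves its value at \<open>z\<close> free if \<open>k \<le> j\<close> and makes it zero otherwise.
\<close>

lemma coord_root_jordan_block:
  assumes j: "j > 0" and k: "k > 0"
  shows "coord_root j (pencil_mat (jordan_block_pencil j z)) z k (if k \<le> j then {0} else {})"
proof -
  let ?M = "pencil_mat (jordan_block_pencil j z)" and ?t = "[:-z, 1:]"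
  have M: "?M \<in> carrier_mat j j" by (simp add: pencil_mat_carrier)
  have mult: "(?M *\<^sub>v f) $ i = (if Suc i < j then f $ Suc i else 0) - ?t * f $ i"
    if f: "f \<in> carrier_vec j" and i: "i < j" for f i
  proof -
    have "(?M *\<^sub>v f) $ i = (\<Sum>l = 0..<j. ?M $$ (i, l) * f $ l)"
      using f i M by (simp add: scalar_prod_def)
    also have "\<dots> = (\<Sum>l = 0..<j. (if l = i then [:z, -1:] * f $ l else 0) + (if l = Suc i then f $ l else 0))"
      by (intro sum.cong refl) (use i in \<open>auto simp: pencil_mat_def\<close>)
    also have "\<dots> = [:z, -1:] * f $ i + (if Suc i < j then f $ Suc i else 0)"
      using i by (simp add: sum.distrib)
    also have "[:z, -1:] = - ?t" by (simp add: pCons_minus_one)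
    finally show ?thesis by simp
  qed
  have sub: "v $ i = 0" if v: "v \<in> root_space ?M z k" and i: "i < j" "i \<noteq> 0 \<or> k > j" for v i
  proof -
    obtain f where f: "f \<in> carrier_vec j" "v = eval_vec z f"
      "\<And>i. i < j \<Longrightarrow> ?t ^ k dvd (?M *\<^sub>v f) $ i"
      using root_spaceE[OF M v] by blast
    have step: "?t ^ k dvd f $ Suc i - ?t * f $ i" if "Suc i < j" for i
      using f(3)[of i] mult[OF f(1), of i] that by (simp del: mult_pCons_left)
    have pow: "?t ^ k dvd f $ i - ?t ^ i * f $ 0" if "i < j" for i
      using that
    proof (induction i)
      case (Suc i)
      have "f $ Suc i - ?t ^ Suc i * f $ 0 = (f $ Suc i - ?t * f $ i) + ?t * (f $ i - ?t ^ i * f $ 0)"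
        by (simp add: algebra_simps)
      then show ?case using step[of i] Suc by (metis Suc_lessD dvd_add dvd_mult)
    qed simp
    show "v $ i = 0"
    proof (cases "i = 0")
      case False
      have "?t dvd ?t ^ k" using k by (simp add: dvd_power)
      moreover have "?t dvd ?t ^ i * f $ 0" using False by (simp add: dvd_power)
      ultimately have "?t dvd (f $ i - ?t ^ i * f $ 0) + ?t ^ i * f $ 0"
        using pow[OF i(1)] by (meson dvd_add dvd_trans)
      then show ?thesis using f i by (simp add: poly_eq_0_iff_dvd)
    next
      case True
      then have kj: "k > j" using i by simp
      have "?t ^ k dvd ?t * f $ (j - 1)" using f(3)[of "j - 1"] mult[OF f(1), of "j - 1"] j by (simp del: mult_pCons_left)
      moreover have "?t ^ k dvd ?t * (f $ (j - 1) - ?t ^ (j - 1) * f $ 0)"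
        using pow[of "j - 1"] j by (intro dvd_mult) simp
      ultimately have "?t ^ k dvd ?t * f $ (j - 1) - ?t * (f $ (j - 1) - ?t ^ (j - 1) * f $ 0)"
        by (rule dvd_diff)
      also have "\<dots> = ?t * ?t ^ (j - 1) * f $ 0" by (simp add: algebra_simps)
      also have "?t * ?t ^ (j - 1) = ?t ^ j" using j by (simp flip: power_Suc)
      finally have "?t ^ Suc j dvd ?t ^ j * f $ 0" using kj le_imp_power_dvd[of "Suc j" k ?t] by (meson Suc_leI dvd_trans)
      then have "?t ^ j * ?t dvd ?t ^ j * f $ 0" by (simp only: power_Suc2)
      then have "?t dvd f $ 0" by (subst (asm) dvd_times_left_cancel_iff) auto
      then show ?thesis using f i True by (simp add: poly_eq_0_iff_dvd)
    qed
  qed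
  have sup: "v \<in> root_space ?M z k"
    if v: "v \<in> carrier_vec j" and v0: "\<And>i. i < j \<Longrightarrow> i \<noteq> 0 \<or> k > j \<Longrightarrow> v $ i = 0" for v
  proof -
    define f where "f = vec j (\<lambda>i. ?t ^ i * [:v $ 0:])"
    have f: "f \<in> carrier_vec j" by (simp add: f_def)
    have "v = eval_vec z f" using v v0 j by (intro eq_vecI) (auto simp: f_def power_0_left)
    moreover have "?t ^ k dvd (?M *\<^sub>v f) $ i" if i: "i < j" for i
    proof (cases "Suc i < j")
      case True
      have "f $ Suc i = ?t * f $ i" using True i by (simp add: f_def)
      then show ?thesis unfolding mult[OF f i] using True by (simp del: mult_pCons_left)
    next
      case False
      then have "i = j - 1" using i by simp
      then have e: "(?M *\<^sub>v f) $ i = - (?t ^ j * [:v $ 0:])"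
        unfolding mult[OF f i] using j by (cases j) (simp_all add: f_def)
      show ?thesis
      proof (cases "k \<le> j")
        case True
        then show ?thesis unfolding e by (simp only: dvd_minus_iff) (intro dvd_mult2 le_imp_power_dvd)
      next
        case False
        then have "v $ 0 = 0" using v0[of 0] j by simp
        then show ?thesis unfolding e by simp
      qed
    qed
    ultimately show ?thesis using root_spaceI[OF M f] by simp
  qed
  have carr: "root_space ?M z k \<subseteq> carrier_vec j" using M unfolding root_space_def by auto
  have "root_space ?M z k = {v \<in> carrier_vec j. \<forall>i<j. i \<notin> (if k \<le> j then {0} else {}) \<longrightarrow> v $ i = 0}"
    (is "_ = ?R")
  proof (rule antisym; rule subsetI)
    fix v assume "v \<in> root_space ?M z k"
    then show "v \<in> ?R" using sub[of v] carr by (auto split: if_splits)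
  next
    fix v assume "v \<in> ?R"
    then show "v \<in> root_space ?M z k" by (intro sup) (auto split: if_splits)
  qed
  then show ?thesis using M j by (auto simp: coord_root_def)
qed

lemma coord_root_jordan_pencil:
  assumes "0 \<notin> fst ` set bs" and k: "k > 0"
  shows "\<exists>I. coord_root (sum_list (map fst bs)) (pencil_mat (jordan_pencil bs)) z k I \<and>
    card I = length (filter (\<lambda>(j, a). a = z \<and> k \<le> j) bs)"
  using assms(1)
proof (induction bs)
  case Nil
  have "pencil_mat (jordan_pencil []) \<in> carrier_mat 0 0" by (simp add: pencil_mat_def)
  moreover have "det (pencil_mat (jordan_pencil [])) = 1" using det_jordan_pencil[of "[]"] by simp
  ultimately have "coord_root 0 (pencil_mat (jordan_pencil [])) z k {}"
    using k by (intro coord_root_nonsingular) auto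
  then show ?case by auto
next
  case (Cons ja bs)
  obtain j a where ja: "ja = (j, a)" by force
  let ?N = "sum_list (map fst bs)"
  from Cons obtain I where I: "coord_root ?N (pencil_mat (jordan_pencil bs)) z k I"
    "card I = length (filter (\<lambda>(j, a). a = z \<and> k \<le> j) bs)" by auto
  have j: "j > 0" using Cons(2) by (auto simp: ja)
  have "\<exists>I'. coord_root j (pencil_mat (jordan_block_pencil j a)) z k I' \<and>
    card I' = (if a = z \<and> k \<le> j then 1 else 0)"
  proof (cases "a = z")
    case True
    show ?thesis using coord_root_jordan_block[OF j k, of z]
      by (intro exI[of _ "if k \<le> j then {0} else {}"]) (simp add: True)
  next
    case False
    have "coord_root j (pencil_mat (jordan_block_pencil j a)) z k {}"
      by (rule coord_root_nonsingular[OF _ _ k]) (use False in \<open>auto simp: pencil_mat_carrier det_jordan_block_pencil\<close>)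
    then show ?thesis using False by auto
  qed
  then obtain I' where I': "coord_root j (pencil_mat (jordan_block_pencil j a)) z k I'"
    "card I' = (if a = z \<and> k \<le> j then 1 else 0)" by auto
  have sub: "I' \<subseteq> {..<j}" "I \<subseteq> {..<?N}" using I I' by (auto simp: coord_root_def)
  have "card (I' \<union> (+) j ` I) = card I' + card ((+) j ` I)"
    by (rule card_Un_disjoint) (use sub finite_subset[OF sub(1)] finite_subset[OF sub(2)] in auto)
  also have "card ((+) j ` I) = card I" by (rule card_image) simp
  finally have "card (I' \<union> (+) j ` I) = length (filter (\<lambda>(j, a). a = z \<and> k \<le> j) (ja # bs))"
    using I I' by (simp add: ja)
  moreover have "coord_root (sum_list (map fst (ja # bs))) (pencil_mat (jordan_pencil (ja # bs))) z k (I' \<union> (+) j ` I)"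
    using coord_root_four_block[OF I'(1) I(1)] unfolding ja jordan_pencil_mat_Cons by simp
  ultimately show ?case by blast
qed

lemma jordan_matrix_nilpotent_diag:
  "i < sum_list ks \<Longrightarrow> jordan_matrix (map (\<lambda>k. (k, 0 :: complex)) ks) $$ (i, i) = 0"
proof (induction ks arbitrary: i)
  case (Cons k ks)
  then show ?case by (simp add: jordan_matrix_Cons o_def)
qed simp

text \<open>
The block of the infinite eigenvalue is invertible at every finite point, so it contributes
nothing there.
\<close>

lemma det_nilpotent_pencil:
  "det (pencil_mat (1\<^sub>m (sum_list ks), - jordan_matrix (map (\<lambda>k. (k, 0)) ks))) = 1"
proof -
  let ?J = "jordan_matrix (map (\<lambda>k. (k, 0 :: complex)) ks)" and ?K = "sum_list ks"
  let ?M = "pencil_mat (1\<^sub>m ?K, - ?J)"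
  have J: "?J \<in> carrier_mat ?K ?K" using jordan_matrix_carrier[of "map (\<lambda>k. (k, 0 :: complex)) ks"] by (simp add: o_def)
  have ut: "?J $$ (i, l) = 0" if "l < i" "i < ?K" for i l
    by (rule jordan_matrix_upper_triangular) (use that in \<open>auto simp: o_def\<close>)
  have M: "?M \<in> carrier_mat ?K ?K" by (rule pencil_mat_carrier) (use J in auto)
  have "upper_triangular ?M" unfolding upper_triangular_def
    using M J ut by (auto simp: pencil_mat_def)
  moreover have "diag_mat ?M = replicate ?K 1"
    using M J jordan_matrix_nilpotent_diag[of _ ks]
    by (intro nth_equalityI) (auto simp: diag_mat_def pencil_mat_def simp flip: one_pCons)
  ultimately show ?thesis using det_upper_triangular[OF _ M] by simp
qed

lemma invertible_matE:
  assumes "invertible_mat (P :: 'a :: semiring_1 mat)" "P \<in> carrier_mat n n"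
  obtains P' where "P' \<in> carrier_mat n n" "P' * P = 1\<^sub>m n" "P * P' = 1\<^sub>m n"
proof -
  obtain P' where P': "P * P' = 1\<^sub>m n" "P' * P = 1\<^sub>m (dim_row P')"
    using assms unfolding invertible_mat_def inverts_mat_def by auto
  have "dim_col P' = n" using P'(1) by (metis index_mult_mat(3) index_one_mat(3))
  moreover have "dim_row P' = n" using P'(2) assms(2) by (metis carrier_matD(2) index_mult_mat(3) index_one_mat(3))
  ultimately show ?thesis using that[of P'] P' by auto
qed

lemma const_mat_mult:
  "A \<in> carrier_mat nr n \<Longrightarrow> B \<in> carrier_mat n nc \<Longrightarrow> const_mat (A * B) = const_mat A * const_mat B"
  by (rule semiring_hom.mat_hom_mult[OF const_poly_hom.semiring_hom_axioms])

lemma const_mat_inverse: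
  assumes "P' \<in> carrier_mat n n" "P \<in> carrier_mat n n" "P' * P = 1\<^sub>m n"
  shows "const_mat P' * const_mat P = 1\<^sub>m n"
proof -
  have "const_mat P' * const_mat P = const_mat (1\<^sub>m n)" using const_mat_mult[OF assms(1,2)] assms(3) by simp
  also have "\<dots> = 1\<^sub>m n" by (intro eq_matI) (auto simp flip: one_pCons)
  finally show ?thesis .
qed

lemma pencil_mat_mult:
  assumes A: "A \<in> carrier_mat n n" "B \<in> carrier_mat n n" and P: "P \<in> carrier_mat n n" "Q \<in> carrier_mat n n"
  shows "pencil_mat (P * A * Q, P * B * Q) = const_mat P * pencil_mat (A, B) * const_mat Q"
proof -
  have "const_mat P * pencil_mat (A, B) * const_mat Q
     = (const_mat P * const_mat A + [:0, 1:] \<cdot>\<^sub>m (const_mat P * const_mat B)) * const_mat Q"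
    unfolding pencil_mat_altdef[OF A] using assms
    by (subst mult_add_distrib_mat[of _ n n _ n]) (auto simp: mult_smult_distrib[of _ n n _ n])
  also have "\<dots> = const_mat P * const_mat A * const_mat Q + [:0, 1:] \<cdot>\<^sub>m (const_mat P * const_mat B * const_mat Q)"
    using assms by (subst add_mult_distrib_mat[of _ n n _ _ n]) (auto simp: mult_smult_assoc_mat[of _ n n _ n])
  also have "\<dots> = const_mat (P * A * Q) + [:0, 1:] \<cdot>\<^sub>m const_mat (P * B * Q)"
    using assms by (simp add: const_mat_mult[of _ n n _ n])
  finally show ?thesis using assms by (simp add: pencil_mat_altdef[of _ n])
qed

lemma diag_block_mat_pair:
  "diag_block_mat [A, B] =
    four_block_mat A (0\<^sub>m (dim_row A) (dim_col B)) (0\<^sub>m (dim_row B) (dim_col A)) B"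
  by (subst diag_block_mat.simps(2)) (simp only: diag_block_mat_singleton Let_def)

text \<open>
Constant invertible factors change neither the order of the determinant nor the dimensions of
the root spaces, and both are additive over the blocks. So the block sizes at \<open>z\<close> can be recovered
from \<open>L\<close>, whichever Weierstrass form is chosen.
\<close>

lemma weierstrass_form_root_data:
  assumes L: "L \<in> pencils n" and W: "weierstrass_form L bs ks"
  shows "pencil_det L \<noteq> 0"
    and "order z (pencil_det L) = sum_list (map fst (filter (\<lambda>(j, a). a = z) bs))"
    and "k > 0 \<Longrightarrow> \<exists>b. basis_of n (root_space (pencil_mat L) z k) (length (filter (\<lambda>(j, a). a = z \<and> k \<le> j) bs)) b"
proof -
  let ?N = "sum_list (map fst bs)" and ?K = "sum_list ks"
  let ?J = "jordan_matrix bs" and ?JN = "jordan_matrix (map (\<lambda>k. (k, 0 :: complex)) ks)"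
  obtain n' A B P Q where LAB: "L = (A, B)" and c': "A \<in> carrier_mat n' n'" "B \<in> carrier_mat n' n'"
     "P \<in> carrier_mat n' n'" "Q \<in> carrier_mat n' n'" and inv: "invertible_mat P" "invertible_mat Q"
    and PAQ': "P * A * Q = diag_block_mat [?J, 1\<^sub>m ?K]"
    and PBQ': "P * B * Q = - diag_block_mat [1\<^sub>m ?N, ?JN]"
    and bs: "0 \<notin> fst ` set bs"
    using W unfolding weierstrass_form_def by (elim conjE exE) (rule that; assumption)
  have "n' = n" using L LAB c' by auto
  note c = c'[unfolded this]
  have J0: "?JN \<in> carrier_mat ?K ?K" using jordan_matrix_carrier[of "map (\<lambda>k. (k, 0 :: complex)) ks"] by (simp add: o_def)
  have PAQ: "P * A * Q = four_block_mat ?J (0\<^sub>m ?N ?K) (0\<^sub>m ?K ?N) (1\<^sub>m ?K)"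
    unfolding PAQ' diag_block_mat_pair by simp
  have PBQ: "P * B * Q = four_block_mat (- 1\<^sub>m ?N) (0\<^sub>m ?N ?K) (0\<^sub>m ?K ?N) (- ?JN)"
    unfolding PBQ' diag_block_mat_pair using J0 by (intro eq_matI) auto
  have n: "n = ?N + ?K"
  proof -
    have "dim_row (P * A * Q) = n" using c by simp
    then show ?thesis unfolding PAQ by simp
  qed
  obtain P' where P': "P' \<in> carrier_mat n n" "P' * P = 1\<^sub>m n" "P * P' = 1\<^sub>m n"
    using invertible_matE[OF inv(1) c(3)] by blast
  obtain Q' where Q': "Q' \<in> carrier_mat n n" "Q' * Q = 1\<^sub>m n" "Q * Q' = 1\<^sub>m n"
    using invertible_matE[OF inv(2) c(4)] by blast
  have dJ: "pencil_mat (jordan_pencil bs) \<in> carrier_mat ?N ?N" by (auto simp: pencil_mat_carrier)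
  have dJ0: "pencil_mat (1\<^sub>m ?K, - ?JN) \<in> carrier_mat ?K ?K" using J0 by (auto simp: pencil_mat_carrier)
  let ?D = "four_block_mat (pencil_mat (jordan_pencil bs)) (0\<^sub>m ?N ?K) (0\<^sub>m ?K ?N) (pencil_mat (1\<^sub>m ?K, - ?JN))"
  have D: "const_mat P * pencil_mat L * const_mat Q = ?D"
  proof -
    have "pencil_mat (P * A * Q, P * B * Q) = ?D"
      unfolding PAQ PBQ by (rule pencil_mat_four_block) (use J0 in auto)
    then show ?thesis using pencil_mat_mult[OF c] LAB by simp
  qed
  have cL: "pencil_mat L \<in> carrier_mat n n" by (rule pencil_mat_carrier[OF L])
  have cD: "?D \<in> carrier_mat n n" unfolding n using dJ dJ0 by simp
  have cP: "const_mat P \<in> carrier_mat n n" "const_mat Q \<in> carrier_mat n n"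
    "const_mat P' \<in> carrier_mat n n" "const_mat Q' \<in> carrier_mat n n" using c P' Q' by auto
  have inv: "const_mat P' * const_mat P = 1\<^sub>m n" "const_mat Q * const_mat Q' = 1\<^sub>m n" "const_mat P * const_mat P' = 1\<^sub>m n"
    using const_mat_inverse P' Q' c by auto
  have detD: "det ?D = (\<Prod>(j, a)\<leftarrow>bs. [:a, -1:] ^ j)"
    using det_four_block_mat_upper_right_zero[OF dJ refl zero_carrier_mat dJ0]
    by (simp add: det_jordan_pencil det_nilpotent_pencil)
  have "det (const_mat P * pencil_mat L * const_mat Q) = det (const_mat P) * pencil_det L * det (const_mat Q)"
    using cP cL by (simp add: det_mult[of _ n] pencil_det_pencil_mat)
  then have prod: "(\<Prod>(j, a)\<leftarrow>bs. [:a, -1:] ^ j) = det (const_mat P) * pencil_det L * det (const_mat Q)"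
    unfolding D detD .
  show nz: "pencil_det L \<noteq> 0"
  proof
    assume "pencil_det L = 0"
    then show False using prod order_det_jordan_pencil(2)[of bs] by simp
  qed
  have unit: "order z (det (const_mat R)) = 0" if "det (const_mat R) \<noteq> 0" for R
  proof -
    have "det (const_mat R) = [:det R:]" by (rule comm_ring_hom.hom_det[OF const_poly_hom.comm_ring_hom_axioms])
    then show ?thesis using that by (intro order_0I) auto
  qed
  have "order z (p * D * q) = order z D" if "p * D * q \<noteq> 0" "order z p = 0" "order z q = 0" for p D q
    using that by (simp add: order_mult)
  then have "order z (det (const_mat P) * pencil_det L * det (const_mat Q)) = order z (pencil_det L)"
    using order_det_jordan_pencil(2)[of bs] unfolding prod
    by (metis unit mult_zero_left mult_zero_right)
  then show "order z (pencil_det L) = sum_list (map fst (filter (\<lambda>(j, a). a = z) bs))"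
    unfolding prod[symmetric] by (simp add: order_det_jordan_pencil(1))
  assume k: "k > 0"
  obtain I where I: "coord_root ?N (pencil_mat (jordan_pencil bs)) z k I"
    "card I = length (filter (\<lambda>(j, a). a = z \<and> k \<le> j) bs)"
    using coord_root_jordan_pencil[OF bs k] by blast
  have "coord_root ?K (pencil_mat (1\<^sub>m ?K, - ?JN)) z k {}"
    by (rule coord_root_nonsingular[OF dJ0 _ k]) (simp add: det_nilpotent_pencil)
  then have "coord_root n ?D z k (I \<union> (+) ?N ` {})" unfolding n by (rule coord_root_four_block[OF I(1)])
  then have ID: "I \<subseteq> {..<n}" "root_space ?D z k = {v \<in> carrier_vec n. \<forall>i<n. i \<notin> I \<longrightarrow> v $ i = 0}"
    by (auto simp: coord_root_def)
  have evc: "eval_mat z (const_mat R) = R" for R by (intro eq_matI) auto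
  have "root_space (pencil_mat L) z k = {Q *\<^sub>v v | v. v \<in> carrier_vec n \<and> (\<forall>i<n. i \<notin> I \<longrightarrow> v $ i = 0)}" (is "_ = ?R")
  proof (rule antisym; rule subsetI)
    fix x assume x: "x \<in> root_space (pencil_mat L) z k"
    have xc: "x \<in> carrier_vec n" using root_spaceE[OF cL x] by (metis map_carrier_vec)
    have LD: "pencil_mat L = const_mat P' * ?D * const_mat Q'"
    proof -
      have "const_mat P' * ?D * const_mat Q' = (const_mat P' * const_mat P) * pencil_mat L * (const_mat Q * const_mat Q')"
        unfolding D[symmetric] using cP cL by (simp add: assoc_mult_mat[of _ n n _ n _ n])
      then show ?thesis unfolding inv using cL by simp
    qed
    have "Q' *\<^sub>v x \<in> root_space ?D z k"
      using root_space_transform[OF cD cP(3) cP(1) cP(4) inv(3)] x[unfolded LD] evc by metis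
    then have "Q' *\<^sub>v x \<in> carrier_vec n \<and> (\<forall>i<n. i \<notin> I \<longrightarrow> (Q' *\<^sub>v x) $ i = 0)" unfolding ID by blast
    moreover have "x = Q *\<^sub>v (Q' *\<^sub>v x)"
      using xc c Q' by (simp flip: assoc_mult_mat_vec[of Q n n Q' n])
    ultimately show "x \<in> ?R" by blast
  next
    fix x assume "x \<in> ?R"
    then obtain v where v: "x = Q *\<^sub>v v" "v \<in> root_space ?D z k" unfolding ID by blast
    show "x \<in> root_space (pencil_mat L) z k"
      using root_space_transform[OF cL cP(1) cP(3) cP(2) inv(1)] v D evc by metis
  qed
  then show "\<exists>b. basis_of n (root_space (pencil_mat L) z k) (length (filter (\<lambda>(j, a). a = z \<and> k \<le> j) bs)) b"
    using basis_of_columns[OF ID(1) c(4) Q'(1,2)] I(2) by simp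
qed

section \<open>Existence of the Weierstrass form\<close>

lemma inverse_if_det_nonzero:
  assumes X: "(X :: 'a :: field mat) \<in> carrier_mat n n" and d: "det X \<noteq> 0"
  obtains X' where "X' \<in> carrier_mat n n" "X' * X = 1\<^sub>m n" "X * X' = 1\<^sub>m n"
proof
  let ?X' = "(1 / det X) \<cdot>\<^sub>m adj_mat X"
  note a = adj_mat[OF X]
  show "?X' \<in> carrier_mat n n" using a by simp
  have "?X' * X = (1 / det X) \<cdot>\<^sub>m (adj_mat X * X)" using a X by (simp add: mult_smult_assoc_mat[of _ n n _ n])
  then show "?X' * X = 1\<^sub>m n" unfolding a using d by (intro eq_matI) auto
  have "X * ?X' = (1 / det X) \<cdot>\<^sub>m (X * adj_mat X)" using a X by (simp add: mult_smult_distrib[of _ n n _ n])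
  then show "X * ?X' = 1\<^sub>m n" unfolding a using d by (intro eq_matI) auto
qed

lemma invertible_mat_if_det_nonzero:
  assumes X: "(X :: 'a :: field mat) \<in> carrier_mat n n" and d: "det X \<noteq> 0"
  shows "invertible_mat X"
proof -
  obtain X' where "X' \<in> carrier_mat n n" "X' * X = 1\<^sub>m n" "X * X' = 1\<^sub>m n"
    using inverse_if_det_nonzero[OF X d] .
  then show ?thesis using X unfolding invertible_mat_def inverts_mat_def by auto
qed

lemma det_nonzero_if_inverse:
  assumes "(X :: 'a :: field mat) \<in> carrier_mat n n" "Y \<in> carrier_mat n n" "X * Y = 1\<^sub>m n"
  shows "det X \<noteq> 0" "det Y \<noteq> 0"
proof -
  have "det X * det Y = 1" using det_mult[OF assms(1,2)] assms(3) by simp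
  then show "det X \<noteq> 0" "det Y \<noteq> 0" by auto
qed

lemma similar_mat_swap_blocks:
  assumes A: "(A :: 'a :: comm_ring_1 mat) \<in> carrier_mat n n" and B: "B \<in> carrier_mat m m"
  shows "similar_mat (four_block_mat A (0\<^sub>m n m) (0\<^sub>m m n) B) (four_block_mat B (0\<^sub>m m n) (0\<^sub>m n m) A)"
proof -
  let ?P = "four_block_mat (0\<^sub>m n m) (1\<^sub>m n) (1\<^sub>m m) (0\<^sub>m m n) :: 'a mat"
  let ?Q = "four_block_mat (0\<^sub>m m n) (1\<^sub>m m) (1\<^sub>m n) (0\<^sub>m n m) :: 'a mat"
  let ?A = "four_block_mat A (0\<^sub>m n m) (0\<^sub>m m n) B"
  let ?B = "four_block_mat B (0\<^sub>m m n) (0\<^sub>m n m) A"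
  note zo = zero_carrier_mat one_carrier_mat
  have PQ: "?P * ?Q = 1\<^sub>m (n + m)"
    by (subst mult_four_block_mat[OF zo(1) zo(2) zo(2) zo(1) zo(1) zo(2) zo(2) zo(1)]) simp
  have "?Q * ?P = 1\<^sub>m (m + n)"
    by (subst mult_four_block_mat[OF zo(1) zo(2) zo(2) zo(1) zo(1) zo(2) zo(2) zo(1)]) simp
  then have QP: "?Q * ?P = 1\<^sub>m (n + m)" by (simp only: add.commute)
  have PB: "?P * ?B = four_block_mat (0\<^sub>m n m) A B (0\<^sub>m m n)"
    by (rule trans[OF mult_four_block_mat[OF zo(1) zo(2) zo(2) zo(1) B zo(1) zo(1) A]], rule cong_four_block_mat)
      (simp_all add: left_mult_zero_mat[OF B] left_mult_one_mat[OF B] left_mult_zero_mat[OF A] left_mult_one_mat[OF A] left_add_zero_mat[OF A] right_add_zero_mat[OF B])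
  have "?P * ?B * ?Q = ?A"
    unfolding PB
    by (rule trans[OF mult_four_block_mat[OF zo(1) A B zo(1) zo(1) zo(2) zo(2) zo(1)]], rule cong_four_block_mat)
      (simp_all add: right_mult_zero_mat[OF B] right_mult_one_mat[OF B] right_mult_zero_mat[OF A] right_mult_one_mat[OF A] left_add_zero_mat[OF A] right_add_zero_mat[OF B])
  then have sand: "?A = ?P * ?B * ?Q" by (rule sym)
  have "?P \<in> carrier_mat (n + m) (m + n)" "?Q \<in> carrier_mat (m + n) (n + m)" "?B \<in> carrier_mat (m + n) (m + n)"
    by (intro four_block_carrier_mat zo B A)+
  then have carr: "?P \<in> carrier_mat (n + m) (n + m)" "?Q \<in> carrier_mat (n + m) (n + m)" "?B \<in> carrier_mat (n + m) (n + m)"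
    by (simp_all only: add.commute[of m n])
  have "?A \<in> carrier_mat (n + m) (n + m)" by (intro four_block_carrier_mat A B)
  then have "similar_mat_wit ?A ?B ?P ?Q"
    by (rule similar_mat_witI[OF PQ QP sand]) (rule carr)+
  then show ?thesis unfolding similar_mat_def by blast
qed

lemma jordan_matrix_append:
  "jordan_matrix (xs @ ys) = four_block_mat (jordan_matrix xs)
     (0\<^sub>m (sum_list (map fst xs)) (sum_list (map fst ys)))
     (0\<^sub>m (sum_list (map fst ys)) (sum_list (map fst xs))) (jordan_matrix ys)"
  unfolding jordan_matrix_def map_append diag_block_mat_append Let_def
  by (simp flip: jordan_matrix_def)

lemma similar_jordan_matrix_commute:
  "similar_mat (jordan_matrix (xs @ ys) :: 'a :: comm_ring_1 mat) (jordan_matrix (ys @ xs))"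
  unfolding jordan_matrix_append by (rule similar_mat_swap_blocks) auto

lemma similar_jordan_matrix_append:
  assumes "similar_mat (jordan_matrix xs :: 'a :: comm_ring_1 mat) (jordan_matrix xs')"
    and "similar_mat (jordan_matrix ys) (jordan_matrix ys')"
    and "sum_list (map fst xs) = sum_list (map fst xs')" "sum_list (map fst ys) = sum_list (map fst ys')"
  shows "similar_mat (jordan_matrix (xs @ ys)) (jordan_matrix (xs' @ ys'))"
  unfolding jordan_matrix_append assms(3,4)[symmetric]
  by (rule similar_mat_four_block_0_0[OF assms(1,2)]) auto

text \<open>
This is used to move the blocks with nonzero eigenvalues to the front.
\<close>

lemma similar_jordan_matrix_partition:
  "similar_mat (jordan_matrix bs :: 'a :: comm_ring_1 mat) (jordan_matrix (filter p bs @ filter (\<lambda>x. \<not> p x) bs))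
   \<and> sum_list (map fst (filter p bs @ filter (\<lambda>x. \<not> p x) bs)) = sum_list (map fst bs)"
proof (induction bs)
  case Nil
  have "jordan_matrix [] \<in> carrier_mat 0 0" using jordan_matrix_carrier[of "[]"] by simp
  then show ?case by (auto intro: similar_mat_refl)
next
  case (Cons x bs)
  let ?F = "filter p bs" and ?G = "filter (\<lambda>x. \<not> p x) bs"
  have refl: "similar_mat (jordan_matrix xs) (jordan_matrix xs)" for xs :: "(nat \<times> 'a) list"
    by (rule similar_mat_refl[OF jordan_matrix_carrier])
  have 1: "similar_mat (jordan_matrix ([x] @ bs)) (jordan_matrix ([x] @ (?F @ ?G)))"
    by (rule similar_jordan_matrix_append) (use Cons refl in auto)
  show ?case
  proof (cases "p x")
    case True
    then show ?thesis using 1 Cons by simp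
  next
    case False
    have "similar_mat (jordan_matrix (([x] @ ?F) @ ?G)) (jordan_matrix ((?F @ [x]) @ ?G))"
      by (rule similar_jordan_matrix_append[OF similar_jordan_matrix_commute refl]) auto
    then have "similar_mat (jordan_matrix (x # bs)) (jordan_matrix (?F @ x # ?G))"
      using similar_mat_trans[OF 1] by simp
    then show ?thesis using False Cons by simp
  qed
qed

lemma jordan_nf_complex:
  assumes "A \<in> carrier_mat n n"
  shows "\<exists>bs. jordan_nf (A :: complex mat) bs"
  using char_poly_factorized[OF assms] jordan_nf_exists[OF assms] by blast

lemma jordan_nf_dim:
  assumes A: "A \<in> carrier_mat n n" and "jordan_nf A bs"
  shows "sum_list (map fst bs) = n"
proof -
  obtain m P Q where "{A, jordan_matrix bs, P, Q} \<subseteq> carrier_mat m m"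
    using assms(2) similar_matD unfolding jordan_nf_def by blast
  then have "m = n" "jordan_matrix bs \<in> carrier_mat m m" using A by auto
  then show ?thesis using jordan_matrix_dim(1)[of bs] by auto
qed

lemma nilpotent_jordan_nf:
  assumes N: "(N :: complex mat) \<in> carrier_mat n n" and ev: "\<And>a. eigenvalue N a \<Longrightarrow> a = 0"
  shows "\<exists>ks. jordan_nf N (map (\<lambda>k. (k, 0)) ks)"
proof -
  obtain bs where bs: "jordan_nf N bs" using jordan_nf_complex[OF N] by blast
  have "a = 0" if ja: "(j, a) \<in> set bs" for j a
  proof (rule ev)
    have "j \<noteq> 0" using bs ja unfolding jordan_nf_def by force
    then have "poly ([:- a, 1:] ^ j) a = 0" by simp
    then have "poly (\<Prod>(j, a)\<leftarrow>bs. [:- a, 1:] ^ j) a = 0"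
      using ja by (force simp: poly_prod_list prod_list_zero_iff)
    then have "poly (char_poly N) a = 0" using jordan_nf_char_poly[OF bs] by simp
    then show "eigenvalue N a" using eigenvalue_root_char_poly[OF N] by simp
  qed
  then have "map (\<lambda>k. (k, 0)) (map fst bs) = bs"
    unfolding map_map o_def by (intro map_idI) (auto simp: prod_eq_iff)
  then show ?thesis using bs by metis
qed

text \<open>
Choose \<open>c\<close> such that \<open>X = A + c B\<close> is invertible and bring \<open>M = inv X B\<close> to the form \<open>diag (M1, M0)\<close> with
\<open>M1\<close> invertible and \<open>M0\<close> nilpotent. As \<open>A + x B = X (1 + (x - c) M)\<close>, multiplication by
\<open>- inv M1\<close> turns the first block into \<open>(c - inv M1) - x\<close>, and multiplication by \<open>inv (1 - c M0)\<close> turns the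
second one into \<open>1 - x N\<close> with \<open>N\<close> nilpotent. It remains to take the Jordan forms of \<open>c - inv M1\<close> and \<open>N\<close>.
\<close>

lemma weierstrass_form_exists:
  assumes L: "L \<in> pencils n" and reg: "pencil_det L \<noteq> 0"
  shows "\<exists>bs ks. weierstrass_form L bs ks"
proof -
  obtain A B where AB: "L = (A, B)" "A \<in> carrier_mat n n" "B \<in> carrier_mat n n" using L by auto
  obtain c where c: "poly (pencil_det L) c \<noteq> 0" using reg poly_all_0_iff_0 by blast
  let ?X = "A + c \<cdot>\<^sub>m B"
  have X: "?X \<in> carrier_mat n n" "det ?X \<noteq> 0"
    using AB c by (auto simp: poly_pencil_det)
  obtain X' where X': "X' \<in> carrier_mat n n" "X' * ?X = 1\<^sub>m n" "?X * X' = 1\<^sub>m n"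
    using inverse_if_det_nonzero[OF X] .
  define M where "M = X' * B"
  have M: "M \<in> carrier_mat n n" using X' AB by (simp add: M_def)
  have X'A: "X' * A = 1\<^sub>m n - c \<cdot>\<^sub>m M"
  proof -
    have "1\<^sub>m n = X' * A + c \<cdot>\<^sub>m M"
      unfolding X'(2)[symmetric] M_def using AB X'
      by (subst mult_add_distrib_mat[of _ n n _ n]) (auto simp: mult_smult_distrib[of _ n n _ n])
    moreover have "X' * A \<in> carrier_mat n n" using X' AB by simp
    ultimately show ?thesis using M by (intro eq_matI) auto
  qed
  obtain as where as: "jordan_nf M as" using jordan_nf_complex[OF M] by blast
  let ?F = "filter (\<lambda>x. snd x \<noteq> 0) as" and ?G = "filter (\<lambda>x. \<not> snd x \<noteq> 0) as"
  define ms where "ms = map fst ?G"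
  have G: "?G = map (\<lambda>k. (k, 0)) ms"
    unfolding ms_def map_map o_def by (rule map_idI[symmetric]) (auto simp: prod_eq_iff)
  let ?p = "sum_list (map fst ?F)" and ?q = "sum_list ms"
  \<comment> \<open>the invertible and the nilpotent part of \<open>M\<close>\<close>
  define M1 where "M1 = jordan_matrix ?F"
  define M0 where "M0 = jordan_matrix (map (\<lambda>k. (k, 0 :: complex)) ms)"
  have M1: "M1 \<in> carrier_mat ?p ?p" by (simp add: M1_def)
  have M0: "M0 \<in> carrier_mat ?q ?q"
    using jordan_matrix_carrier[of "map (\<lambda>k. (k, 0 :: complex)) ms"] by (simp add: M0_def o_def)
  define D where "D = four_block_mat M1 (0\<^sub>m ?p ?q) (0\<^sub>m ?q ?p) M0"
  have "similar_mat (jordan_matrix as) (jordan_matrix (?F @ ?G))"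
    using similar_jordan_matrix_partition by blast
  also have "jordan_matrix (?F @ ?G) = D"
    unfolding G jordan_matrix_append D_def M1_def M0_def by (simp add: o_def)
  finally have "similar_mat M D"
    using as similar_mat_trans unfolding jordan_nf_def by blast
  then obtain S S' where w: "similar_mat_wit M D S S'" unfolding similar_mat_def by blast
  have S: "S \<in> carrier_mat n n" "S' \<in> carrier_mat n n" "S' * S = 1\<^sub>m n" "S * S' = 1\<^sub>m n" "M = S * D * S'"
    and D: "D \<in> carrier_mat n n"
    using similar_mat_witD2[OF M w] by auto
  have n: "n = ?p + ?q" using D M1 M0 by (auto simp: D_def)
  have S'MS: "S' * M * S = D"
  proof -
    have "S' * M * S = (S' * S) * D * (S' * S)"
      unfolding S(5) using S(1,2) D by (simp add: assoc_mult_mat[of _ n n _ n _ n])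
    then show ?thesis unfolding S(3) using D by simp
  qed
  have "det M1 \<noteq> 0"
  proof -
    have "M1 + 0 \<cdot>\<^sub>m (- 1\<^sub>m ?p) = M1" using M1 by (intro eq_matI) auto
    then have "det M1 = poly (pencil_det (M1, - 1\<^sub>m ?p)) 0"
      by (subst poly_pencil_det[OF M1]) (simp_all only: uminus_carrier_iff_mat one_carrier_mat)
    also have "\<dots> = poly (\<Prod>(j, a)\<leftarrow>?F. [:a, -1:] ^ j) 0"
      unfolding M1_def pencil_det_pencil_mat det_jordan_pencil ..
    also have "\<dots> \<noteq> 0" by (auto simp: poly_prod_list prod_list_zero_iff)
    finally show ?thesis .
  qed
  then obtain M1' where M1': "M1' \<in> carrier_mat ?p ?p" "M1' * M1 = 1\<^sub>m ?p" "M1 * M1' = 1\<^sub>m ?p"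
    using inverse_if_det_nonzero[OF M1] by blast
  let ?Y = "1\<^sub>m ?q - c \<cdot>\<^sub>m M0"
  have Y: "?Y \<in> carrier_mat ?q ?q" by (intro minus_carrier_mat smult_carrier_mat M0)
  have "det ?Y \<noteq> 0"
  proof -
    have "?Y = 1\<^sub>m ?q + c \<cdot>\<^sub>m (- M0)" using M0 by (intro eq_matI) auto
    then have "det ?Y = poly (pencil_det (1\<^sub>m ?q, - M0)) c"
      using M0 by (simp add: poly_pencil_det[of _ ?q])
    then show ?thesis by (simp add: pencil_det_pencil_mat M0_def det_nilpotent_pencil)
  qed
  then obtain W where W: "W \<in> carrier_mat ?q ?q" "W * ?Y = 1\<^sub>m ?q" "?Y * W = 1\<^sub>m ?q"
    using inverse_if_det_nonzero[OF Y] by blast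
  define F' where "F' = c \<cdot>\<^sub>m 1\<^sub>m ?p - M1'"
  define N' where "N' = - (W * M0)"
  have F': "F' \<in> carrier_mat ?p ?p" and N': "N' \<in> carrier_mat ?q ?q"
    using M1' W M0 by (auto simp: F'_def N'_def)
  obtain bs where bs: "jordan_nf F' bs" using jordan_nf_complex[OF F'] by blast
  have "\<exists>ks. jordan_nf N' (map (\<lambda>k. (k, 0)) ks)"
  proof (rule nilpotent_jordan_nf[OF N'])
    fix a assume "eigenvalue N' a"
    then obtain v where v: "v \<in> carrier_vec ?q" "v \<noteq> 0\<^sub>v ?q" "N' *\<^sub>v v = a \<cdot>\<^sub>v v"
      using N' unfolding eigenvalue_def eigenvector_def by auto
    have M0v: "M0 *\<^sub>v v \<in> carrier_vec ?q" using M0 v by simp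
    have WM: "W *\<^sub>v (M0 *\<^sub>v v) = (- a) \<cdot>\<^sub>v v"
    proof -
      have "(W * M0) *\<^sub>v v = - (N' *\<^sub>v v)"
        unfolding N'_def using W M0 v by (intro eq_vecI) auto
      also have "\<dots> = (- a) \<cdot>\<^sub>v v" unfolding v(3) by (intro eq_vecI) auto
      finally show ?thesis using W M0 v by (simp add: assoc_mult_mat_vec[of _ ?q ?q _ ?q])
    qed
    have "M0 *\<^sub>v v = (?Y * W) *\<^sub>v (M0 *\<^sub>v v)" unfolding W(3) using M0v by simp
    also have "\<dots> = ?Y *\<^sub>v ((- a) \<cdot>\<^sub>v v)"
      by (subst assoc_mult_mat_vec[OF Y W(1) M0v]) (simp only: WM)
    also have "\<dots> = (- a) \<cdot>\<^sub>v (?Y *\<^sub>v v)" using Y v by (simp add: mult_mat_vec[of _ ?q ?q])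
    also have "?Y *\<^sub>v v = v - c \<cdot>\<^sub>v (M0 *\<^sub>v v)"
    proof -
      have "(c \<cdot>\<^sub>m M0) *\<^sub>v v = c \<cdot>\<^sub>v (M0 *\<^sub>v v)" using M0 v by (intro eq_vecI) auto
      then show ?thesis
        using M0 v by (subst minus_mult_distrib_mat_vec[of _ ?q ?q]) auto
    qed
    finally have e: "M0 *\<^sub>v v = (- a) \<cdot>\<^sub>v (v - c \<cdot>\<^sub>v (M0 *\<^sub>v v))" .
    have ei: "(a * c - 1) * (M0 *\<^sub>v v) $ i = a * v $ i" if "i < ?q" for i
    proof -
      have "(M0 *\<^sub>v v) $ i = ((- a) \<cdot>\<^sub>v (v - c \<cdot>\<^sub>v (M0 *\<^sub>v v))) $ i" using e by simp
      also have "\<dots> = - a * (v $ i - c * (M0 *\<^sub>v v) $ i)" using that M0 v by (simp del: index_mult_mat_vec)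
      also have "\<dots> = a * c * (M0 *\<^sub>v v) $ i - a * v $ i" by (simp add: algebra_simps)
      finally have x: "(M0 *\<^sub>v v) $ i = a * c * (M0 *\<^sub>v v) $ i - a * v $ i" .
      have "a * c * (M0 *\<^sub>v v) $ i - (a * c * (M0 *\<^sub>v v) $ i - a * v $ i) = a * v $ i" by simp
      then show ?thesis unfolding x[symmetric] by (simp add: left_diff_distrib)
    qed
    show "a = 0"
    proof (rule ccontr)
      assume a: "a \<noteq> 0"
      obtain i where i: "i < ?q" "v $ i \<noteq> 0" using v by (metis eq_vecI carrier_vecD index_zero_vec)
      have ac: "a * c - 1 \<noteq> 0"
      proof
        assume "a * c - 1 = 0"
        then show False using ei[OF i(1)] a i(2) by simp
      qed
      have "M0 *\<^sub>v v = (a / (a * c - 1)) \<cdot>\<^sub>v v"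
        using ei ac M0v v M0 by (intro eq_vecI) (auto simp: field_simps)
      then have "eigenvalue M0 (a / (a * c - 1))"
        unfolding eigenvalue_def eigenvector_def using v M0 by auto
      then have "poly (char_poly M0) (a / (a * c - 1)) = 0" using eigenvalue_root_char_poly[OF M0] by simp
      then have "a / (a * c - 1) = 0"
        unfolding M0_def jordan_matrix_char_poly by (auto simp: poly_prod_list prod_list_zero_iff o_def)
      then show False using a ac by simp
    qed
  qed
  then obtain ks where ks: "jordan_nf N' (map (\<lambda>k. (k, 0)) ks)" by blast
  let ?J = "jordan_matrix bs" and ?JN = "jordan_matrix (map (\<lambda>k. (k, 0 :: complex)) ks)"
  have dims: "sum_list (map fst bs) = ?p" "sum_list ks = ?q"
    using jordan_nf_dim[OF F' bs] jordan_nf_dim[OF N' ks] by (simp_all add: o_def)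
  obtain S1 S1' where w1: "similar_mat_wit F' ?J S1 S1'"
    using bs unfolding jordan_nf_def similar_mat_def by blast
  obtain S2 S2' where w2: "similar_mat_wit N' ?JN S2 S2'"
    using ks unfolding jordan_nf_def similar_mat_def by blast
  have 1: "S1 \<in> carrier_mat ?p ?p" "S1' \<in> carrier_mat ?p ?p" "S1' * S1 = 1\<^sub>m ?p" "S1 * S1' = 1\<^sub>m ?p"
    "?J \<in> carrier_mat ?p ?p" "?J = S1' * F' * S1"
    using similar_mat_witD2[OF F' w1] similar_mat_witD2[OF _ similar_mat_wit_sym[OF w1], of ?p] by auto
  have 2: "S2 \<in> carrier_mat ?q ?q" "S2' \<in> carrier_mat ?q ?q" "S2' * S2 = 1\<^sub>m ?q" "S2 * S2' = 1\<^sub>m ?q"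
    "?JN \<in> carrier_mat ?q ?q" "?JN = S2' * N' * S2"
    using similar_mat_witD2[OF N' w2] similar_mat_witD2[OF _ similar_mat_wit_sym[OF w2], of ?q] by auto
  let ?dg = "\<lambda>U V. four_block_mat U (0\<^sub>m ?p ?q) (0\<^sub>m ?q ?p) V :: complex mat"
  have dg: "?dg U V \<in> carrier_mat n n" if "U \<in> carrier_mat ?p ?p" "V \<in> carrier_mat ?q ?q" for U V
    unfolding n using that by simp
  have dg_mult: "?dg U V * ?dg U' V' = ?dg (U * U') (V * V')"
    if "U \<in> carrier_mat ?p ?p" "V \<in> carrier_mat ?q ?q" "U' \<in> carrier_mat ?p ?p" "V' \<in> carrier_mat ?q ?q"
    for U V U' V'
    by (subst mult_four_block_mat[of _ ?p ?p _ ?q _ ?q _ _ ?p _ ?q]) (use that in auto)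
  have dg_det: "det (?dg U V) = det U * det V"
    if "U \<in> carrier_mat ?p ?p" "V \<in> carrier_mat ?q ?q" for U V
    by (rule det_four_block_mat_upper_right_zero) (use that in auto)
  define K where "K = ?dg (- M1') W"
  define T where "T = ?dg S1' S2'"
  define T' where "T' = ?dg S1 S2"
  have K: "K \<in> carrier_mat n n" and T: "T \<in> carrier_mat n n" and T': "T' \<in> carrier_mat n n"
    unfolding K_def T_def T'_def using M1' W 1 2 by (auto intro!: dg)
  define P where "P = T * K * S' * X'"
  define Q where "Q = S * T'"
  have PQ: "P \<in> carrier_mat n n" "Q \<in> carrier_mat n n" using K T T' S X' by (auto simp: P_def Q_def)
  have sandwich: "P * Z * Q = T * (K * (S' * (X' * Z) * S)) * T'" if "Z \<in> carrier_mat n n" for Z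
    unfolding P_def Q_def using that K T T' S(1,2) X'(1) by (simp add: assoc_mult_mat[of _ n n _ n _ n])
  have KD: "K * D = ?dg (- 1\<^sub>m ?p) (W * M0)"
  proof -
    have "- M1' * M1 = - 1\<^sub>m ?p" using M1 M1' by simp
    then show ?thesis unfolding K_def D_def using M1 M1' W M0 by (simp add: dg_mult)
  qed
  have "K * (1\<^sub>m n - c \<cdot>\<^sub>m D) = ?dg F' (1\<^sub>m ?q)"
  proof -
    have "1\<^sub>m n - c \<cdot>\<^sub>m D = ?dg (1\<^sub>m ?p - c \<cdot>\<^sub>m M1) ?Y"
      unfolding D_def n using M1 M0 by (intro eq_matI) auto
    moreover have "- M1' * (1\<^sub>m ?p - c \<cdot>\<^sub>m M1) = F'"
    proof -
      have "M1' * (1\<^sub>m ?p - c \<cdot>\<^sub>m M1) = M1' - c \<cdot>\<^sub>m 1\<^sub>m ?p"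
        using M1 M1' by (simp add: mult_minus_distrib_mat[of _ ?p ?p _ ?p] mult_smult_distrib[of _ ?p ?p _ ?p])
      then have "- (M1' * (1\<^sub>m ?p - c \<cdot>\<^sub>m M1)) = F'" unfolding F'_def using M1' by (intro eq_matI) auto
      then show ?thesis using M1 M1' by simp
    qed
    moreover have "?dg (- M1') W * ?dg (1\<^sub>m ?p - c \<cdot>\<^sub>m M1) ?Y = ?dg (- M1' * (1\<^sub>m ?p - c \<cdot>\<^sub>m M1)) (W * ?Y)"
      by (rule dg_mult) (use M1 M1' W Y in auto)
    ultimately show ?thesis unfolding K_def W(2) by simp
  qed
  moreover have "S' * (X' * A) * S = 1\<^sub>m n - c \<cdot>\<^sub>m D"
  proof -
    have "S' * (1\<^sub>m n - c \<cdot>\<^sub>m M) * S = (S' - c \<cdot>\<^sub>m (S' * M)) * S"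
      using S(1,2) M by (simp add: mult_minus_distrib_mat[of _ n n _ n] mult_smult_distrib[of _ n n _ n])
    also have "\<dots> = S' * S - c \<cdot>\<^sub>m (S' * M * S)"
      using S(1,2) M by (simp add: minus_mult_distrib_mat[of _ n n _ _ n] mult_smult_assoc_mat[of _ n n _ n])
    finally show ?thesis unfolding X'A S'MS S(3) .
  qed
  ultimately have "P * A * Q = T * ?dg F' (1\<^sub>m ?q) * T'" using sandwich[OF AB(2)] by simp
  also have "\<dots> = ?dg ?J (1\<^sub>m ?q)"
    unfolding T_def T'_def using 1 2 F' by (simp add: dg_mult)
  finally have PAQ: "P * A * Q = ?dg ?J (1\<^sub>m ?q)" .
  have "P * B * Q = T * (K * D) * T'" using sandwich[OF AB(3)] S'MS by (simp add: M_def)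
  also have "\<dots> = ?dg (S1' * (- 1\<^sub>m ?p) * S1) (S2' * (W * M0) * S2)"
    unfolding KD T_def T'_def using 1(1,2) 2(1,2) W(1) M0 by (simp add: dg_mult)
  also have "S1' * (- 1\<^sub>m ?p) * S1 = - 1\<^sub>m ?p" using 1(1-3) by simp
  also have "S2' * (W * M0) * S2 = - ?JN"
  proof -
    have "W * M0 = - N'" unfolding N'_def using W M0 by simp
    then show ?thesis unfolding 2(6) using 2(1,2) N' by simp
  qed
  finally have PBQ: "P * B * Q = ?dg (- 1\<^sub>m ?p) (- ?JN)" .
  have "det P \<noteq> 0"
  proof -
    have "det T \<noteq> 0" unfolding T_def using 1 2 det_nonzero_if_inverse[OF 1(2,1,3)] det_nonzero_if_inverse[OF 2(2,1,3)]
      by (simp add: dg_det)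
    moreover have "det K \<noteq> 0"
    proof -
      have "(- M1') * (- M1) = 1\<^sub>m ?p" using M1 M1' by simp
      then have "det (- M1') \<noteq> 0" by (rule det_nonzero_if_inverse(1)[rotated 2]) (use M1 M1' in auto)
      then show ?thesis unfolding K_def using M1' W det_nonzero_if_inverse[OF W(1) Y W(2)] by (simp add: dg_det)
    qed
    ultimately show ?thesis unfolding P_def
      using K T S X' det_nonzero_if_inverse[OF S(2,1,3)] det_nonzero_if_inverse[OF X'(1) X(1) X'(2)]
      by (simp add: det_mult[of _ n])
  qed
  moreover have "det Q \<noteq> 0"
  proof -
    have "det T' \<noteq> 0" unfolding T'_def using 1 2 det_nonzero_if_inverse[OF 1(2,1,3)] det_nonzero_if_inverse[OF 2(2,1,3)]
      by (simp add: dg_det)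
    then show ?thesis unfolding Q_def using T' S det_nonzero_if_inverse[OF S(2,1,3)] by (simp add: det_mult[of _ n])
  qed
  ultimately have inv: "invertible_mat P" "invertible_mat Q"
    using invertible_mat_if_det_nonzero PQ by blast+
  have "P * A * Q = diag_block_mat [?J, 1\<^sub>m (sum_list ks)]"
    unfolding PAQ diag_block_mat_pair by (simp add: dims)
  moreover have "P * B * Q = - diag_block_mat [1\<^sub>m (sum_list (map fst bs)), ?JN]"
    unfolding PBQ dims diag_block_mat_pair using 2(5) by (intro eq_matI) auto
  moreover have "0 \<notin> fst ` set bs" "0 \<notin> set ks" using bs ks unfolding jordan_nf_def by (auto simp: image_image)
  ultimately show ?thesis unfolding weierstrass_form_def using AB PQ inv by blast
qed

section \<open>Partial multiplicities and root spaces\<close>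

text \<open>
The partial multiplicities are defined through an arbitrary choice of a Weierstrass form. These
four facts determine them; the choice itself is not looked at again.
\<close>

lemma finite_partial_mults_props:
  assumes L: "L \<in> pencils n" and reg: "pencil_det L \<noteq> 0"
  shows sorted_partial_mults: "sorted_wrt (\<ge>) (finite_partial_mults L z)"
    and partial_mults_pos: "0 \<notin> set (finite_partial_mults L z)"
    and sum_partial_mults: "sum_list (finite_partial_mults L z) = order z (pencil_det L)"
    and basis_root_space: "k > 0 \<Longrightarrow> \<exists>b. basis_of n (root_space (pencil_mat L) z k)
      (length (filter (\<lambda>j. k \<le> j) (finite_partial_mults L z))) b"
proof -
  define bs where "bs = (SOME bs. \<exists>ks. weierstrass_form L bs ks)"
  let ?fs = "map fst (filter (\<lambda>(j, a). a = z) bs)"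
  have ns: "finite_partial_mults L z = rev (sort ?fs)"
    by (simp add: finite_partial_mults_def bs_def Let_def)
  have "\<exists>ks. weierstrass_form L bs ks" unfolding bs_def
    by (rule someI_ex) (rule weierstrass_form_exists[OF L reg])
  then obtain ks where W: "weierstrass_form L bs ks" by blast
  have m: "mset (finite_partial_mults L z) = mset ?fs" by (simp add: ns)
  show "sorted_wrt (\<ge>) (finite_partial_mults L z)" by (simp add: ns sorted_wrt_rev)
  have "0 \<notin> fst ` set bs" using W by (auto simp: weierstrass_form_def)
  then show "0 \<notin> set (finite_partial_mults L z)" unfolding ns by force
  show "sum_list (finite_partial_mults L z) = order z (pencil_det L)"
    unfolding weierstrass_form_root_data(2)[OF L W] using m by (metis sum_mset_sum_list)
  assume "k > 0"
  have "length (filter (\<lambda>j. k \<le> j) (finite_partial_mults L z)) = length (filter (\<lambda>j. k \<le> j) ?fs)"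
    using m by (metis mset_filter size_mset)
  also have "\<dots> = length (filter (\<lambda>(j, a). a = z \<and> k \<le> j) bs)"
    by (simp add: filter_map o_def case_prod_unfold conj_commute)
  finally show "\<exists>b. basis_of n (root_space (pencil_mat L) z k)
      (length (filter (\<lambda>j. k \<le> j) (finite_partial_mults L z))) b"
    using weierstrass_form_root_data(3)[OF L W \<open>k > 0\<close>] by simp
qed

lemma sum_list_le_if_dominates:
  fixes xs ys :: "nat list"
  assumes "length ys \<le> length xs" "\<And>i. i < length ys \<Longrightarrow> ys ! i \<le> xs ! i" "0 \<notin> set xs"
  shows "sum_list ys \<le> sum_list xs \<and> (sum_list xs \<le> sum_list ys \<longrightarrow> xs = ys)"
  using assms
proof (induction xs arbitrary: ys)
  case (Cons x xs)
  show ?case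
  proof (cases ys)
    case Nil
    then show ?thesis using Cons.prems(3) by simp
  next
    case (Cons y ys')
    have "sum_list ys' \<le> sum_list xs \<and> (sum_list xs \<le> sum_list ys' \<longrightarrow> xs = ys')"
    proof (rule Cons.IH)
      show "ys' ! i \<le> xs ! i" if "i < length ys'" for i
        using Cons.prems(2)[of "Suc i"] that Cons by simp
    qed (use Cons.prems Cons in auto)
    moreover have "y \<le> x" using Cons.prems(2)[of 0] Cons by simp
    ultimately show ?thesis using Cons by auto
  qed
qed simp

lemma length_filter_ge_iff_nth:
  assumes "sorted_wrt (\<ge>) (xs :: nat list)"
  shows "i < length (filter (\<lambda>j. k \<le> j) xs) \<longleftrightarrow> i < length xs \<and> k \<le> xs ! i"
  using assms
proof (induction xs arbitrary: i)
  case (Cons x xs)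
  have le: "y \<le> x" if "y \<in> set xs" for y using Cons.prems that by simp
  show ?case
  proof (cases "k \<le> x")
    case True
    then show ?thesis using Cons by (cases i) auto
  next
    case False
    have e: "filter (\<lambda>j. k \<le> j) (x # xs) = []" using le False by (auto simp: filter_empty_conv not_le intro: le_less_trans)
    have "\<not> k \<le> (x # xs) ! i" if "i < length (x # xs)"
      using that False le nth_mem[of i "x # xs"] by (metis order_trans set_ConsD)
    then show ?thesis unfolding e by auto
  qed
qed simp

text \<open>
The hypothesis on the counts means that the \<open>i\<close>-th entry of \<open>xs\<close> is at least the \<open>(i + r)\<close>-th entry of
\<open>ys\<close>. Therefore a comparison of the sums in the other direction leaves no room for a difference.
\<close>

lemma drop_eq_if_interlacing:
  assumes xs: "sorted_wrt (\<ge>) (xs :: nat list)" "0 \<notin> set xs" and ys: "sorted_wrt (\<ge>) ys" "0 \<notin> set ys"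
    and le: "\<And>k. k > 0 \<Longrightarrow> length (filter (\<lambda>j. k \<le> j) ys) \<le> length (filter (\<lambda>j. k \<le> j) xs) + r"
  shows "sum_list (drop r ys) \<le> sum_list xs"
    and "sum_list xs \<le> sum_list (drop r ys) \<Longrightarrow> xs = drop r ys"
proof -
  have *: "i < length xs \<and> drop r ys ! i \<le> xs ! i" if i: "i < length (drop r ys)" for i
  proof -
    let ?k = "ys ! (r + i)"
    have il: "r + i < length ys" using i by simp
    then have "?k > 0" using ys(2) by (metis gr0I nth_mem)
    have "r + i < length (filter (\<lambda>j. ?k \<le> j) ys)" using length_filter_ge_iff_nth[OF ys(1)] il by simp
    then have "i < length (filter (\<lambda>j. ?k \<le> j) xs)" using le[OF \<open>?k > 0\<close>] by simp
    then show ?thesis unfolding length_filter_ge_iff_nth[OF xs(1)] using i by simp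
  qed
  have len: "length (drop r ys) \<le> length xs" using * by (meson not_less order_refl)
  have "sum_list (drop r ys) \<le> sum_list xs \<and> (sum_list xs \<le> sum_list (drop r ys) \<longrightarrow> xs = drop r ys)"
    by (rule sum_list_le_if_dominates[OF len _ xs(2)]) (use * in blast)
  then show "sum_list (drop r ys) \<le> sum_list xs"
    and "sum_list xs \<le> sum_list (drop r ys) \<Longrightarrow> xs = drop r ys" by blast+
qed

section \<open>Interlacing under perturbations of low rank\<close>

text \<open>
Up to a space of dimension \<open>r\<close>, the set \<open>V\<close> is contained in \<open>V'\<close>. In contrast to a comparison of
dimensions this can be chained through root spaces of singular pencils, for which no basis is at
hand.
\<close>

definition codim_le :: "nat \<Rightarrow> nat \<Rightarrow> complex vec set \<Rightarrow> complex vec set \<Rightarrow> bool" where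
  "codim_le n r V V' \<longleftrightarrow> (\<exists>y :: nat \<Rightarrow> nat \<Rightarrow> complex. \<forall>v \<in> V. \<exists>c.
     vec n (\<lambda>p. v $ p - (\<Sum>l<r. c l * y l p)) \<in> V')"

lemma sum_lessThan_add: "(\<Sum>l<a + b. f l) = (\<Sum>l<a. f l) + (\<Sum>l<b. f (a + l))"
  for f :: "nat \<Rightarrow> 'a :: comm_monoid_add"
  by (induction b) (auto simp: add.assoc)

lemma codim_le_refl: "V \<subseteq> carrier_vec n \<Longrightarrow> codim_le n 0 V V"
  unfolding codim_le_def
proof (intro exI ballI)
  fix v assume "V \<subseteq> carrier_vec n" "v \<in> V"
  then have "vec n (\<lambda>p. v $ p - (\<Sum>l<0. (\<lambda>_. 0) l * (\<lambda>_ _. 0) l p)) = v" by (intro eq_vecI) auto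
  then show "vec n (\<lambda>p. v $ p - (\<Sum>l<0. (\<lambda>_. 0) l * (\<lambda>_ _. 0) l p)) \<in> V" using \<open>v \<in> V\<close> by simp
qed

lemma codim_le_trans:
  assumes "codim_le n a V V'" "codim_le n b V' V''"
  shows "codim_le n (a + b) V V''"
proof -
  obtain y where y: "\<And>v. v \<in> V \<Longrightarrow> \<exists>c. vec n (\<lambda>p. v $ p - (\<Sum>l<a. c l * y l p)) \<in> V'"
    using assms(1) unfolding codim_le_def by blast
  obtain y' where y': "\<And>v. v \<in> V' \<Longrightarrow> \<exists>c. vec n (\<lambda>p. v $ p - (\<Sum>l<b. c l * y' l p)) \<in> V''"
    using assms(2) unfolding codim_le_def by blast
  let ?y = "\<lambda>l. if l < a then y l else y' (l - a)"
  show ?thesis unfolding codim_le_def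
  proof (intro exI[of _ ?y] ballI)
    fix v assume "v \<in> V"
    then obtain c where c: "vec n (\<lambda>p. v $ p - (\<Sum>l<a. c l * y l p)) \<in> V'" using y by blast
    then obtain c' where c': "vec n (\<lambda>p. vec n (\<lambda>p. v $ p - (\<Sum>l<a. c l * y l p)) $ p - (\<Sum>l<b. c' l * y' l p)) \<in> V''"
      using y' by blast
    let ?c = "\<lambda>l. if l < a then c l else c' (l - a)"
    have "vec n (\<lambda>p. vec n (\<lambda>p. v $ p - (\<Sum>l<a. c l * y l p)) $ p - (\<Sum>l<b. c' l * y' l p))
      = vec n (\<lambda>p. v $ p - (\<Sum>l<a + b. ?c l * ?y l p))"
      by (intro eq_vecI) (auto simp: sum_lessThan_add diff_diff_eq)
    then show "\<exists>c. vec n (\<lambda>p. v $ p - (\<Sum>l<a + b. c l * ?y l p)) \<in> V''" using c' by (intro exI[of _ ?c]) simp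
  qed
qed

text \<open>
The \<open>g\<close> basis vectors of \<open>V\<close> lie in the span of the \<open>g'\<close> basis vectors of \<open>V'\<close> and the \<open>r\<close> vectors \<open>y\<close>.
If \<open>g > g' + r\<close>, the square matrix of the coefficients, filled up with zero rows, is singular, and
a kernel vector is a linear relation between the basis vectors of \<open>V\<close>.
\<close>

lemma basis_of_codim_le:
  assumes b: "basis_of n V g b" and b': "basis_of n V' g' b'" and cod: "codim_le n r V V'"
  shows "g \<le> g' + r"
proof (rule ccontr)
  assume "\<not> g \<le> g' + r"
  then have less: "g' + r < g" by simp
  obtain y where y: "\<And>v. v \<in> V \<Longrightarrow> \<exists>c. vec n (\<lambda>p. v $ p - (\<Sum>l<r. c l * y l p)) \<in> V'"
    using cod unfolding codim_le_def by blast
  have "\<exists>d c. \<forall>p<n. b m p = (\<Sum>l<g'. d l * b' l p) + (\<Sum>l<r. c l * y l p)" if m: "m < g" for m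
  proof -
    have V: "V = {vec n (\<lambda>p. \<Sum>l<g. c l * b l p) | c. True}"
      using b unfolding basis_of_def by (rule conjunct2)
    have "vec n (\<lambda>p. \<Sum>l<g. c l * b l p) \<in> V" for c
      unfolding V by (intro CollectI exI[of _ c] conjI refl TrueI)
    from this[of "\<lambda>l. if l = m then 1 else 0"]
    have "vec n (\<lambda>p. \<Sum>l<g. (if l = m then 1 else 0) * b l p) \<in> V" .
    also have "(\<lambda>p. \<Sum>l<g. (if l = m then 1 else 0) * b l p) = b m"
      using m by (simp add: if_distrib[of "\<lambda>x. x * _"] cong: if_cong)
    finally obtain c where "vec n (\<lambda>p. vec n (b m) $ p - (\<Sum>l<r. c l * y l p)) \<in> V'" using y by blast
    then obtain d where d: "vec n (\<lambda>p. vec n (b m) $ p - (\<Sum>l<r. c l * y l p)) = vec n (\<lambda>p. \<Sum>l<g'. d l * b' l p)"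
      using b' unfolding basis_of_def by blast
    have "b m p = (\<Sum>l<g'. d l * b' l p) + (\<Sum>l<r. c l * y l p)" if "p < n" for p
      using arg_cong[OF d, of "\<lambda>v. v $ p"] that by (simp add: algebra_simps)
    then show ?thesis by blast
  qed
  then obtain d c where dc: "\<And>m p. m < g \<Longrightarrow> p < n \<Longrightarrow>
      b m p = (\<Sum>l<g'. d m l * b' l p) + (\<Sum>l<r. c m l * y l p)" by metis
  define A where "A = mat g g (\<lambda>(i, m). if i < g' then d m i else if i < g' + r then c m (i - g') else 0)"
  have A: "A \<in> carrier_mat g g" by (simp add: A_def)
  \<comment> \<open>the last row of \<open>A\<close> vanishes because \<open>g' + r < g\<close>\<close>
  have "transpose_mat A *\<^sub>v unit_vec g (g - 1) = 0\<^sub>v g"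
    using less by (intro eq_vecI) (auto simp: A_def)
  moreover have "unit_vec g (g - 1) \<noteq> (0\<^sub>v g :: complex vec)" using less by simp
  ultimately have "det (transpose_mat A) = 0"
    using det_0_iff_vec_prod_zero[of "transpose_mat A" g] A unit_vec_carrier[of g "g - 1"] by (metis transpose_carrier_mat)
  then obtain x where x: "x \<in> carrier_vec g" "x \<noteq> 0\<^sub>v g" "A *\<^sub>v x = 0\<^sub>v g"
    using det_0_iff_vec_prod_zero[OF A] det_transpose[OF A] by auto
  have Ax: "(\<Sum>m<g. A $$ (i, m) * x $ m) = 0" if "i < g" for i
    using arg_cong[OF x(3), of "\<lambda>v. v $ i"] that x(1) A by (simp add: scalar_prod_def atLeast0LessThan)
  have d0: "(\<Sum>m<g. x $ m * d m l) = 0" if "l < g'" for l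
    using Ax[of l] that less by (simp add: A_def mult.commute)
  have c0: "(\<Sum>m<g. x $ m * c m l) = 0" if "l < r" for l
    using Ax[of "g' + l"] that less by (simp add: A_def mult.commute)
  have "(\<Sum>m<g. x $ m * b m p) = 0" if p: "p < n" for p
  proof -
    have "(\<Sum>m<g. x $ m * b m p) = (\<Sum>m<g. x $ m * ((\<Sum>l<g'. d m l * b' l p) + (\<Sum>l<r. c m l * y l p)))"
      using dc p by (intro sum.cong) auto
    also have "\<dots> = (\<Sum>m<g. \<Sum>l<g'. x $ m * d m l * b' l p) + (\<Sum>m<g. \<Sum>l<r. x $ m * c m l * y l p)"
      by (simp add: distrib_left sum.distrib sum_distrib_left mult.assoc)
    also have "(\<Sum>m<g. \<Sum>l<g'. x $ m * d m l * b' l p) = (\<Sum>l<g'. (\<Sum>m<g. x $ m * d m l) * b' l p)"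
      by (subst sum.swap) (simp add: sum_distrib_right)
    also have "(\<Sum>m<g. \<Sum>l<r. x $ m * c m l * y l p) = (\<Sum>l<r. (\<Sum>m<g. x $ m * c m l) * y l p)"
      by (subst sum.swap) (simp add: sum_distrib_right)
    finally show ?thesis using d0 c0 by simp
  qed
  then have "\<forall>l<g. x $ l = 0" using b unfolding basis_of_def by blast
  then have "x = 0\<^sub>v g" using x(1) by (intro eq_vecI) auto
  then show False using x(2) by simp
qed

text \<open>
A chain \<open>f\<close> of \<open>M\<close> is a chain of \<open>M'\<close> if the polynomial \<open>\<phi> f = w \<bullet> f\<close> is divisible by \<open>t\<^sup>k\<close>. Unless
this holds for all chains, choose a chain \<open>f0\<close> for which the order of \<open>\<phi> f0\<close> at \<open>z\<close> is minimal:
\<open>\<phi> f0 = t\<^sup>e \<eta>\<close> with \<open>\<eta>(z) \<noteq> 0\<close>. Every other chain has \<open>\<phi> f = t\<^sup>e \<xi>\<close>, so \<open>\<eta> f - \<xi> f0\<close> is a chain of \<open>M'\<close>. Its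
value at \<open>z\<close> is, up to the nonzero factor \<open>\<eta>(z)\<close>, that of \<open>f\<close> minus a multiple of that of \<open>f0\<close>.
\<close>

lemma codim_le_root_space_rank_one:
  assumes M: "M \<in> carrier_mat n n" "M' \<in> carrier_mat n n"
    and M': "\<And>i j. i < n \<Longrightarrow> j < n \<Longrightarrow> M' $$ (i, j) = M $$ (i, j) + u i * w j"
  shows "codim_le n 1 (root_space M z k) (root_space M' z k)"
proof -
  let ?t = "[:-z, 1:]"
  define S where "S = {f \<in> carrier_vec n. \<forall>i<n. ?t ^ k dvd (M *\<^sub>v f) $ i}"
  define \<phi> where "\<phi> f = (\<Sum>j<n. w j * f $ j)" for f
  have mult: "(N *\<^sub>v f) $ i = (\<Sum>j<n. N $$ (i, j) * f $ j)"
    if "N \<in> carrier_mat n n" "f \<in> carrier_vec n" "i < n" for N and f :: "complex poly vec" and i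
    using that by (simp add: scalar_prod_def atLeast0LessThan)
  have M'f: "(M' *\<^sub>v f) $ i = (M *\<^sub>v f) $ i + u i * \<phi> f" if "f \<in> carrier_vec n" "i < n" for f i
    unfolding mult[OF M(2) that] mult[OF M(1) that] \<phi>_def
    using that by (simp add: M' distrib_right sum.distrib sum_distrib_left mult.assoc)
  show ?thesis
  proof (cases "\<forall>f\<in>S. ?t ^ k dvd \<phi> f")
    case True
    show ?thesis unfolding codim_le_def
    proof (intro exI[of _ "\<lambda>_ _. 0"] ballI exI[of _ "\<lambda>_. 0"])
      fix v assume "v \<in> root_space M z k"
      then obtain f where f: "f \<in> carrier_vec n" "v = eval_vec z f" "\<And>i. i < n \<Longrightarrow> ?t ^ k dvd (M *\<^sub>v f) $ i"
        using root_spaceE[OF M(1)] by blast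
      then have "f \<in> S" by (simp add: S_def)
      have "v \<in> root_space M' z k" unfolding f(2)
        by (rule root_spaceI[OF M(2) f(1)]) (use f M'f \<open>f \<in> S\<close> True in \<open>simp add: dvd_add dvd_mult\<close>)
      moreover have "vec n (\<lambda>p. v $ p - (\<Sum>l<(1 :: nat). 0 * 0)) = v" using f by (intro eq_vecI) auto
      ultimately show "vec n (\<lambda>p. v $ p - (\<Sum>l<(1 :: nat). 0 * 0)) \<in> root_space M' z k" by simp
    qed
  next
    case False
    let ?P = "\<lambda>e. \<exists>f\<in>S. \<not> ?t ^ Suc e dvd \<phi> f"
    define e where "e = (LEAST e. ?P e)"
    obtain g where g: "g \<in> S" "\<not> ?t ^ k dvd \<phi> g" using False by blast
    then obtain k' where "k = Suc k'" by (cases k) auto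
    then have "?P k'" using g by auto
    then have "?P e" unfolding e_def by (rule LeastI)
    then obtain f0 where f0: "f0 \<in> S" "\<not> ?t ^ Suc e dvd \<phi> f0" by blast
    have dvd: "?t ^ e dvd \<phi> f" if "f \<in> S" for f
    proof (cases e)
      case (Suc e')
      then have "\<not> ?P e'" using not_less_Least[of e' ?P] by (simp add: e_def)
      then show ?thesis using Suc that by auto
    qed simp
    obtain \<eta> where \<eta>: "\<phi> f0 = ?t ^ e * \<eta>" using dvd[OF f0(1)] by (rule dvdE)
    have \<eta>z: "poly \<eta> z \<noteq> 0"
    proof
      assume "poly \<eta> z = 0"
      then have "?t dvd \<eta>" by (simp add: poly_eq_0_iff_dvd)
      then have "?t ^ e * ?t dvd \<phi> f0" unfolding \<eta> by (rule mult_dvd_mono[OF dvd_refl])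
      then show False using f0(2) unfolding power_Suc2 by contradiction
    qed
    show ?thesis unfolding codim_le_def
    proof (intro exI[of _ "\<lambda>_ p. poly (f0 $ p) z"] ballI)
      fix v assume "v \<in> root_space M z k"
      then obtain f where f: "f \<in> carrier_vec n" "v = eval_vec z f" "\<And>i. i < n \<Longrightarrow> ?t ^ k dvd (M *\<^sub>v f) $ i"
        using root_spaceE[OF M(1)] by blast
      then have "f \<in> S" by (simp add: S_def)
      obtain \<xi> where \<xi>: "\<phi> f = ?t ^ e * \<xi>" using dvd[OF \<open>f \<in> S\<close>] by (rule dvdE)
      let ?a = "[:1 / poly \<eta> z:]"
      define h where "h = vec n (\<lambda>i. ?a * (\<eta> * f $ i - \<xi> * f0 $ i))"
      have h: "h \<in> carrier_vec n" by (simp add: h_def)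
      have f0c: "f0 \<in> carrier_vec n" "\<And>i. i < n \<Longrightarrow> ?t ^ k dvd (M *\<^sub>v f0) $ i" using f0(1) by (auto simp: S_def)
      have lin: "(\<Sum>j<n. q j * h $ j) = ?a * (\<eta> * (\<Sum>j<n. q j * f $ j) - \<xi> * (\<Sum>j<n. q j * f0 $ j))"
        for q :: "nat \<Rightarrow> complex poly"
      proof -
        have "q j * h $ j = ?a * (\<eta> * (q j * f $ j) - \<xi> * (q j * f0 $ j))" if "j < n" for j
        proof -
          have "h $ j = ?a * (\<eta> * f $ j - \<xi> * f0 $ j)" using that by (simp add: h_def)
          then show ?thesis by (simp only: right_diff_distrib mult.left_commute)
        qed
        then have "(\<Sum>j<n. q j * h $ j) = (\<Sum>j<n. ?a * (\<eta> * (q j * f $ j) - \<xi> * (q j * f0 $ j)))"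
          by (intro sum.cong) auto
        then show ?thesis by (simp only: sum_distrib_left[symmetric] sum_subtractf)
      qed
      have "\<phi> h = 0" unfolding \<phi>_def lin unfolding \<phi>_def[symmetric] \<eta> \<xi> by (simp only: ac_simps diff_self mult_zero_right mult_zero_left)
      moreover have "(M *\<^sub>v h) $ i = ?a * (\<eta> * (M *\<^sub>v f) $ i - \<xi> * (M *\<^sub>v f0) $ i)" if "i < n" for i
        unfolding mult[OF M(1) h that] mult[OF M(1) f(1) that] mult[OF M(1) f0c(1) that] by (rule lin)
      ultimately have "?t ^ k dvd (M' *\<^sub>v h) $ i" if "i < n" for i
        using M'f[OF h that] f(3)[OF that] f0c(2)[OF that] that
        by (simp only: mult_zero_right add_0_right) (intro dvd_mult dvd_diff)
      then have "eval_vec z h \<in> root_space M' z k" using root_spaceI[OF M(2) h] by blast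
      also have "eval_vec z h = vec n (\<lambda>p. v $ p - (\<Sum>l<(1 :: nat). (\<lambda>_. poly \<xi> z / poly \<eta> z) l * poly (f0 $ p) z))"
        using \<eta>z f f0c by (intro eq_vecI) (auto simp: h_def field_simps)
      finally show "\<exists>c. vec n (\<lambda>p. v $ p - (\<Sum>l<(1 :: nat). c l * poly (f0 $ p) z)) \<in> root_space M' z k"
        by (intro exI[of _ "\<lambda>_. poly \<xi> z / poly \<eta> z"])
    qed
  qed
qed

lemma codim_le_root_space:
  assumes M: "M \<in> carrier_mat n n" "M' \<in> carrier_mat n n"
    and "\<And>i j. i < n \<Longrightarrow> j < n \<Longrightarrow> M' $$ (i, j) = M $$ (i, j) + (\<Sum>l<r. u l i * w l j)"
  shows "codim_le n r (root_space M z k) (root_space M' z k)"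
  using M(2) assms(3)
proof (induction r arbitrary: M')
  case 0
  then have "M' = M" using M(1) by (intro eq_matI) auto
  moreover have "root_space M z k \<subseteq> carrier_vec n" using M unfolding root_space_def by auto
  ultimately show ?case by (simp add: codim_le_refl)
next
  case (Suc r)
  define M1 where "M1 = mat n n (\<lambda>(i, j). M $$ (i, j) + (\<Sum>l<r. u l i * w l j))"
  have M1: "M1 \<in> carrier_mat n n" by (simp add: M1_def)
  have "codim_le n r (root_space M z k) (root_space M1 z k)" by (rule Suc.IH) (auto simp: M1_def)
  moreover have "codim_le n 1 (root_space M1 z k) (root_space M' z k)"
    by (rule codim_le_root_space_rank_one[OF M1 Suc.prems(1), of "u r" "w r"])
      (simp add: Suc.prems(2) M1_def)
  ultimately have "codim_le n (r + 1) (root_space M z k) (root_space M' z k)" by (rule codim_le_trans)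
  then show ?case by simp
qed

definition rank_le :: "nat \<Rightarrow> nat \<Rightarrow> pencil \<Rightarrow> bool" where
  "rank_le n r E \<longleftrightarrow> (\<exists>u w. \<forall>i<n. \<forall>j<n. pencil_mat E $$ (i, j) = (\<Sum>l<r. u l i * w l j))"

lemma pencils_add: "L \<in> pencils n \<Longrightarrow> E \<in> pencils n \<Longrightarrow> L + E \<in> pencils n"
  by (auto simp: plus_prod_def)

lemma pencil_mat_add:
  assumes "L \<in> pencils n" "E \<in> pencils n"
  shows "pencil_mat (L + E) = pencil_mat L + pencil_mat E"
  using assms by (intro eq_matI) (auto simp: pencil_mat_def)

text \<open>
A perturbation of rank \<open>r\<close> lowers the number of partial multiplicities \<open>\<ge> k\<close> by at most \<open>r\<close>, for every
\<open>k\<close>. Hence the order of the determinant at \<open>z\<close> is at least the sum of all but the \<open>r\<close> largest partial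
multiplicities of \<open>L\<close>, and if it is not larger than that, then all partial multiplicities of the
perturbed pencil are known. This reduces the statement on the old eigenvalues to one number for
each of them.
\<close>

lemma partial_mults_interlacing:
  assumes L: "L \<in> pencils n" "pencil_det L \<noteq> 0" and E: "E \<in> pencils n" "rank_le n r E"
    and reg: "pencil_det (L + E) \<noteq> 0"
  shows "sum_list (drop r (finite_partial_mults L z)) \<le> order z (pencil_det (L + E))"
    and "order z (pencil_det (L + E)) \<le> sum_list (drop r (finite_partial_mults L z)) \<Longrightarrow>
      finite_partial_mults (L + E) z = drop r (finite_partial_mults L z)"
proof -
  note LE = pencils_add[OF L(1) E(1)]
  obtain u w where uw: "\<And>i j. i < n \<Longrightarrow> j < n \<Longrightarrow> pencil_mat E $$ (i, j) = (\<Sum>l<r. u l i * w l j)"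
    using E(2) unfolding rank_le_def by blast
  have le: "length (filter (\<lambda>j. k \<le> j) (finite_partial_mults L z)) \<le>
     length (filter (\<lambda>j. k \<le> j) (finite_partial_mults (L + E) z)) + r" if k: "k > 0" for k
  proof -
    have "codim_le n r (root_space (pencil_mat L) z k) (root_space (pencil_mat (L + E)) z k)"
    proof (rule codim_le_root_space)
      fix i j assume "i < n" "j < n"
      then show "pencil_mat (L + E) $$ (i, j) = pencil_mat L $$ (i, j) + (\<Sum>l<r. u l i * w l j)"
        using pencil_mat_carrier[OF L(1)] pencil_mat_carrier[OF E(1)] uw
        by (simp add: pencil_mat_add[OF L(1) E(1)])
    qed (use L LE pencil_mat_carrier in auto)
    then show ?thesis
      using basis_root_space[OF L k] basis_root_space[OF LE reg k] basis_of_codim_le by metis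
  qed
  note * = drop_eq_if_interlacing[OF sorted_partial_mults[OF LE reg] partial_mults_pos[OF LE reg]
    sorted_partial_mults[OF L] partial_mults_pos[OF L] le, unfolded sum_partial_mults[OF LE reg]]
  show "sum_list (drop r (finite_partial_mults L z)) \<le> order z (pencil_det (L + E))" by (rule *(1))
  show "order z (pencil_det (L + E)) \<le> sum_list (drop r (finite_partial_mults L z)) \<Longrightarrow>
      finite_partial_mults (L + E) z = drop r (finite_partial_mults L z)" by (rule *(2))
qed

section \<open>Rank-one updates of the determinant\<close>

text \<open>
The bordered matrix with the rows \<open>(1, -w\<^sup>T)\<close> and \<open>(u, M)\<close> has determinant \<open>det M'\<close>, as one sees by clearing
its first column from the left. Clearing \<open>u\<close> from the right by means of the adjugate instead gives
the other side, multiplied by \<open>det M\<close>.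
\<close>

lemma det_rank_one_update:
  fixes M :: "'a :: idom mat"
  assumes M: "M \<in> carrier_mat n n" "M' \<in> carrier_mat n n"
    and M': "\<And>i j. i < n \<Longrightarrow> j < n \<Longrightarrow> M' $$ (i, j) = M $$ (i, j) + u i * w j"
    and d: "det M \<noteq> 0"
  shows "det M' = det M + (\<Sum>i<n. \<Sum>j<n. w i * adj_mat M $$ (i, j) * u j)"
proof -
  define U where "U = mat n 1 (\<lambda>(i, j). u i)"
  define W where "W = mat 1 n (\<lambda>(i, j). w j)"
  have U: "U \<in> carrier_mat n 1" and W: "W \<in> carrier_mat 1 n" by (auto simp: U_def W_def)
  note adj = adj_mat[OF M(1)]
  define K where "K = adj_mat M * U"
  have K: "K \<in> carrier_mat n 1" using adj U by (simp add: K_def)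
  let ?N = "four_block_mat (1\<^sub>m 1) (- W) U M"
  let ?T = "four_block_mat (1\<^sub>m 1) (0\<^sub>m 1 n) (- U) (1\<^sub>m n)"
  let ?R = "four_block_mat (det M \<cdot>\<^sub>m 1\<^sub>m 1) (0\<^sub>m 1 n) (- K) (1\<^sub>m n)"
  have c1: "(1\<^sub>m 1 :: 'a mat) \<in> carrier_mat 1 1" "(0\<^sub>m 1 n :: 'a mat) \<in> carrier_mat 1 n"
    "(1\<^sub>m n :: 'a mat) \<in> carrier_mat n n" "det M \<cdot>\<^sub>m 1\<^sub>m 1 \<in> carrier_mat 1 1"
    "- U \<in> carrier_mat n 1" "- W \<in> carrier_mat 1 n" "- K \<in> carrier_mat n 1" using U W K by auto
  have N: "?N \<in> carrier_mat (1 + n) (1 + n)" and T: "?T \<in> carrier_mat (1 + n) (1 + n)"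
    and R: "?R \<in> carrier_mat (1 + n) (1 + n)" using c1 M by (intro four_block_carrier_mat; simp)+
  have TN: "?T * ?N = four_block_mat (1\<^sub>m 1) (- W) (0\<^sub>m n 1) M'"
  proof (rule trans[OF mult_four_block_mat[OF c1(1,2,5,3) c1(1,6) U M(1)]], rule cong_four_block_mat)
    show "- U * - W + 1\<^sub>m n * M = M'"
      using M U W by (intro eq_matI) (auto simp: M' U_def W_def scalar_prod_def)
    show "1\<^sub>m 1 * - W + 0\<^sub>m 1 n * M = - W" using M W by (intro eq_matI) auto
    show "- U * 1\<^sub>m 1 + 1\<^sub>m n * U = 0\<^sub>m n 1" using U by (intro eq_matI) auto
    show "1\<^sub>m 1 * 1\<^sub>m 1 + 0\<^sub>m 1 n * U = 1\<^sub>m 1" using U by (intro eq_matI) auto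
  qed
  have "det ?T = 1" using det_four_block_mat_upper_right_zero[OF c1(1) refl c1(5) c1(3)] by simp
  moreover have "det (?T * ?N) = det M'"
    unfolding TN using det_four_block_mat_lower_left_zero[OF c1(1) c1(6) refl M(2)] by simp
  ultimately have detN: "det ?N = det M'" using det_mult[OF T N] by simp
  define q where "q = (\<Sum>i<n. \<Sum>j<n. w i * adj_mat M $$ (i, j) * u j)"
  have MK: "M * K = det M \<cdot>\<^sub>m U"
  proof -
    have "M * K = (M * adj_mat M) * U" unfolding K_def by (rule assoc_mult_mat[OF M(1) adj(1) U, symmetric])
    then show ?thesis unfolding adj(2) using U by (simp add: mult_smult_assoc_mat[of _ n n _ 1])
  qed
  have NR: "?N * ?R = four_block_mat (mat 1 1 (\<lambda>_. det M + q)) (- W) (0\<^sub>m n 1) M"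
  proof (rule trans[OF mult_four_block_mat[OF c1(1,6) U M(1) c1(4,2,7,3)]], rule cong_four_block_mat)
    show "1\<^sub>m 1 * (det M \<cdot>\<^sub>m 1\<^sub>m 1) + - W * - K = mat 1 1 (\<lambda>_. det M + q)"
    proof (rule eq_matI)
      fix i j assume "i < dim_row (mat 1 1 (\<lambda>_. det M + q))" "j < dim_col (mat 1 1 (\<lambda>_. det M + q))"
      then have ij: "i = 0" "j = 0" by auto
      have "- W * - K = W * K" using W K by simp
      moreover have "(W * K) $$ (0, 0) = (\<Sum>l<n. w l * K $$ (l, 0))"
        using W K by (simp add: W_def scalar_prod_def atLeast0LessThan)
      moreover have "K $$ (l, 0) = (\<Sum>j<n. adj_mat M $$ (l, j) * u j)" if "l < n" for l
        using that adj(1) U by (simp add: K_def U_def scalar_prod_def atLeast0LessThan)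
      ultimately have "(- W * - K) $$ (0, 0) = q" by (simp add: q_def sum_distrib_left mult.assoc)
      then show "(1\<^sub>m 1 * (det M \<cdot>\<^sub>m 1\<^sub>m 1) + - W * - K) $$ (i, j) = mat 1 1 (\<lambda>_. det M + q) $$ (i, j)"
        using W K by (simp add: ij)
    qed (use W K in auto)
    show "1\<^sub>m 1 * 0\<^sub>m 1 n + - W * 1\<^sub>m n = - W" using W by (intro eq_matI) auto
    show "U * 0\<^sub>m 1 n + M * 1\<^sub>m n = M" using U M by (intro eq_matI) auto
    have "M * - K = - (det M \<cdot>\<^sub>m U)" using M K MK by simp
    moreover have "U * (det M \<cdot>\<^sub>m 1\<^sub>m 1) = det M \<cdot>\<^sub>m U"
      using U by (simp add: mult_smult_distrib[of _ n 1 _ 1])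
    ultimately show "U * (det M \<cdot>\<^sub>m 1\<^sub>m 1) + M * - K = 0\<^sub>m n 1" using U by (intro eq_matI) auto
  qed
  have detR: "det ?R = det M" using det_four_block_mat_upper_right_zero[OF c1(4) refl c1(7) c1(3)] by simp
  have detNR: "det (?N * ?R) = (det M + q) * det M"
    unfolding NR using det_four_block_mat_lower_left_zero[OF _ c1(6) refl M(1), of "mat 1 1 (\<lambda>_. det M + q)"]
    by (simp add: det_single)
  have "det M' * det M = det ?N * det ?R" by (simp only: detN detR)
  also have "\<dots> = (det M + q) * det M" unfolding detNR[symmetric] by (rule det_mult[OF N R, symmetric])
  finally show ?thesis using d by (simp add: q_def)
qed

lemma adj_mat_symmetric:
  fixes M :: "'a :: idom mat"
  assumes M: "M \<in> carrier_mat n n" "transpose_mat M = M" and d: "det M \<noteq> 0" and ij: "i < n" "j < n"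
  shows "adj_mat M $$ (i, j) = adj_mat M $$ (j, i)"
proof -
  note adj = adj_mat[OF M(1)]
  let ?A = "adj_mat M" let ?B = "transpose_mat ?A"
  have B: "?B \<in> carrier_mat n n" using adj by simp
  have "transpose_mat (?A * M) = M * ?B" using transpose_mult[OF adj(1) M(1)] M(2) by simp
  moreover have "transpose_mat (det M \<cdot>\<^sub>m 1\<^sub>m n) = det M \<cdot>\<^sub>m 1\<^sub>m n" by (intro eq_matI) auto
  ultimately have MB: "M * ?B = det M \<cdot>\<^sub>m 1\<^sub>m n" unfolding adj(3) by simp
  have "(?A * M) * ?B = ?A * (M * ?B)" by (rule assoc_mult_mat[OF adj(1) M(1) B])
  then have "det M \<cdot>\<^sub>m ?B = det M \<cdot>\<^sub>m ?A" unfolding MB adj(3)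
    using adj(1) B by (simp add: mult_smult_assoc_mat[of _ n n _ n] mult_smult_distrib[of _ n n _ n])
  then have "(det M \<cdot>\<^sub>m ?B) $$ (i, j) = (det M \<cdot>\<^sub>m ?A) $$ (i, j)" by simp
  then show ?thesis using ij adj(1) d by simp
qed

definition outer :: "nat \<Rightarrow> (nat \<Rightarrow> complex) \<Rightarrow> complex mat" where
  "outer n p = mat n n (\<lambda>(i, j). p i * p j)"

definition rank_one_pencil :: "nat \<Rightarrow> complex \<Rightarrow> complex \<Rightarrow> (nat \<Rightarrow> complex) \<Rightarrow> pencil" where
  "rank_one_pencil n a b p = (a \<cdot>\<^sub>m outer n p, b \<cdot>\<^sub>m outer n p)"

text \<open>
The quadratic form \<open>(a + x b) p\<^sup>T adj(L) p\<close> with polynomial values: the amount by which adding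
\<open>(a + x b) p p\<^sup>T\<close> to \<open>L\<close> changes the determinant.
\<close>

definition adj_form :: "nat \<Rightarrow> pencil \<Rightarrow> complex \<Rightarrow> complex \<Rightarrow> (nat \<Rightarrow> complex) \<Rightarrow> complex poly" where
  "adj_form n L a b p =
     (\<Sum>i<n. \<Sum>j<n. [:p i * p j:] * ([:a, b:] * adj_mat (pencil_mat L) $$ (i, j)))"

lemma outer_carrier: "outer n p \<in> carrier_mat n n"
  by (simp add: outer_def)

lemma rank_one_pencil_carrier: "rank_one_pencil n a b p \<in> pencils n"
  by (simp add: rank_one_pencil_def outer_carrier)

lemma pencil_mat_rank_one:
  "i < n \<Longrightarrow> j < n \<Longrightarrow> pencil_mat (rank_one_pencil n a b p) $$ (i, j) = ([:a, b:] * [:p i:]) * [:p j:]"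
  by (simp add: pencil_mat_def rank_one_pencil_def outer_def mult.assoc)

lemma rank_le_rank_one: "rank_le n 1 (rank_one_pencil n a b p)"
  unfolding rank_le_def
  by (rule exI[of _ "\<lambda>_ i. [:a, b:] * [:p i:]"], rule exI[of _ "\<lambda>_ j. [:p j:]"])
    (simp add: pencil_mat_rank_one del: mult_pCons_left mult_pCons_right)

lemma rev_pencil_rank_one: "rev_pencil (rank_one_pencil n a b p) = rank_one_pencil n b a p"
  by (simp add: rev_pencil_def rank_one_pencil_def)

lemma rev_pencil_add: "rev_pencil (L + E) = rev_pencil L + rev_pencil E"
  by (cases L; cases E) (simp add: rev_pencil_def plus_prod_def)

lemma pencil_det_rank_one:
  assumes L: "L \<in> pencils n" and D: "pencil_det L \<noteq> 0"
  shows "pencil_det (L + rank_one_pencil n a b p) = pencil_det L + adj_form n L a b p"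
proof -
  let ?E = "rank_one_pencil n a b p"
  have E: "?E \<in> pencils n" by (rule rank_one_pencil_carrier)
  have "det (pencil_mat (L + ?E)) = det (pencil_mat L) +
    (\<Sum>i<n. \<Sum>j<n. [:p i:] * adj_mat (pencil_mat L) $$ (i, j) * ([:a, b:] * [:p j:]))"
  proof (rule det_rank_one_update)
    fix i j assume "i < n" "j < n"
    then show "pencil_mat (L + ?E) $$ (i, j) = pencil_mat L $$ (i, j) + ([:a, b:] * [:p i:]) * [:p j:]"
      using pencil_mat_carrier[OF L] pencil_mat_carrier[OF E]
      by (simp add: pencil_mat_add[OF L E] pencil_mat_rank_one del: mult_pCons_left mult_pCons_right)
  qed (use L E D pencil_mat_carrier pencils_add in \<open>auto simp: pencil_det_pencil_mat\<close>)
  also have "(\<Sum>i<n. \<Sum>j<n. [:p i:] * adj_mat (pencil_mat L) $$ (i, j) * ([:a, b:] * [:p j:])) = adj_form n L a b p"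
    unfolding adj_form_def
  proof (intro sum.cong refl)
    fix i j
    have "[:p i * p j:] = [:p i:] * [:p j:]" by simp
    then show "[:p i:] * adj_mat (pencil_mat L) $$ (i, j) * ([:a, b:] * [:p j:])
      = [:p i * p j:] * ([:a, b:] * adj_mat (pencil_mat L) $$ (i, j))"
      by (simp only: ac_simps)
  qed
  finally show ?thesis by (simp add: pencil_det_pencil_mat)
qed

lemma adj_form_scale: "adj_form n L a b (\<lambda>i. \<sigma> * p i) = [:\<sigma>\<^sup>2:] * adj_form n L a b p"
proof -
  have "[:(\<sigma> * x) * (\<sigma> * y):] = [:\<sigma>\<^sup>2:] * [:x * y:]" for x y by (simp add: power2_eq_square)
  then show ?thesis unfolding adj_form_def by (simp only: sum_distrib_left mult.assoc)
qed

section \<open>Coefficients at a point\<close>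

text \<open>
For a multiple \<open>f\<close> of \<open>(x - z)\<^sup>N\<close> this is the coefficient of \<open>(x - z)\<^sup>N\<close> in the expansion of \<open>f\<close> at \<open>z\<close>.
It vanishes if and only if \<open>f\<close> is divisible by a higher power of \<open>x - z\<close>. Being linear in \<open>f\<close>, it turns the
polynomial-valued form \<open>adj_form\<close> into a complex quadratic form.
\<close>

definition coeff_at :: "complex \<Rightarrow> nat \<Rightarrow> complex poly \<Rightarrow> complex" where
  "coeff_at z N f = poly (f div [:-z, 1:] ^ N) z"

lemma coeff_at_add: "coeff_at z N (f + g) = coeff_at z N f + coeff_at z N g"
  by (simp add: coeff_at_def poly_div_add_left)

lemma coeff_at_scale: "coeff_at z N ([:c:] * f) = c * coeff_at z N f"
  by (simp add: coeff_at_def div_smult_left)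

lemma coeff_at_zero: "coeff_at z N 0 = 0"
  by (simp add: coeff_at_def)

lemma coeff_at_sum: "coeff_at z N (\<Sum>i\<in>A. f i) = (\<Sum>i\<in>A. coeff_at z N (f i))"
  by (induction A rule: infinite_finite_induct) (auto simp: coeff_at_add coeff_at_zero)

lemma coeff_at_mult_power: "coeff_at z N ([:-z, 1:] ^ N * q) = poly q z"
proof -
  have "[:-z, 1:] ^ N \<noteq> 0" by simp
  then show ?thesis by (simp add: coeff_at_def)
qed

lemma coeff_at_nonzero_order:
  assumes "coeff_at z N f \<noteq> 0"
  shows "order z f \<le> N"
proof (rule ccontr)
  assume "\<not> order z f \<le> N"
  then have "[:-z, 1:] ^ Suc N dvd f"
    using order_1[of z f] by (meson dvd_trans le_imp_power_dvd not_less_eq_eq)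
  then obtain q where "f = [:-z, 1:] ^ N * ([:-z, 1:] * q)" by (metis dvdE mult.assoc power_Suc2)
  then have "coeff_at z N f = 0" using coeff_at_mult_power[of z N "[:-z, 1:] * q"] by simp
  then show False using assms by simp
qed

lemma coeff_at_zero_dvd:
  assumes "[:-z, 1:] ^ N dvd f" "coeff_at z N f = 0"
  shows "[:-z, 1:] ^ Suc N dvd f"
proof -
  obtain q where q: "f = [:-z, 1:] ^ N * q" using assms(1) by (rule dvdE)
  have "poly q z = 0" using assms(2) unfolding q coeff_at_mult_power .
  then have "[:-z, 1:] dvd q" by (simp add: poly_eq_0_iff_dvd)
  then show ?thesis unfolding q power_Suc2 by (rule mult_dvd_mono[OF dvd_refl])
qed

lemma linear_power_dvd_cancel:
  fixes c q :: "complex poly"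
  assumes "poly c z \<noteq> 0" "[:-z, 1:] ^ k dvd c * q"
  shows "[:-z, 1:] ^ k dvd q"
proof (cases "q = 0")
  case False
  then have nz: "c * q \<noteq> 0" using assms(1) by auto
  then have "k \<le> order z (c * q)" using assms(2) order_divides by blast
  also have "\<dots> = order z q" using nz assms(1) by (simp add: order_mult order_0I)
  finally show ?thesis using order_divides by blast
qed simp

lemma prod_linear_power_dvd:
  fixes f :: "complex poly"
  assumes "finite Z" "\<And>z. z \<in> Z \<Longrightarrow> [:-z, 1:] ^ N z dvd f"
  shows "(\<Prod>z\<in>Z. [:-z, 1:] ^ N z) dvd f"
  using assms
proof (induction Z rule: finite_induct)
  case (insert y Z)
  have "(\<Prod>z\<in>Z. [:-z, 1:] ^ N z) dvd f" by (rule insert.IH) (rule insert.prems, simp)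
  then obtain q where q: "f = (\<Prod>z\<in>Z. [:-z, 1:] ^ N z) * q" by (rule dvdE)
  have "poly (\<Prod>z\<in>Z. [:-z, 1:] ^ N z) y \<noteq> 0"
    using insert(1,2) by (auto simp: poly_prod)
  moreover have "[:-y, 1:] ^ N y dvd (\<Prod>z\<in>Z. [:-z, 1:] ^ N z) * q"
    unfolding q[symmetric] by (rule insert.prems) simp
  ultimately have "[:-y, 1:] ^ N y dvd q" by (rule linear_power_dvd_cancel)
  then have "(\<Prod>z\<in>Z. [:-z, 1:] ^ N z) * [:-y, 1:] ^ N y dvd f"
    unfolding q by (rule mult_dvd_mono[OF dvd_refl])
  then show ?case unfolding prod.insert[OF insert(1,2)] by (simp only: mult.commute)
qed simp

text \<open>
Interlacing applied to \<open>L\<close> and to its rank-one perturbation; \<open>adj_form\<close> is the difference of the two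
determinants.
\<close>

lemma linear_power_dvd_rank_one:
  fixes z :: complex
  assumes L: "L \<in> pencils n" and D: "pencil_det L \<noteq> 0"
  defines "N \<equiv> sum_list (drop 1 (finite_partial_mults L z))"
  shows "[:-z, 1:] ^ N dvd pencil_det L" and "[:-z, 1:] ^ N dvd adj_form n L a b p"
proof -
  let ?E = "rank_one_pencil n a b p"
  have "N \<le> order z (pencil_det L)"
    unfolding N_def sum_partial_mults[OF L D, symmetric] by (cases "finite_partial_mults L z") auto
  then show 1: "[:-z, 1:] ^ N dvd pencil_det L" using order_divides by blast
  have 2: "[:-z, 1:] ^ N dvd pencil_det (L + ?E)"
  proof (cases "pencil_det (L + ?E) = 0")
    case False
    have "N \<le> order z (pencil_det (L + ?E))" unfolding N_def
      by (rule partial_mults_interlacing(1)[OF L D rank_one_pencil_carrier rank_le_rank_one False])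
    then show ?thesis using order_divides by blast
  qed simp
  have "adj_form n L a b p = pencil_det (L + ?E) - pencil_det L"
    by (simp add: pencil_det_rank_one[OF L D])
  then show "[:-z, 1:] ^ N dvd adj_form n L a b p" using dvd_diff[OF 2 1] by simp
qed

lemma symmetric_pencils_subset: "L \<in> symmetric_pencils n \<Longrightarrow> L \<in> pencils n"
  by (auto simp: symmetric_pencils_def)

lemma transpose_pencil_mat:
  assumes "L \<in> symmetric_pencils n"
  shows "transpose_mat (pencil_mat L) = pencil_mat L"
proof -
  obtain A B where AB: "L = (A, B)" "A \<in> carrier_mat n n" "B \<in> carrier_mat n n"
    "transpose_mat A = A" "transpose_mat B = B" using assms by (auto simp: symmetric_pencils_def)
  have "A $$ (i, j) = A $$ (j, i)" "B $$ (i, j) = B $$ (j, i)" if "i < n" "j < n" for i j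
    using that AB by (metis carrier_matD index_transpose_mat(1))+
  then show ?thesis using AB by (intro eq_matI) (auto simp: pencil_mat_def)
qed

text \<open>
The lower bound \<open>N\<close> from interlacing is attained by some rank-one perturbation. Let \<open>t = x - z\<close> and
let \<open>k\<close> be the largest partial multiplicity, so that \<open>det L\<close> has order \<open>k + N\<close> at \<open>z\<close>. If all the
coefficients in question vanished, then, by polarisation, the entries of the symmetric matrix
\<open>adj L\<close> would be divisible by \<open>t ^ (N + 1)\<close>. Take a chain \<open>f\<close> of length \<open>k\<close> with \<open>f(z) \<noteq> 0\<close>. Then
\<open>det L f = adj L (L f)\<close> is divisible by \<open>t ^ (k + N + 1)\<close>, which contradicts the order of \<open>det L\<close>.
\<close>

lemma rank_one_coeff_at_nonzero:
  fixes z :: complex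
  assumes sym: "L \<in> symmetric_pencils n" and D: "pencil_det L \<noteq> 0" and ab: "a + z * b \<noteq> 0"
  defines "N \<equiv> sum_list (drop 1 (finite_partial_mults L z))"
  shows "coeff_at z N (pencil_det L) \<noteq> 0 \<or> (\<exists>p. coeff_at z N (adj_form n L a b p) \<noteq> 0)"
proof (rule ccontr)
  assume neg: "\<not> ?thesis"
  let ?t = "[:-z, 1:]" and ?D = "pencil_det L" and ?M = "pencil_mat L"
  note L = symmetric_pencils_subset[OF sym]
  have M: "?M \<in> carrier_mat n n" by (rule pencil_mat_carrier[OF L])
  have detM: "det ?M \<noteq> 0" using D by (simp add: pencil_det_pencil_mat)
  note adj = adj_mat[OF M]
  let ?A = "adj_mat ?M"
  note dvdN = linear_power_dvd_rank_one[OF L D, of z, folded N_def]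
  have D1: "?t ^ Suc N dvd ?D" using coeff_at_zero_dvd[OF dvdN(1)] neg by blast
  have q1: "?t ^ Suc N dvd adj_form n L a b p" for p using coeff_at_zero_dvd[OF dvdN(2)] neg by blast
  define q where "q p = (\<Sum>i<n. \<Sum>j<n. [:p i * p j:] * ?A $$ (i, j))" for p :: "nat \<Rightarrow> complex"
  have form: "adj_form n L a b p = [:a, b:] * q p" for p
    unfolding adj_form_def q_def sum_distrib_left by (simp only: mult.left_commute)
  have q: "?t ^ Suc N dvd q p" for p
    by (rule linear_power_dvd_cancel[OF _ q1[of p, unfolded form]]) (use ab in simp)
  have diag: "?t ^ Suc N dvd ?A $$ (i, i)" if "i < n" for i
  proof -
    have "q (\<lambda>l. if l = i then 1 else 0) = (\<Sum>k<n. \<Sum>l<n. if l = i then if k = i then ?A $$ (k, l) else 0 else 0)"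
      unfolding q_def by (intro sum.cong refl) auto
    also have "\<dots> = ?A $$ (i, i)" using that by simp
    finally show ?thesis using q by metis
  qed
  define pick where "pick l0 k0 k l = (if l = l0 then if k = k0 then ?A $$ (k, l) else 0 else 0)" for k0 l0 k l
  have pick: "(\<Sum>k<n. \<Sum>l<n. pick l0 k0 k l) = ?A $$ (k0, l0)" if "k0 < n" "l0 < n" for k0 l0
    using that by (simp add: pick_def)
  have all: "?t ^ Suc N dvd ?A $$ (i, j)" if ij: "i < n" "j < n" for i j
  proof (cases "i = j")
    case False
    have "q (\<lambda>l. if l = i \<or> l = j then 1 else 0) = (\<Sum>k<n. \<Sum>l<n. if l = i \<or> l = j then if k = i \<or> k = j then ?A $$ (k, l) else 0 else 0)"
      unfolding q_def by (intro sum.cong refl) auto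
    also have "\<dots> = (\<Sum>k<n. \<Sum>l<n. pick i i k l + pick i j k l + pick j i k l + pick j j k l)"
      unfolding pick_def using False by (intro sum.cong refl) simp
    also have "\<dots> = ?A $$ (i, i) + ?A $$ (j, i) + ?A $$ (i, j) + ?A $$ (j, j)"
      using ij by (simp only: sum.distrib pick)
    also have "?A $$ (j, i) = ?A $$ (i, j)" by (rule adj_mat_symmetric[OF M transpose_pencil_mat[OF sym] detM ij(2,1)])
    finally have e: "q (\<lambda>l. if l = i \<or> l = j then 1 else 0) - ?A $$ (i, i) - ?A $$ (j, j) = [:2:] * ?A $$ (i, j)"
      by (simp add: numeral_poly[symmetric] del: mult_pCons_left)
    have "?t ^ Suc N dvd q (\<lambda>l. if l = i \<or> l = j then 1 else 0) - ?A $$ (i, i) - ?A $$ (j, j)"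
      by (intro dvd_diff q diag ij)
    then have "?t ^ Suc N dvd [:2:] * ?A $$ (i, j)" unfolding e .
    then show ?thesis by (rule linear_power_dvd_cancel[rotated]) simp
  qed (use diag ij in simp)
  show False
  proof (cases "finite_partial_mults L z")
    case Nil
    then have "order z ?D = 0" using sum_partial_mults[OF L D, of z] by simp
    moreover have "Suc N \<le> order z ?D" using D1 D order_divides by blast
    ultimately show False by simp
  next
    case (Cons k ns)
    have ord: "order z ?D = k + N" using sum_partial_mults[OF L D, of z] by (simp add: N_def Cons)
    have k: "k > 0" using partial_mults_pos[OF L D, of z] Cons by auto
    obtain b where b: "basis_of n (root_space ?M z k) (length (filter (\<lambda>j. k \<le> j) (k # ns))) b"
      using basis_root_space[OF L D k, of z] unfolding Cons by blast
    define g where "g = length (filter (\<lambda>j. k \<le> j) (k # ns))"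
    have g: "0 < g" by (simp add: g_def)
    let ?\<delta> = "\<lambda>l. if l = 0 then 1 else (0 :: complex)"
    let ?v = "vec n (\<lambda>p. \<Sum>l<g. ?\<delta> l * b l p)"
    have V: "root_space ?M z k = {vec n (\<lambda>p. \<Sum>l<g. c l * b l p) | c. True}"
      using b unfolding basis_of_def g_def by (rule conjunct2)
    have "?v \<in> root_space ?M z k"
      unfolding V by (intro CollectI exI[of _ ?\<delta>] conjI refl TrueI)
    then obtain f where f: "f \<in> carrier_vec n" "?v = eval_vec z f" "\<And>i. i < n \<Longrightarrow> ?t ^ k dvd (?M *\<^sub>v f) $ i"
      using root_spaceE[OF M] by blast
    obtain \<eta> where \<eta>: "?D = ?t ^ (k + N) * \<eta>" using order_1[of z ?D] unfolding ord by (rule dvdE)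
    have \<eta>z: "poly \<eta> z \<noteq> 0"
    proof
      assume "poly \<eta> z = 0"
      then have "?t dvd \<eta>" by (simp add: poly_eq_0_iff_dvd)
      then have "?t ^ Suc (k + N) dvd ?D" unfolding \<eta> power_Suc2 by (rule mult_dvd_mono[OF dvd_refl])
      then show False using order_2[OF D, of z] unfolding ord by contradiction
    qed
    have fz: "poly (f $ i) z = 0" if i: "i < n" for i
    proof -
      have Mf: "?M *\<^sub>v f \<in> carrier_vec n" using M f by simp
      have "?A *\<^sub>v (?M *\<^sub>v f) = (?D \<cdot>\<^sub>m 1\<^sub>m n) *\<^sub>v f"
        unfolding pencil_det_pencil_mat adj(3)[symmetric] by (rule assoc_mult_mat_vec[OF adj(1) M f(1), symmetric])
      also have "\<dots> = ?D \<cdot>\<^sub>v f" using f(1) by (intro eq_vecI) auto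
      finally have "(?A *\<^sub>v (?M *\<^sub>v f)) $ i = ?D * f $ i" using i f by simp
      moreover have "(?A *\<^sub>v (?M *\<^sub>v f)) $ i = (\<Sum>j<n. ?A $$ (i, j) * (?M *\<^sub>v f) $ j)"
        using i adj(1) Mf M by (simp add: scalar_prod_def atLeast0LessThan)
      moreover have "?t ^ Suc N * ?t ^ k dvd (\<Sum>j<n. ?A $$ (i, j) * (?M *\<^sub>v f) $ j)"
        by (intro dvd_sum mult_dvd_mono all f(3) i) auto
      ultimately have "?t ^ Suc N * ?t ^ k dvd ?D * f $ i" by simp
      also have "?t ^ Suc N * ?t ^ k = ?t ^ (k + N) * ?t" by (simp only: power_add power_Suc ac_simps)
      also have "?D * f $ i = ?t ^ (k + N) * (\<eta> * f $ i)" unfolding \<eta> by (simp only: mult.assoc)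
      finally have "?t dvd \<eta> * f $ i" by (subst (asm) dvd_times_left_cancel_iff) auto
      then have "poly (\<eta> * f $ i) z = 0" by (simp only: poly_eq_0_iff_dvd)
      then show ?thesis using \<eta>z by simp
    qed
    have "(\<Sum>l<g. ?\<delta> l * b l p) = 0" if p: "p < n" for p
    proof -
      have "?v $ p = eval_vec z f $ p" using f(2) by simp
      then show ?thesis using p f(1) fz by simp
    qed
    moreover have "\<forall>c. (\<forall>p<n. (\<Sum>l<g. c l * b l p) = 0) \<longrightarrow> (\<forall>l<g. c l = 0)"
      using b unfolding basis_of_def g_def by (rule conjunct1)
    then have "(\<forall>p<n. (\<Sum>l<g. ?\<delta> l * b l p) = 0) \<longrightarrow> (\<forall>l<g. ?\<delta> l = 0)" by (rule spec)
    ultimately have "\<forall>l<g. ?\<delta> l = 0" by blast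
    then show False using g by auto
  qed
qed

section \<open>A good perturbation of rank one\<close>

text \<open>
On the line through a vector \<open>p\<close> that is good for the forms treated so far and a vector \<open>q\<close> that is
good for the next one, each of these forms is a nonzero polynomial in the parameter \<open>\<tau>\<close> of the line.
Almost every point of the line is then good for all of them.
\<close>

lemma quadratic_forms_common_nonzero:
  fixes C :: "'s \<Rightarrow> nat \<Rightarrow> nat \<Rightarrow> complex" and n :: nat
  assumes "finite S"
  defines "Q \<equiv> \<lambda>s p. \<Sum>i<n. \<Sum>j<n. p i * p j * C s i j"
  shows "\<exists>p. \<forall>s\<in>S. (\<exists>q. Q s q \<noteq> 0) \<longrightarrow> Q s p \<noteq> 0"
  using assms(1)
proof (induction S rule: finite_induct)
  case (insert s S)
  then obtain p where p: "\<forall>s\<in>S. (\<exists>q. Q s q \<noteq> 0) \<longrightarrow> Q s p \<noteq> 0" by blast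
  show ?case
  proof (cases "\<exists>q. Q s q \<noteq> 0")
    case False
    then show ?thesis using p by blast
  next
    case True
    then obtain q where q: "Q s q \<noteq> 0" by blast
    define d where "d = (\<lambda>i. q i - p i)"
    define line where "line \<tau> = (\<lambda>i. p i + \<tau> * d i)" for \<tau>
    define \<pi> where "\<pi> t = [:Q t p, \<Sum>i<n. \<Sum>j<n. (p i * d j + d i * p j) * C t i j, Q t d:]" for t
    have \<pi>: "Q t (line \<tau>) = poly (\<pi> t) \<tau>" for t \<tau>
    proof -
      have "(p i + \<tau> * d i) * (p j + \<tau> * d j) * C t i j =
        p i * p j * C t i j + \<tau> * ((p i * d j + d i * p j) * C t i j + \<tau> * (d i * d j * C t i j))" for i j
        by (simp add: algebra_simps)
      then show ?thesis unfolding Q_def \<pi>_def line_def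
        by (simp add: sum.distrib sum_distrib_left distrib_left)
    qed
    let ?T = "{t \<in> insert s S. \<exists>q. Q t q \<noteq> 0}"
    have "\<pi> t \<noteq> 0" if "t \<in> ?T" for t
    proof
      assume 0: "\<pi> t = 0"
      have "line 0 = p" "line 1 = q" by (auto simp: line_def d_def)
      then have "Q t p = 0" "Q t q = 0" using \<pi>[of t 0] \<pi>[of t 1] 0 by simp_all
      then show False using that p q by blast
    qed
    then have "finite (\<Union>t\<in>?T. {\<tau>. poly (\<pi> t) \<tau> = 0})"
      using insert(1) by (intro finite_UN_I poly_roots_finite) auto
    then obtain \<tau> where "\<tau> \<notin> (\<Union>t\<in>?T. {\<tau>. poly (\<pi> t) \<tau> = 0})"
      using ex_new_if_finite[OF infinite_UNIV_char_0] by blast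
    then have "\<forall>t\<in>insert s S. (\<exists>q. Q t q \<noteq> 0) \<longrightarrow> Q t (line \<tau>) \<noteq> 0" unfolding \<pi> by blast
    then show ?thesis by blast
  qed
qed simp

lemma coeff_at_adj_form:
  "coeff_at z N (adj_form n L a b p) =
    (\<Sum>i<n. \<Sum>j<n. p i * p j * coeff_at z N ([:a, b:] * adj_mat (pencil_mat L) $$ (i, j)))"
  unfolding adj_form_def by (simp only: coeff_at_sum coeff_at_scale)

lemma finite_linear_zeros:
  fixes \<alpha> \<beta> :: complex
  assumes "\<alpha> \<noteq> 0 \<or> \<beta> \<noteq> 0"
  shows "finite {\<epsilon>. \<alpha> + \<epsilon> * \<beta> = 0}"
proof -
  have "[:\<alpha>, \<beta>:] \<noteq> 0" using assms by simp
  then have "finite {\<epsilon>. poly [:\<alpha>, \<beta>:] \<epsilon> = 0}" by (rule poly_roots_finite)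
  then show ?thesis by simp
qed

lemma order_le_1:
  fixes p :: "complex poly"
  assumes "poly p w \<noteq> 0 \<or> poly (pderiv p) w \<noteq> 0"
  shows "order w p \<le> 1"
proof (cases "poly p w = 0")
  case True
  then have "poly (pderiv p) w \<noteq> 0" using assms by simp
  then have "p \<noteq> 0" by auto
  then show ?thesis
    using order_pderiv[OF _ True] order_0I[OF \<open>poly (pderiv p) w \<noteq> 0\<close>] by simp
qed (simp add: order_0I)

lemma symmetric_pencils_rev: "L \<in> symmetric_pencils n \<Longrightarrow> rev_pencil L \<in> symmetric_pencils n"
  by (auto simp: symmetric_pencils_def rev_pencil_def)

text \<open>
For \<open>\<phi> \<noteq> 0\<close> differentiation lowers the order of the zero \<open>c\<close> of \<open>\<phi>\<close> by one, so at \<open>c\<close> the left-hand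
side of the first assumption has a smaller order than the right-hand side.
\<close>

lemma wronskian_zero_imp:
  fixes m \<phi> :: "complex poly"
  assumes W: "m * pderiv \<phi> = pderiv m * \<phi>" and c: "poly \<phi> c = 0" "poly m c \<noteq> 0"
  shows "\<phi> = 0"
proof (rule ccontr)
  assume \<phi>: "\<phi> \<noteq> 0"
  have o: "order c \<phi> = Suc (order c (pderiv \<phi>))" by (rule order_pderiv[OF \<phi> c(1)])
  have "pderiv \<phi> \<noteq> 0"
  proof
    assume "pderiv \<phi> = 0"
    then obtain a where "\<phi> = [:a:]" using pderiv_iszero by blast
    then show False using c(1) \<phi> by simp
  qed
  then have nz: "m * pderiv \<phi> \<noteq> 0" using c(2) by auto
  have "order c (m * pderiv \<phi>) = order c (pderiv \<phi>)"
    using nz c(2) by (simp add: order_mult order_0I)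
  moreover have "order c (pderiv m * \<phi>) = order c (pderiv m) + order c \<phi>"
    using nz unfolding W by (rule order_mult)
  ultimately show False using W o by simp
qed

text \<open>
The perturbation is \<open>\<epsilon> (x - c) p p\<^sup>T\<close>. The factor \<open>x - c\<close> keeps the value at \<open>c\<close>, hence regularity; with a
constant in its place the number of partial multiplicities at infinity would not change. First \<open>p\<close> is chosen
such that \<open>adj_form\<close> has the least possible order at all points of \<open>Z\<close> and at infinity. After the
common factor \<open>G\<close> has been split off, the determinants for varying \<open>\<epsilon>\<close> form the family \<open>m + \<epsilon> \<phi>\<close>, where \<open>m\<close>
has no zeros outside \<open>Z\<close>. A multiple zero of \<open>m + \<epsilon> \<phi>\<close> is a zero of the Wronskian of \<open>m\<close> and
\<open>\<phi>\<close>. Unless \<open>\<phi> = 0\<close>, the Wronskian has finitely many zeros, and each of those outside \<open>Z\<close> is a zero of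
\<open>m + \<epsilon> \<phi>\<close> for at most one \<open>\<epsilon>\<close>. So all but finitely many \<open>\<epsilon>\<close> are good.

The set \<open>Z\<close> may contain points that are not eigenvalues of \<open>L\<close>. There the partial multiplicities
stay empty, which the iteration below relies on.
\<close>

lemma rank_one_step:
  assumes sym: "L \<in> symmetric_pencils n" and c: "poly (pencil_det L) c \<noteq> 0"
    and Z: "finite Z" "c \<notin> Z" "\<And>z. poly (pencil_det L) z = 0 \<Longrightarrow> z \<in> Z"
  obtains p where
    "poly (pencil_det (L + rank_one_pencil n (-c) 1 p)) c \<noteq> 0"
    "\<And>z. z \<in> Z \<Longrightarrow> finite_partial_mults (L + rank_one_pencil n (-c) 1 p) z = drop 1 (finite_partial_mults L z)"
    "finite_partial_mults (rev_pencil (L + rank_one_pencil n (-c) 1 p)) 0 = drop 1 (finite_partial_mults (rev_pencil L) 0)"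
    "\<And>w. w \<notin> Z \<Longrightarrow> order w (pencil_det (L + rank_one_pencil n (-c) 1 p)) \<le> 1"
proof -
  note L = symmetric_pencils_subset[OF sym]
  note sym' = symmetric_pencils_rev[OF sym]
  note L' = symmetric_pencils_subset[OF sym']
  let ?D = "pencil_det L" and ?D' = "pencil_det (rev_pencil L)"
  have D: "?D \<noteq> 0" using c by auto
  have D': "?D' \<noteq> 0" using pencil_det_rev_eq_0_iff[OF L] D by simp
  define \<psi> where "\<psi> = adj_form n L (-c) 1"
  define \<psi>' where "\<psi>' = adj_form n (rev_pencil L) 1 (-c)"
  define N where "N z = sum_list (drop 1 (finite_partial_mults L z))" for z
  define N' where "N' = sum_list (drop 1 (finite_partial_mults (rev_pencil L) 0))"
  define C where "C s i j = (case s of Some z \<Rightarrow> coeff_at z (N z) ([:-c, 1:] * adj_mat (pencil_mat L) $$ (i, j))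
     | None \<Rightarrow> coeff_at 0 N' ([:1, -c:] * adj_mat (pencil_mat (rev_pencil L)) $$ (i, j)))" for s i j
  define Q where "Q s p = (\<Sum>i<n. \<Sum>j<n. p i * p j * C s i j)" for s p
  have "finite (insert None (Some ` Z))" using Z(1) by simp
  then obtain p where p: "\<forall>s\<in>insert None (Some ` Z). (\<exists>q. Q s q \<noteq> 0) \<longrightarrow> Q s p \<noteq> 0"
    using quadratic_forms_common_nonzero[where n = n and C = C] unfolding Q_def by blast
  have Q: "Q (Some z) q = coeff_at z (N z) (\<psi> q)" "Q None q = coeff_at 0 N' (\<psi>' q)" for z q
    unfolding Q_def C_def \<psi>_def \<psi>'_def coeff_at_adj_form by simp_all
  have fin: "coeff_at z (N z) ?D \<noteq> 0 \<or> coeff_at z (N z) (\<psi> p) \<noteq> 0" if z: "z \<in> Z" for z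
  proof -
    have "- c + z * 1 \<noteq> 0" using z Z(2) by auto
    from rank_one_coeff_at_nonzero[OF sym D this]
    have "coeff_at z (N z) ?D \<noteq> 0 \<or> (\<exists>q. Q (Some z) q \<noteq> 0)" unfolding Q N_def \<psi>_def .
    then show ?thesis using p z unfolding Q[symmetric] by blast
  qed
  have inf: "coeff_at 0 N' ?D' \<noteq> 0 \<or> coeff_at 0 N' (\<psi>' p) \<noteq> 0"
  proof -
    have "coeff_at 0 N' ?D' \<noteq> 0 \<or> (\<exists>q. Q None q \<noteq> 0)" unfolding Q N'_def \<psi>'_def
      by (rule rank_one_coeff_at_nonzero[OF sym' D']) simp
    then show ?thesis using p unfolding Q[symmetric] by blast
  qed
  define G where "G = (\<Prod>z\<in>Z. [:-z, 1:] ^ N z)"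
  have "G dvd ?D" unfolding G_def N_def
    by (rule prod_linear_power_dvd[OF Z(1)]) (rule linear_power_dvd_rank_one(1)[OF L D])
  then obtain m where m: "?D = G * m" by (rule dvdE)
  have "G dvd \<psi> p" unfolding G_def N_def \<psi>_def
    by (rule prod_linear_power_dvd[OF Z(1)]) (rule linear_power_dvd_rank_one(2)[OF L D])
  then obtain \<phi> where \<phi>: "\<psi> p = G * \<phi>" by (rule dvdE)
  have G0: "poly G w \<noteq> 0" if "w \<notin> Z" for w
    unfolding G_def using that Z(1) by (auto simp: poly_prod)
  have m0: "poly m w \<noteq> 0" if "w \<notin> Z" for w
    using Z(3)[of w] that unfolding m by auto
  have \<psi>c: "poly (\<psi> p) c = 0" unfolding \<psi>_def adj_form_def by (simp add: poly_sum)
  then have \<phi>c: "poly \<phi> c = 0" unfolding \<phi> using G0[OF Z(2)] by simp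
  define W where "W = m * pderiv \<phi> - pderiv m * \<phi>"
  \<comment> \<open>In the last part zeros of \<open>W\<close> inside \<open>Z\<close> are left out: only outside \<open>Z\<close> is \<open>m w \<noteq> 0\<close> known.\<close>
  define bad where "bad = (\<Union>z\<in>Z. {\<epsilon>. coeff_at z (N z) ?D + \<epsilon> * coeff_at z (N z) (\<psi> p) = 0})
    \<union> {\<epsilon>. coeff_at 0 N' ?D' + \<epsilon> * coeff_at 0 N' (\<psi>' p) = 0}
    \<union> (\<Union>w\<in>(if W = 0 then {} else {w. poly W w = 0} - Z). {\<epsilon>. poly m w + \<epsilon> * poly \<phi> w = 0})"
  have "finite bad" unfolding bad_def
  proof (intro finite_UnI finite_UN_I finite_linear_zeros)
    show "finite (if W = 0 then {} else {w. poly W w = 0} - Z)" by (simp add: poly_roots_finite)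
  qed (use Z(1) fin inf m0 in \<open>auto split: if_splits\<close>)
  then obtain \<epsilon> where \<epsilon>: "\<epsilon> \<notin> bad" using ex_new_if_finite[OF infinite_UNIV_char_0] by blast
  \<comment> \<open>scaling \<open>p\<close> by a square root of \<open>\<epsilon>\<close> multiplies the quadratic form by \<open>\<epsilon>\<close>\<close>
  define p' where "p' = (\<lambda>i. csqrt \<epsilon> * p i)"
  let ?E = "rank_one_pencil n (-c) 1 p'"
  have detE: "pencil_det (L + ?E) = ?D + [:\<epsilon>:] * \<psi> p"
    unfolding pencil_det_rank_one[OF L D] \<psi>_def p'_def adj_form_scale by simp
  have detE': "pencil_det (rev_pencil (L + ?E)) = ?D' + [:\<epsilon>:] * \<psi>' p"
    unfolding rev_pencil_add rev_pencil_rank_one pencil_det_rank_one[OF L' D'] \<psi>'_def p'_def adj_form_scale by simp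
  have Fc: "poly (pencil_det (L + ?E)) c \<noteq> 0" unfolding detE using c \<psi>c by simp
  note LE = pencils_add[OF L rank_one_pencil_carrier[of n "-c" 1 p']]
  have reg: "pencil_det (L + ?E) \<noteq> 0" using Fc by auto
  have reg': "pencil_det (rev_pencil L + rank_one_pencil n 1 (-c) p') \<noteq> 0"
    using pencil_det_rev_eq_0_iff[OF LE] reg by (simp add: rev_pencil_add rev_pencil_rank_one)
  show ?thesis
  proof (rule that[of p'])
    show "poly (pencil_det (L + ?E)) c \<noteq> 0" by (rule Fc)
    show "finite_partial_mults (L + ?E) z = drop 1 (finite_partial_mults L z)" if z: "z \<in> Z" for z
    proof (rule partial_mults_interlacing(2)[OF L D rank_one_pencil_carrier rank_le_rank_one reg])
      have "coeff_at z (N z) (pencil_det (L + ?E)) \<noteq> 0"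
        unfolding detE coeff_at_add coeff_at_scale using \<epsilon> z unfolding bad_def by blast
      then show "order z (pencil_det (L + ?E)) \<le> sum_list (drop 1 (finite_partial_mults L z))"
        unfolding N_def by (rule coeff_at_nonzero_order)
    qed
    show "finite_partial_mults (rev_pencil (L + ?E)) 0 = drop 1 (finite_partial_mults (rev_pencil L) 0)"
      unfolding rev_pencil_add rev_pencil_rank_one
    proof (rule partial_mults_interlacing(2)[OF L' D' rank_one_pencil_carrier rank_le_rank_one reg'])
      have "coeff_at 0 N' (pencil_det (rev_pencil (L + ?E))) \<noteq> 0"
        unfolding detE' coeff_at_add coeff_at_scale using \<epsilon> unfolding bad_def by blast
      then show "order 0 (pencil_det (rev_pencil L + rank_one_pencil n 1 (-c) p'))
          \<le> sum_list (drop 1 (finite_partial_mults (rev_pencil L) 0))"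
        unfolding N'_def rev_pencil_add rev_pencil_rank_one by (rule coeff_at_nonzero_order)
    qed
    show "order w (pencil_det (L + ?E)) \<le> 1" if w: "w \<notin> Z" for w
    proof -
      let ?h = "m + [:\<epsilon>:] * \<phi>"
      have F: "pencil_det (L + ?E) = G * ?h" unfolding detE m \<phi> by (simp only: distrib_left mult.left_commute)
      have "order w (G * ?h) = order w ?h"
        using reg G0[OF w] unfolding F by (simp add: order_mult order_0I del: mult_pCons_left)
      also have "\<dots> \<le> 1"
      proof (rule order_le_1, rule ccontr)
        assume "\<not> (poly ?h w \<noteq> 0 \<or> poly (pderiv ?h) w \<noteq> 0)"
        then have h: "poly m w + \<epsilon> * poly \<phi> w = 0" "poly (pderiv m) w + \<epsilon> * poly (pderiv \<phi>) w = 0"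
          by (simp_all add: pderiv_add pderiv_smult)
        have "poly W w = 0"
        proof -
          have e: "poly m w = - (\<epsilon> * poly \<phi> w)" "poly (pderiv m) w = - (\<epsilon> * poly (pderiv \<phi>) w)"
            using h by (simp_all add: add_eq_0_iff2)
          show ?thesis unfolding W_def by (simp add: e)
        qed
        show False
        proof (cases "W = 0")
          case True
          then have "\<phi> = 0" using wronskian_zero_imp[OF _ \<phi>c m0[OF Z(2)]] by (simp add: W_def)
          then show False using h(1) m0[OF w] by simp
        next
          case False
          then have "poly m w + \<epsilon> * poly \<phi> w \<noteq> 0"
            using \<epsilon> w \<open>poly W w = 0\<close> unfolding bad_def by auto
          then show False using h(1) by simp
        qed
      qed
      finally show ?thesis unfolding F .
    qed
  qed
qed

section \<open>A good perturbation of rank \<open>r\<close>\<close>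

definition gram :: "nat \<Rightarrow> nat \<Rightarrow> (nat \<Rightarrow> nat \<Rightarrow> complex) \<Rightarrow> complex mat" where
  "gram n r ps = mat n n (\<lambda>(i, j). \<Sum>l<r. ps l i * ps l j)"

abbreviation gram_pencil :: "nat \<Rightarrow> nat \<Rightarrow> complex \<Rightarrow> (nat \<Rightarrow> nat \<Rightarrow> complex) \<Rightarrow> pencil" where
  "gram_pencil n r c ps \<equiv> (-c \<cdot>\<^sub>m gram n r ps, 1 \<cdot>\<^sub>m gram n r ps)"

lemma gram_carrier: "gram n r ps \<in> carrier_mat n n"
  by (simp add: gram_def)

lemma symmetric_pencils_add_gram:
  assumes "L \<in> symmetric_pencils n"
  shows "L + (a \<cdot>\<^sub>m gram n r ps, b \<cdot>\<^sub>m gram n r ps) \<in> symmetric_pencils n"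
proof -
  obtain A B where AB: "L = (A, B)" "A \<in> carrier_mat n n" "B \<in> carrier_mat n n"
    "transpose_mat A = A" "transpose_mat B = B" using assms by (auto simp: symmetric_pencils_def)
  have "transpose_mat (gram n r ps) = gram n r ps"
    by (intro eq_matI) (auto simp: gram_def mult.commute)
  moreover have "transpose_mat (d \<cdot>\<^sub>m M) = d \<cdot>\<^sub>m transpose_mat M" for d and M :: "complex mat"
    by (intro eq_matI) auto
  ultimately have "transpose_mat (M + d \<cdot>\<^sub>m gram n r ps) = M + d \<cdot>\<^sub>m gram n r ps"
    if "M \<in> carrier_mat n n" "transpose_mat M = M" for M d
    using that gram_carrier[of n r ps] by (simp add: transpose_add[of _ n n])
  then show ?thesis using AB gram_carrier[of n r ps] by (simp add: symmetric_pencils_def plus_prod_def)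
qed

text \<open>
Every step treats the eigenvalues of the original pencil together with those of the current one
as special points. An eigenvalue that a step creates is simple, so the next step removes it, and
an original eigenvalue that has been removed does not come back.
\<close>

lemma rank_r_perturbation_exists:
  assumes sym: "L \<in> symmetric_pencils n" and c: "poly (pencil_det L) c \<noteq> 0"
  defines "Z \<equiv> {z. poly (pencil_det L) z = 0}"
  shows "\<exists>ps. let L' = L + gram_pencil n r c ps in
    poly (pencil_det L') c \<noteq> 0 \<and>
    (\<forall>z\<in>Z. finite_partial_mults L' z = drop r (finite_partial_mults L z)) \<and>
    finite_partial_mults (rev_pencil L') 0 = drop r (finite_partial_mults (rev_pencil L) 0) \<and>
    (\<forall>w. w \<notin> Z \<longrightarrow> order w (pencil_det L') \<le> 1)"
proof (induction r)
  case 0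
  note L = symmetric_pencils_subset[OF sym]
  have "L + gram_pencil n 0 c ps = L" for ps
  proof -
    have "M + d \<cdot>\<^sub>m gram n 0 ps = M" if "M \<in> carrier_mat n n" for M d
      using that by (intro eq_matI) (auto simp: gram_def)
    then show ?thesis using L by (cases L) (auto simp: plus_prod_def)
  qed
  then show ?case using c by (simp add: Let_def Z_def order_0I)
next
  case (Suc r)
  then obtain ps where ps: "poly (pencil_det (L + gram_pencil n r c ps)) c \<noteq> 0"
    "\<And>z. z \<in> Z \<Longrightarrow> finite_partial_mults (L + gram_pencil n r c ps) z = drop r (finite_partial_mults L z)"
    "finite_partial_mults (rev_pencil (L + gram_pencil n r c ps)) 0 = drop r (finite_partial_mults (rev_pencil L) 0)"
    "\<And>w. w \<notin> Z \<Longrightarrow> order w (pencil_det (L + gram_pencil n r c ps)) \<le> 1"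
    unfolding Let_def by blast
  define K where "K = L + gram_pencil n r c ps"
  note ps = ps[folded K_def]
  have symK: "K \<in> symmetric_pencils n" unfolding K_def by (rule symmetric_pencils_add_gram[OF sym])
  note LK = symmetric_pencils_subset[OF symK]
  have K0: "pencil_det K \<noteq> 0" using ps(1) by auto
  let ?Z = "Z \<union> {z. poly (pencil_det K) z = 0}"
  have "pencil_det L \<noteq> 0" using c by auto
  then have finZ: "finite ?Z" unfolding Z_def using K0 by (simp add: poly_roots_finite)
  have cZ: "c \<notin> ?Z" using c ps(1) by (simp add: Z_def)
  obtain p where p: "poly (pencil_det (K + rank_one_pencil n (-c) 1 p)) c \<noteq> 0"
    "\<And>z. z \<in> ?Z \<Longrightarrow> finite_partial_mults (K + rank_one_pencil n (-c) 1 p) z = drop 1 (finite_partial_mults K z)"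
    "finite_partial_mults (rev_pencil (K + rank_one_pencil n (-c) 1 p)) 0 = drop 1 (finite_partial_mults (rev_pencil K) 0)"
    "\<And>w. w \<notin> ?Z \<Longrightarrow> order w (pencil_det (K + rank_one_pencil n (-c) 1 p)) \<le> 1"
    using rank_one_step[OF symK ps(1) finZ cZ] by blast
  define ps' where "ps' = ps(r := p)"
  have eq: "L + gram_pencil n (Suc r) c ps' = K + rank_one_pencil n (-c) 1 p"
  proof -
    have "M + d \<cdot>\<^sub>m gram n (Suc r) ps' = (M + d \<cdot>\<^sub>m gram n r ps) + d \<cdot>\<^sub>m outer n p"
      if "M \<in> carrier_mat n n" for M d
      using that by (intro eq_matI) (auto simp: gram_def outer_def ps'_def algebra_simps)
    then show ?thesis using symmetric_pencils_subset[OF sym]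
      by (cases L) (auto simp: K_def rank_one_pencil_def plus_prod_def)
  qed
  have KE: "K + rank_one_pencil n (-c) 1 p \<in> pencils n" by (rule pencils_add[OF LK rank_one_pencil_carrier])
  have KE0: "pencil_det (K + rank_one_pencil n (-c) 1 p) \<noteq> 0" using p(1) by auto
  have "order w (pencil_det (K + rank_one_pencil n (-c) 1 p)) \<le> 1" if w: "w \<notin> Z" for w
  proof (cases "poly (pencil_det K) w = 0")
    case True
    have "sum_list (finite_partial_mults K w) \<le> 1"
      using ps(4)[OF w] by (simp add: sum_partial_mults[OF LK K0])
    moreover have "sum_list (drop 1 xs) \<le> sum_list xs" for xs :: "nat list" by (cases xs) auto
    ultimately have "sum_list (finite_partial_mults (K + rank_one_pencil n (-c) 1 p) w) \<le> 1"
      using p(2)[of w] True order_trans by fastforce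
    then show ?thesis by (simp add: sum_partial_mults[OF KE KE0])
  next
    case False
    then show ?thesis using p(4)[of w] w by blast
  qed
  then show ?case
    by (intro exI[of _ ps']) (simp add: Let_def eq p(1,2,3) ps(2,3))
qed

section \<open>The parametrisation\<close>

definition phi_mat :: "nat \<Rightarrow> nat \<Rightarrow> nat \<Rightarrow> (nat \<Rightarrow> complex) \<Rightarrow> (nat \<Rightarrow> complex vec) \<Rightarrow>
    (nat \<Rightarrow> complex vec) \<Rightarrow> (nat \<Rightarrow> complex vec) \<Rightarrow> complex mat" where
  "phi_mat n l s c u v w = mat n n (\<lambda>(p, q). (\<Sum>i<l. c i * (u i $ p * u i $ q)) +
     (\<Sum>j<s. v j $ p * w j $ q + w j $ p * v j $ q))"

lemma Phi_altdef:
  defines "B \<equiv> \<lambda>n r s x. nth_block n (r - 2 * s) x"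
  shows "Phi n r s x =
    (phi_mat n (r - 2 * s) s (\<lambda>i. x $ (2 * i)) (B n r s x)
       (\<lambda>j. B n r s x (r - 2 * s + j)) (\<lambda>j. B n r s x (r - 2 * s + s + j)),
     phi_mat n (r - 2 * s) s (\<lambda>i. x $ (2 * i + 1)) (B n r s x)
       (\<lambda>j. B n r s x (r - 2 * s + j)) (\<lambda>j. B n r s x (r - 2 * s + 2 * s + j)))"
  unfolding Phi_def phi_mat_def B_def by (simp add: Let_def)

lemma phi_mat_carrier: "phi_mat n l s c u v w \<in> carrier_mat n n"
  by (simp add: phi_mat_def)

lemma Phi_carrier: "Phi n r s x \<in> pencils n"
  by (simp add: Phi_altdef phi_mat_carrier)

lemma sum_pCons2: "(\<Sum>i\<in>A. [:f i, g i:]) = [:\<Sum>i\<in>A. f i, \<Sum>i\<in>A. g i:]"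
  for f :: "'a \<Rightarrow> 'b :: comm_monoid_add"
  by (induction A rule: infinite_finite_induct) auto

lemma rank_le_phi_mat: "rank_le n (l + s + s) (phi_mat n l s a u v w, phi_mat n l s b u v w')"
proof -
  let ?W = "\<lambda>j p. [:w j $ p, w' j $ p:]"
  define U where "U k p = (if k < l then [:a k, b k:] * [:u k $ p:]
     else if k < l + s then [:v (k - l) $ p:] else ?W (k - l - s) p)" for k p
  define V where "V k p = (if k < l then [:u k $ p:]
     else if k < l + s then ?W (k - l) p else [:v (k - l - s) $ p:])" for k p
  have "pencil_mat (phi_mat n l s a u v w, phi_mat n l s b u v w') $$ (p, q) = (\<Sum>k<l + s + s. U k p * V k q)"
    if pq: "p < n" "q < n" for p q
  proof -
    have "(\<Sum>k<l + s + s. U k p * V k q) =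
      (\<Sum>i<l. [:a i * (u i $ p * u i $ q), b i * (u i $ p * u i $ q):]) +
      ((\<Sum>j<s. [:v j $ p * w j $ q, v j $ p * w' j $ q:]) + (\<Sum>j<s. [:w j $ p * v j $ q, w' j $ p * v j $ q:]))"
      unfolding sum_lessThan_add add.assoc
      by (intro arg_cong2[where f = "(+)"] sum.cong refl) (auto simp: U_def V_def mult_ac)
    also have "\<dots> = pencil_mat (phi_mat n l s a u v w, phi_mat n l s b u v w') $$ (p, q)"
      using pq by (simp add: sum_pCons2 pencil_mat_def phi_mat_def sum.distrib add.assoc)
    finally show ?thesis by (rule sym)
  qed
  then show ?thesis unfolding rank_le_def by blast
qed

lemma rank_le_Phi:
  assumes "s \<le> r div 2"
  shows "rank_le n r (Phi n r s x)" "rank_le n r (rev_pencil (Phi n r s x))"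
proof -
  have r: "r - 2 * s + s + s = r" using assms by simp
  show "rank_le n r (Phi n r s x)" "rank_le n r (rev_pencil (Phi n r s x))"
    unfolding Phi_altdef rev_pencil_def prod.case
    by (rule rank_le_phi_mat[of n "r - 2 * s" s, unfolded r])+
qed

lemma polyfun_Phi:
  assumes s: "s \<le> r div 2" and pq: "p < n" "q < n"
  defines "m \<equiv> 2 * (r - 2 * s) + (r + s) * n"
  shows "polyfun m (\<lambda>x. fst (Phi n r s x) $$ (p, q))" "polyfun m (\<lambda>x. snd (Phi n r s x) $$ (p, q))"
proof -
  have blk: "polyfun m (\<lambda>x. nth_block n (r - 2 * s) x k $ i)" if "k < r + s" "i < n" for k i
  proof -
    have "k * n + i < (k + 1) * n" using that by simp
    also have "\<dots> \<le> (r + s) * n" using that by (intro mult_le_mono1) simp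
    finally have "2 * (r - 2 * s) + k * n + i < m" by (simp add: m_def)
    then show ?thesis using that by (simp add: nth_block_def polyfun_coord)
  qed
  have coord: "polyfun m (\<lambda>x. x $ (2 * i))" "polyfun m (\<lambda>x. x $ (2 * i + 1))" if "i < r - 2 * s" for i
    using that by (auto intro!: polyfun_coord simp: m_def)
  show "polyfun m (\<lambda>x. fst (Phi n r s x) $$ (p, q))" "polyfun m (\<lambda>x. snd (Phi n r s x) $$ (p, q))"
    unfolding Phi_altdef fst_conv snd_conv phi_mat_def index_mat(1)[OF pq] prod.case
    using s pq by (auto intro!: polyfun_add polyfun_sum polyfun_mult coord blk simp del: One_nat_def)
qed

lemma sum_pairs: "(\<Sum>j<s. f (l + 2 * j) + f (l + 2 * j + 1)) = (\<Sum>i<2 * s. f (l + i))"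
  for f :: "nat \<Rightarrow> 'a :: comm_monoid_add"
  by (induction s) (auto simp: add.assoc)

text \<open>
Over the complex numbers a pair of squares \<open>p p\<^sup>T + q q\<^sup>T\<close> is also of the form \<open>v \<delta>\<^sup>T + \<delta> v\<^sup>T\<close>. Therefore the
perturbations of rank \<open>r\<close> constructed above occur in the range of the parametrisation for every \<open>s\<close>.
\<close>

lemma Phi_attains_gram:
  assumes s: "s \<le> r div 2"
  shows "\<exists>x \<in> carrier_vec (2 * (r - 2 * s) + (r + s) * n).
    Phi n r s x = gram_pencil n r c ps"
proof -
  define l where "l = r - 2 * s"
  have r: "r = l + 2 * s" using s by (simp add: l_def)
  let ?m = "2 * l + (r + s) * n"
  \<comment> \<open>\<open>v \<delta>\<^sup>T + \<delta> v\<^sup>T = p p\<^sup>T + q q\<^sup>T\<close> for \<open>v = p + i q\<close> and \<open>\<delta> = (p - i q) / 2\<close>\<close>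
  define v where "v j p = ps (l + 2 * j) p + \<i> * ps (l + 2 * j + 1) p" for j p
  define \<delta> where "\<delta> j p = (ps (l + 2 * j) p - \<i> * ps (l + 2 * j + 1) p) / 2" for j p
  define blk where "blk k p = (if k < l then ps k p else if k < l + s then v (k - l) p
    else if k < l + 2 * s then -c * \<delta> (k - l - s) p else \<delta> (k - l - 2 * s) p)" for k p
  define x where "x = vec ?m (\<lambda>i. if i < 2 * l then (if even i then -c else 1)
    else blk ((i - 2 * l) div n) ((i - 2 * l) mod n))"
  have block: "nth_block n l x k = vec n (blk k)" if k: "k < r + s" for k
  proof (intro eq_vecI)
    fix p assume "p < dim_vec (vec n (blk k))"
    then have p: "p < n" by simp
    have "k * n + p < (k + 1) * n" using p by simp
    also have "\<dots> \<le> (r + s) * n" using k by (intro mult_le_mono1) simp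
    finally have "2 * l + k * n + p < ?m" by simp
    then show "nth_block n l x k $ p = vec n (blk k) $ p" using p by (simp add: nth_block_def x_def add.assoc)
  qed (simp add: nth_block_def)
  have a: "x $ (2 * i) = -c" "x $ (2 * i + 1) = 1" if "i < l" for i
    using that by (auto simp: x_def)
  have pair: "v j p * \<delta> j q + \<delta> j p * v j q =
    ps (l + 2 * j) p * ps (l + 2 * j) q + ps (l + 2 * j + 1) p * ps (l + 2 * j + 1) q" for j p q
    by (simp add: v_def \<delta>_def field_simps)
  have gram: "(\<Sum>k<r. ps k p * ps k q) = (\<Sum>i<l. ps i p * ps i q) + (\<Sum>j<s. v j p * \<delta> j q + \<delta> j p * v j q)" for p q
    unfolding pair unfolding sum_pairs[of "\<lambda>k. ps k p * ps k q"] r sum_lessThan_add ..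
  have "Phi n r s x = gram_pencil n r c ps"
    unfolding Phi_altdef l_def[symmetric]
  proof (intro prod.inject[THEN iffD2] conjI eq_matI)
    fix p q assume "p < dim_row (- c \<cdot>\<^sub>m gram n r ps)" "q < dim_col (- c \<cdot>\<^sub>m gram n r ps)"
    then have pq: "p < n" "q < n" by (auto simp: gram_def)
    have "(\<Sum>i<l. x $ (2 * i) * (nth_block n l x i $ p * nth_block n l x i $ q)) = -c * (\<Sum>i<l. ps i p * ps i q)"
      unfolding sum_distrib_left using pq by (intro sum.cong refl) (simp add: a block blk_def r)
    moreover have "(\<Sum>j<s. nth_block n l x (l + j) $ p * nth_block n l x (l + s + j) $ q +
        nth_block n l x (l + s + j) $ p * nth_block n l x (l + j) $ q) = -c * (\<Sum>j<s. v j p * \<delta> j q + \<delta> j p * v j q)"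
      unfolding sum_distrib_left using pq by (intro sum.cong refl) (simp add: block blk_def r algebra_simps)
    ultimately show "phi_mat n l s (\<lambda>i. x $ (2 * i)) (nth_block n l x) (\<lambda>j. nth_block n l x (l + j))
        (\<lambda>j. nth_block n l x (l + s + j)) $$ (p, q) = (- c \<cdot>\<^sub>m gram n r ps) $$ (p, q)"
      using pq by (simp add: phi_mat_def gram_def gram distrib_left)
  next
    fix p q assume "p < dim_row (1 \<cdot>\<^sub>m gram n r ps)" "q < dim_col (1 \<cdot>\<^sub>m gram n r ps)"
    then have pq: "p < n" "q < n" by (auto simp: gram_def)
    have "(\<Sum>i<l. x $ (2 * i + 1) * (nth_block n l x i $ p * nth_block n l x i $ q)) = (\<Sum>i<l. ps i p * ps i q)"
    proof (intro sum.cong refl)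
      fix i assume "i \<in> {..<l}"
      then have "i < l" by simp
      then show "x $ (2 * i + 1) * (nth_block n l x i $ p * nth_block n l x i $ q) = ps i p * ps i q"
        unfolding a(2)[OF \<open>i < l\<close>] using pq by (simp add: block blk_def r)
    qed
    moreover have "(\<Sum>j<s. nth_block n l x (l + j) $ p * nth_block n l x (l + 2 * s + j) $ q +
        nth_block n l x (l + 2 * s + j) $ p * nth_block n l x (l + j) $ q) = (\<Sum>j<s. v j p * \<delta> j q + \<delta> j p * v j q)"
      using pq by (intro sum.cong refl) (simp add: block blk_def r)
    ultimately show "phi_mat n l s (\<lambda>i. x $ (2 * i + 1)) (nth_block n l x) (\<lambda>j. nth_block n l x (l + j))
        (\<lambda>j. nth_block n l x (l + 2 * s + j)) $$ (p, q) = (1 \<cdot>\<^sub>m gram n r ps) $$ (p, q)"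
      using pq by (simp add: phi_mat_def gram_def gram)
  qed (auto simp: phi_mat_def gram_def)
  moreover have "x \<in> carrier_vec ?m" by (simp add: x_def)
  ultimately show ?thesis unfolding l_def by blast
qed

section \<open>The generic behaviour\<close>

lemma order_prod_linear_powers:
  assumes "finite Z" "z \<in> Z"
  shows "order z (\<Prod>y\<in>Z. [:-y, 1 :: complex:] ^ N y) = N z"
proof -
  let ?R = "\<Prod>y\<in>Z - {z}. [:-y, 1:] ^ N y"
  have "(\<Prod>y\<in>Z. [:-y, 1:] ^ N y) = [:-z, 1:] ^ N z * ?R" by (rule prod.remove[OF assms])
  moreover have R: "poly ?R z \<noteq> 0" using assms(1) by (auto simp: poly_prod)
  then have "[:-z, 1:] ^ N z * ?R \<noteq> 0" by auto
  then have "order z ([:-z, 1:] ^ N z * ?R) = order z ([:-z, 1:] ^ N z) + order z ?R" by (rule order_mult)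
  ultimately show ?thesis using order_0I[OF R] by (simp only: order_power_n_n add_0_right)
qed

theorem theorem18:
  fixes L :: pencil and n r s :: nat
  assumes "L \<in> symmetric_pencils n"
    and "regular_pencil L"
    and "r > 0"
    and "s \<le> r div 2"
  shows "\<exists>G. generic (2 * (r - 2 * s) + (r + s) * n) G \<and>
    (\<forall>E \<in> Phi n r s ` G.
       regular_pencil (L + E) \<and>
       (\<forall>z \<in> eigenvalues_of L.
          partial_mults (L + E) z = drop r (partial_mults L z) \<and>
          (r \<ge> length (partial_mults L z) \<longrightarrow> z \<notin> eigenvalues_of (L + E))) \<and>
       (\<forall>z \<in> eigenvalues_of (L + E) - eigenvalues_of L. simple_eigenvalue (L + E) z))"
proof -
  note sym = assms(1) and s = assms(4)
  have D: "pencil_det L \<noteq> 0" using assms(2) by (simp add: regular_pencil_def)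
  note L = symmetric_pencils_subset[OF sym]
  have D': "pencil_det (rev_pencil L) \<noteq> 0" using pencil_det_rev_eq_0_iff[OF L] D by simp
  define k where "k = 2 * (r - 2 * s) + (r + s) * n"
  define Z where "Z = {z. poly (pencil_det L) z = 0}"
  have Z: "finite Z" unfolding Z_def by (rule poly_roots_finite[OF D])
  define N where "N z = sum_list (drop r (finite_partial_mults L z))" for z
  define N' where "N' = sum_list (drop r (finite_partial_mults (rev_pencil L) 0))"
  define G where "G = (\<Prod>z\<in>Z. [:-z, 1:] ^ N z)"
  have G0: "poly G w \<noteq> 0" if "w \<notin> Z" for w
    unfolding G_def using that Z by (auto simp: poly_prod)
  have G: "G \<noteq> 0" unfolding G_def using Z by auto
  \<comment> \<open>the degree that remains for the other finite eigenvalues\<close>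
  define d where "d = n - N' - degree G"
  define F where "F x = pencil_det (L + Phi n r s x)" for x
  define h where "h x = F x div G" for x
  note LE = pencils_add[OF L Phi_carrier[of n r s]]
  have rev: "rev_pencil (L + Phi n r s x) = rev_pencil L + rev_pencil (Phi n r s x)" for x
    by (rule rev_pencil_add)
  note fin_lace = partial_mults_interlacing[OF L D Phi_carrier rank_le_Phi(1)[OF s]]
  note inf_lace = partial_mults_interlacing[OF rev_pencil_carrier[OF L] D' rev_pencil_carrier[OF Phi_carrier] rank_le_Phi(2)[OF s]]
  have F_rev: "pencil_det (rev_pencil L + rev_pencil (Phi n r s x)) \<noteq> 0" if "F x \<noteq> 0" for x
    using that pencil_det_rev_eq_0_iff[OF LE] unfolding F_def rev[symmetric] by simp
  have FGh: "F x = G * h x" for x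
  proof -
    have "G dvd F x"
    proof (cases "F x = 0")
      case False
      show ?thesis unfolding G_def
      proof (rule prod_linear_power_dvd[OF Z])
        fix z
        have "N z \<le> order z (F x)"
          using fin_lace(1)[of x z] False unfolding N_def F_def by blast
        then show "[:- z, 1:] ^ N z dvd F x" using order_divides by blast
      qed
    qed simp
    then show ?thesis by (simp add: h_def)
  qed
  have deg: "degree (F x) + order 0 (pencil_det (rev_pencil (L + Phi n r s x))) = n"
    "N' \<le> order 0 (pencil_det (rev_pencil (L + Phi n r s x)))"
    "degree (F x) = degree G + degree (h x)" if x: "F x \<noteq> 0" for x
  proof -
    show "degree (F x) + order 0 (pencil_det (rev_pencil (L + Phi n r s x))) = n"
      unfolding F_def by (rule degree_pencil_det_rev[OF LE]) (use x in \<open>simp add: F_def\<close>)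
    show "N' \<le> order 0 (pencil_det (rev_pencil (L + Phi n r s x)))"
      unfolding N'_def rev by (rule inf_lace(1)[OF F_rev[OF x]])
    show "degree (F x) = degree G + degree (h x)"
      unfolding FGh using x G by (intro degree_mult_eq) (auto simp: FGh)
  qed
  \<comment> \<open>Nonvanishing of the three factors settles, in turn, the multiplicities at the finite
      eigenvalues of \<open>L\<close>, those at infinity through the degree, and the simplicity of the other
      eigenvalues. For \<open>d = 0\<close> the quotient is a constant and has no roots.\<close>
  define f where "f x = (\<Prod>z\<in>Z. poly (h x) z) * coeff (h x) d *
    (if d = 0 then 1 else det (sylvester_deriv d (h x)))" for x
  have "polyfun k f"
  proof -
    obtain A B where AB: "L = (A, B)" "A \<in> carrier_mat n n" "B \<in> carrier_mat n n" using L by auto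
    have degF: "degree (F x) \<le> n" for x unfolding F_def by (rule degree_pencil_det[OF LE])
    have "ppolyfun k F" unfolding F_def pencil_det_pencil_mat
    proof (rule ppolyfun_det[of _ n])
      show "pencil_mat (L + Phi n r s x) \<in> carrier_mat n n" for x by (rule pencil_mat_carrier[OF LE])
      fix i j assume ij: "i < n" "j < n"
      have "pencil_mat (L + Phi n r s x) $$ (i, j) =
        [:A $$ (i, j) + fst (Phi n r s x) $$ (i, j), B $$ (i, j) + snd (Phi n r s x) $$ (i, j):]" for x
        using ij AB Phi_carrier[of n r s x] by (cases "Phi n r s x") (auto simp: pencil_mat_def plus_prod_def)
      then show "ppolyfun k (\<lambda>x. pencil_mat (L + Phi n r s x) $$ (i, j))"
        unfolding k_def using polyfun_Phi[OF s ij]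
        by (simp add: ppolyfun_linear polyfun_add polyfun_const)
    qed
    then have h: "ppolyfun k h" unfolding h_def using ppolyfun_div degF by blast
    have degh: "degree (h x) \<le> n" for x
    proof (cases "F x = 0")
      case False
      then show ?thesis using deg(3)[of x] degF[of x] by simp
    qed (simp add: h_def)
    have "polyfun k (\<lambda>x. if d = 0 then 1 else det (sylvester_deriv d (h x)))"
      using polyfun_det_sylvester_deriv[OF h, of d] by (cases "d = 0") (simp_all add: polyfun_const)
    moreover have "polyfun k (\<lambda>x. coeff (h x) d)" using h by (simp add: ppolyfun_def)
    ultimately show ?thesis unfolding f_def
      by (intro polyfun_mult polyfun_prod polyfun_poly[OF h degh])
  qed
  moreover have "\<exists>x0 \<in> carrier_vec k. f x0 \<noteq> 0"
  proof -
    obtain c where c: "poly (pencil_det L) c \<noteq> 0" using D poly_all_0_iff_0 by blast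
    obtain ps where ps: "poly (pencil_det (L + gram_pencil n r c ps)) c \<noteq> 0"
      "\<And>z. z \<in> Z \<Longrightarrow> finite_partial_mults (L + gram_pencil n r c ps) z = drop r (finite_partial_mults L z)"
      "finite_partial_mults (rev_pencil (L + gram_pencil n r c ps)) 0 = drop r (finite_partial_mults (rev_pencil L) 0)"
      "\<And>w. w \<notin> Z \<Longrightarrow> order w (pencil_det (L + gram_pencil n r c ps)) \<le> 1"
      using rank_r_perturbation_exists[OF sym c, of r] unfolding Z_def Let_def by blast
    obtain x0 where x0: "x0 \<in> carrier_vec k" "Phi n r s x0 = gram_pencil n r c ps"
      using Phi_attains_gram[OF s] unfolding k_def by blast
    note ps = ps[folded x0(2)]
    have F0: "F x0 \<noteq> 0" using ps(1) unfolding F_def by auto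
    then have h0: "h x0 \<noteq> 0" using FGh[of x0] by auto
    have reg: "pencil_det (L + Phi n r s x0) \<noteq> 0" using F0 by (simp add: F_def)
    have reg': "pencil_det (rev_pencil (L + Phi n r s x0)) \<noteq> 0" using F_rev[OF F0] by (simp add: rev)
    have ordN: "order z (F x0) = N z" if "z \<in> Z" for z
      unfolding F_def sum_partial_mults[OF LE reg, symmetric] N_def ps(2)[OF that] ..
    have "order 0 (pencil_det (rev_pencil (L + Phi n r s x0))) = N'"
      unfolding sum_partial_mults[OF rev_pencil_carrier[OF LE] reg', symmetric] N'_def ps(3) ..
    then have dh: "degree (h x0) = d" using deg[OF F0] by (simp add: d_def)
    have hz: "poly (h x0) z \<noteq> 0" if z: "z \<in> Z" for z
    proof -
      have "order z (F x0) = order z G + order z (h x0)"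
        unfolding FGh[of x0] by (rule order_mult) (use F0 FGh[of x0] in simp)
      then have "order z (h x0) = 0" using ordN[OF z] order_prod_linear_powers[OF Z z, of N] by (simp add: G_def)
      then show ?thesis using h0 by (simp add: order_root)
    qed
    have simple: "poly (pderiv (h x0)) w \<noteq> 0" if w: "poly (h x0) w = 0" for w
    proof -
      have "w \<notin> Z" using hz w by auto
      have "order w (F x0) = order w G + order w (h x0)"
        unfolding FGh[of x0] by (rule order_mult) (use F0 FGh[of x0] in simp)
      then have "order w (h x0) \<le> 1" using ps(4)[OF \<open>w \<notin> Z\<close>] by (simp add: F_def)
      then have "order w (pderiv (h x0)) = 0" using order_pderiv[OF h0 w] by simp
      moreover have "pderiv (h x0) \<noteq> 0"
      proof
        assume "pderiv (h x0) = 0"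
        then obtain a where "h x0 = [:a:]" using pderiv_iszero by blast
        then show False using w h0 by simp
      qed
      ultimately show ?thesis by (simp add: order_root)
    qed
    have "coeff (h x0) d \<noteq> 0" using dh h0 by auto
    moreover have "d \<noteq> 0 \<Longrightarrow> det (sylvester_deriv d (h x0)) \<noteq> 0"
      using sylvester_deriv_nonzero[OF dh _ simple] by simp
    ultimately have "f x0 \<noteq> 0" unfolding f_def using hz Z by auto
    then show ?thesis using x0 by blast
  qed
  ultimately have "generic k {x \<in> carrier_vec k. f x \<noteq> 0}" using generic_nonvanishing by blast
  moreover have "regular_pencil (L + E) \<and>
       (\<forall>z \<in> eigenvalues_of L.
          partial_mults (L + E) z = drop r (partial_mults L z) \<and>
          (r \<ge> length (partial_mults L z) \<longrightarrow> z \<notin> eigenvalues_of (L + E))) \<and>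
       (\<forall>z \<in> eigenvalues_of (L + E) - eigenvalues_of L. simple_eigenvalue (L + E) z)"
    if "E \<in> Phi n r s ` {x \<in> carrier_vec k. f x \<noteq> 0}" for E
  proof -
    obtain x where E: "E = Phi n r s x" and fx: "f x \<noteq> 0" using \<open>E \<in> _\<close> by blast
    have hz: "poly (h x) z \<noteq> 0" if "z \<in> Z" for z using fx that Z unfolding f_def by auto
    have hd: "coeff (h x) d \<noteq> 0" using fx unfolding f_def by auto
    then have h0: "h x \<noteq> 0" by auto
    then have F0: "F x \<noteq> 0" using FGh G by simp
    have reg: "pencil_det (L + E) \<noteq> 0" using F0 by (simp add: F_def E)
    have LEx: "L + E \<in> pencils n" unfolding E by (rule LE)
    have reg': "pencil_det (rev_pencil (L + E)) \<noteq> 0" using F_rev[OF F0] by (simp add: rev E)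
    have "d \<le> degree (h x)" using hd by (rule le_degree)
    then have dh: "degree (h x) = d" and ord': "order 0 (pencil_det (rev_pencil (L + E))) \<le> N'"
      using deg[OF F0] unfolding d_def E by auto
    have ordG: "order z (F x) = order z G + order z (h x)" for z
      unfolding FGh[of x] by (rule order_mult) (use F0 FGh[of x] in simp)
    have fin: "finite_partial_mults (L + E) z = drop r (finite_partial_mults L z)" if z: "z \<in> Z" for z
      unfolding E
    proof (rule fin_lace(2))
      show "pencil_det (L + Phi n r s x) \<noteq> 0" using reg by (simp add: E)
      have "order z (F x) = N z"
        using ordG[of z] order_prod_linear_powers[OF Z z, of N] hz[OF z] by (simp add: G_def order_0I)
      then show "order z (pencil_det (L + Phi n r s x)) \<le> sum_list (drop r (finite_partial_mults L z))"
        by (simp add: F_def N_def)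
    qed
    have inf: "finite_partial_mults (rev_pencil (L + E)) 0 = drop r (finite_partial_mults (rev_pencil L) 0)"
      unfolding E rev
      by (rule inf_lace(2)[OF F_rev[OF F0]]) (use ord' in \<open>simp add: E rev N'_def\<close>)
    have eig_fin: "poly (pencil_det (L + E)) z = 0 \<longleftrightarrow> finite_partial_mults (L + E) z \<noteq> []" for z
      using sum_partial_mults[OF LEx reg, of z] partial_mults_pos[OF LEx reg, of z] reg
      by (cases "finite_partial_mults (L + E) z") (auto simp: order_root)
    note LE' = rev_pencil_carrier[OF LEx]
    have eig_inf: "poly (pencil_det (rev_pencil (L + E))) 0 = 0 \<longleftrightarrow> finite_partial_mults (rev_pencil (L + E)) 0 \<noteq> []"
      using sum_partial_mults[OF LE' reg', of 0] partial_mults_pos[OF LE' reg', of 0] reg'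
      by (cases "finite_partial_mults (rev_pencil (L + E)) 0") (auto simp: order_root)
    have old: "partial_mults (L + E) z = drop r (partial_mults L z) \<and>
          (r \<ge> length (partial_mults L z) \<longrightarrow> z \<notin> eigenvalues_of (L + E))" if "z \<in> eigenvalues_of L" for z
    proof (cases z)
      case (Finite y)
      then have "y \<in> Z" using that by (simp add: eigenvalues_of_def Z_def)
      then show ?thesis using fin[of y] eig_fin[of y] by (simp add: Finite eigenvalues_of_def)
    next
      case Infinity
      then show ?thesis using inf eig_inf by (simp add: eigenvalues_of_def)
    qed
    have new: "simple_eigenvalue (L + E) z" if "z \<in> eigenvalues_of (L + E) - eigenvalues_of L" for z
    proof (cases z)
      case (Finite w)
      have w: "poly (F x) w = 0" "w \<notin> Z" using that by (auto simp: Finite eigenvalues_of_def Z_def F_def E)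
      then have hw: "poly (h x) w = 0" using G0 unfolding FGh by simp
      have d: "d > 0"
      proof (rule ccontr)
        assume "\<not> d > 0"
        then obtain a where "h x = [:a:]" using dh by (metis degree_eq_zeroE not_gr_zero)
        then show False using hw h0 by simp
      qed
      then have "det (sylvester_deriv d (h x)) \<noteq> 0" using fx unfolding f_def by auto
      then have "poly (pderiv (h x)) w \<noteq> 0" using sylvester_deriv_simple_roots[OF _ d _ hw] dh by simp
      then have "order w (h x) \<le> 1" by (intro order_le_1) simp
      then have "order w (F x) \<le> 1" using ordG[of w] G0[OF w(2)] by (simp add: order_0I)
      moreover have "order w (F x) \<noteq> 0" using w F0 by (simp add: order_root)
      ultimately have "order w (pencil_det (L + E)) = 1" by (simp add: F_def E)
      then have "alg_mult (L + E) z = 1"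
        by (simp add: alg_mult_def Finite sum_partial_mults[OF LEx reg])
      then show ?thesis using that by (simp add: simple_eigenvalue_def eigenvalues_of_def)
    next
      case Infinity
      have "poly (pencil_det (rev_pencil L)) 0 \<noteq> 0" using that by (simp add: Infinity eigenvalues_of_def)
      then have "order 0 (pencil_det (rev_pencil L)) = 0" by (rule order_0I)
      then have "finite_partial_mults (rev_pencil L) 0 = []"
        using sum_partial_mults[OF rev_pencil_carrier[OF L] D', of 0] partial_mults_pos[OF rev_pencil_carrier[OF L] D', of 0]
        by (cases "finite_partial_mults (rev_pencil L) 0") auto
      then have False using that inf eig_inf by (simp add: Infinity eigenvalues_of_def)
      then show ?thesis ..
    qed
    show ?thesis using reg old new by (simp add: regular_pencil_def)
  qed
  ultimately show ?thesis unfolding k_def by blast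
qed

end
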